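(* Let $(\boldsymbol{u},\boldsymbol{\sigma})$ solve the continuous elasticity problem, let $(\boldsymbol{u}_h,\boldsymbol{\sigma}_h)\in V_h\times S_h^g$ solve the discrete mixed problem, let $(\boldsymbol{r}_h,\boldsymbol{w}_h)\in (I-P_h)V_h^{l+1}\times V_h^{l}$ solve the local residual minimization system, and let $\boldsymbol{z}_h\in V_h^{l+1}$ solve the auxiliary local problem. Assume the saturation assumption: there exists $\delta\in[0,1)$, independent of $h$ and of $\mu,\lambda$ within any fixed range bounded away from the incompressible limit, such that $$\|\varepsilon(\boldsymbol{u}-\boldsymbol{z}_h)\|_0\le\delta\,\|\varepsilon(\boldsymbol{u}-\boldsymbol{w}_h)\|_0 .$$ Then there is a constant $C>0$, independent of $h$ (it may depend on $\mu,\lambda$), such that $$\mu^{-1/2}\|\boldsymbol{\sigma}-\boldsymbol{\sigma}_h\|_0+\mu^{1/2}\|\boldsymbol{u}-\boldsymbol{w}_h\|_h\le C\,\eta_h .$$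
   Context: Let $d\in\{2,3\}$ and let $\Omega\subset\mathbb{R}^d$ be a polygonal/polyhedral domain with boundary $\Gamma$ split into disjoint parts $\Gamma_D,\Gamma_N$, $|\Gamma_D|>0$. $(\cdot,\cdot)_K$ and $\|\cdot\|_K$ are the $L^2(K)$ inner product and norm; without subscript $K$ (norm $\|\cdot\|_0$) they are over $\Omega$. On piecewise polynomial functions $\varepsilon$ is applied elementwise. $\varepsilon(\boldsymbol{v})=\frac12(\nabla\boldsymbol{v}+(\nabla\boldsymbol{v})^{T})$. With Lamé parameters $\mu,\lambda>0$, $\mathcal{C}\boldsymbol{\tau}=\frac1{2\mu}\big(\boldsymbol{\tau}-\frac{\lambda}{2\mu+d\lambda}\mathrm{tr}(\boldsymbol{\tau})I\big)$. The incompressible limit is $\lambda\to\infty$. Continuous problem. Given a load $\boldsymbol{f}$ and a traction $\boldsymbol{g}$, find $\boldsymbol{u}\in[H^1_D(\Omega)]^d$ ($H^1$ functions vanishing on $\Gamma_D$) and a symmetric $\boldsymbol{\sigma}$ with $\mathcal{C}\boldsymbol{\sigma}-\varepsilon(\boldsymbol{u})=\boldsymbol{0}$ and $-\mathrm{div}\,\boldsymbol{\sigma}=\boldsymbol{f}$ in $\Omega$, $\boldsymbol{u}=\boldsymbol{0}$ on $\Gamma_D$, $\boldsymbol{\sigma}\boldsymbol{n}=\boldsymbol{g}$ on $\Gamma_N$. Mesh and discrete spaces. $\mathcal{T}_h$ is a triangular/tetrahedral mesh of $\Omega$ with mesh parameter $h$. $H(\mathrm{div};\Omega)$ is the space of symmetric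 $L^2$ matrix fields with row-wise divergence in $L^2$. One of the following exactly symmetric mixed element families is fixed: Arnold–Douglas–Gupta (ADG, triangles, 1984), Guzmán–Neilan (GN, triangles, 2014), Arnold–Awanou–Winther (AAW, tetrahedra, 2008), each of degree $k\ge2$, or the linear Johnson–Mercier method (JM, triangles, 1978). $V_h$ is the space of $\boldsymbol{v}\in[L^2(\Omega)]^d$ with $\boldsymbol{v}|_K\in V(K)$ for all $K\in\mathcal{T}_h$, where $V(K)=[P_{k-1}(K)]^d$ for ADG, GN, AAW and $V(K)=[P_1(K)]^d$ for JM. $S_h$ is the space of $\boldsymbol{\tau}\in H(\mathrm{div};\Omega)$ with $\boldsymbol{\tau}|_K\in S(K)$ for all $K$, where $S(K)$ is the local space of symmetric matrix fields of the chosen family. For ADG, GN, AAW one has $[P_k(K)]^{d\times d}_{\mathrm{sym}}\subset S(K)$, local degrees of freedom $\int_K\boldsymbol{\tau}:\varepsilon(\boldsymbol{v})$, $\boldsymbol{v}\in[P_{k-1}(K)]^d$, and $\int_E\boldsymbol{\tau}\boldsymbol{n}\cdot\boldsymbol{v}$, $\boldsymbol{v}\in[P_k(E)]^d$, for each edge/face $E$ of $K$, and $\mathrm{div}\,S_h\subset V_h$. For JM, $S(K)$ consists of the symmetric, $H(\mathrm{div})$-conforming, piecewise linear fields on the Alfeld (barycentric) split of $K$. For edges/faces $E\subset\Gamma_N$, $Q_h|_E$ is the $L^2(E)$-projection onto $[P_k(E)]^d$ ($[P_1(E)]^d$ for JM). $S_h^g=\{\boldsymbol{\tau}\in S_h:\boldsymbol{\tau}\boldsymbol{n}=Q_h\boldsymbol{g}\text{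 on }\Gamma_N\}$, $S_h^0=\{\boldsymbol{\tau}\in S_h:\boldsymbol{\tau}\boldsymbol{n}=\boldsymbol{0}\text{ on }\Gamma_N\}$. The discrete mixed problem is: find $(\boldsymbol{\sigma}_h,\boldsymbol{u}_h)\in S_h^g\times V_h$ with $$(\mathcal{C}\boldsymbol{\sigma}_h,\boldsymbol{\tau})+(\boldsymbol{u}_h,\mathrm{div}\,\boldsymbol{\tau})+(\boldsymbol{v},\mathrm{div}\,\boldsymbol{\sigma}_h)+(\boldsymbol{f},\boldsymbol{v})=0\quad\forall(\boldsymbol{\tau},\boldsymbol{v})\in S_h^0\times V_h.$$ Local problems. $P_h:[L^2(\Omega)]^d\to V_h$ is the $L^2$-projection. $V_h^m=\{\boldsymbol{v}\in[L^2(\Omega)]^d:\boldsymbol{v}|_K\in[P_m(K)]^d\ \forall K\}$; $l=k+1$ for ADG, GN, AAW, and $l=2$ for JM; $|_K$ on a space denotes restrictions to $K$. The local residual minimization system: find $\boldsymbol{r}_h\in(I-P_h)V_h^{l+1}$, $\boldsymbol{w}_h\in V_h^l$ such that for each $K\in\mathcal{T}_h$ $$(\varepsilon(\boldsymbol{r}_h),\varepsilon(\boldsymbol{v}_K))_K+(\varepsilon(\boldsymbol{w}_h),\varepsilon(\boldsymbol{v}_K))_K=(\mathcal{C}\boldsymbol{\sigma}_h,\varepsilon(\boldsymbol{v}_K))_K\ \ \forall\boldsymbol{v}_K\in(I-P_h)V_h^{l+1}|_K,$$ $$(\varepsilon(\boldsymbol{v}_K),\varepsilon(\boldsymbol{r}_h))_K=0\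 \ \forall\boldsymbol{v}_K\in(I-P_h)V_h^{l}|_K,\qquad(\boldsymbol{w}_h,\boldsymbol{v}_K)_K=(\boldsymbol{u}_h,\boldsymbol{v}_K)_K\ \ \forall\boldsymbol{v}_K\in P_hV_h^{l}|_K.$$ The auxiliary local problem: find $\boldsymbol{z}_h\in V_h^{l+1}$ such that for each $K$ $$(\varepsilon(\boldsymbol{z}_h),\varepsilon(\boldsymbol{v}_K))_K=(\mathcal{C}\boldsymbol{\sigma}_h,\varepsilon(\boldsymbol{v}_K))_K\ \ \forall\boldsymbol{v}_K\in(I-P_h)V_h^{l+1}|_K,\qquad(\boldsymbol{z}_h,\boldsymbol{v}_K)_K=(\boldsymbol{u}_h,\boldsymbol{v}_K)_K\ \ \forall\boldsymbol{v}_K\in P_hV_h^{l+1}|_K.$$ Norm and indicator. $\mathcal{E}_h^0$ and $\mathcal{E}_h^D$ are the sets of interior edges/faces and of edges/faces on $\Gamma_D$; $\mathcal{E}_K^0,\mathcal{E}_K^D$ are those belonging to $\partial K$; $h_E$ is the size of $E$; $[\![\boldsymbol{v}]\!]|_E=\boldsymbol{v}|_{K^+}-\boldsymbol{v}|_{K^-}$ for $E$ shared by $K^+,K^-$. For piecewise polynomials and functions in $[H^1(\Omega)]^d$ (and sums), $$\|\boldsymbol{v}\|_h^2=\sum_{K}\|\varepsilon(\boldsymbol{v})\|_K^2+\sum_{E\in\mathcal{E}_h^0}h_E^{-1}\|[\![\boldsymbol{v}]\!]\|_E^2+\sum_{E\in\mathcal{E}_h^D}h_E^{-1}\|\boldsymbol{v}\|_E^2.$$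 $$\eta_K^2=\mu\|\varepsilon(\boldsymbol{r}_h)\|_K^2+\mu\|\mathcal{C}\boldsymbol{\sigma}_h-\varepsilon(\boldsymbol{w}_h)\|_K^2+\frac{\mu}{2}\sum_{E\in\mathcal{E}_K^0}h_E^{-1}\|[\![\boldsymbol{w}_h]\!]\|_E^2+\mu\sum_{E\in\mathcal{E}_K^D}h_E^{-1}\|\boldsymbol{w}_h\|_E^2,\qquad \eta_h=\Big(\sum_{K\in\mathcal{T}_h}\eta_K^2\Big)^{1/2}.$$ *)

theory Defs
  imports "HOL-Analysis.Analysis"
begin

type_synonym 'd vfield = "real^'d \<Rightarrow> real^'d"
type_synonym 'd mfield = "real^'d \<Rightarrow> real^'d^'d"


section \<open>Square-integrable functions and polynomials\<close>

definition square_integrable :: "'a measure \<Rightarrow> ('a \<Rightarrow> 'b::euclidean_space) \<Rightarrow> bool" where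
  "square_integrable M f \<longleftrightarrow> f \<in> borel_measurable M \<and> integrable M (\<lambda>x. (norm (f x))\<^sup>2)"

text \<open>On matrices the inner product of the library is the Frobenius product.\<close>

definition L2_inner :: "'a measure \<Rightarrow> ('a \<Rightarrow> 'b::euclidean_space) \<Rightarrow> ('a \<Rightarrow> 'b) \<Rightarrow> real" where
  "L2_inner M f g = (LINT x|M. f x \<bullet> g x)"

definition L2_norm :: "'a measure \<Rightarrow> ('a \<Rightarrow> 'b::euclidean_space) \<Rightarrow> real" where
  "L2_norm M f = sqrt (LINT x|M. (norm (f x))\<^sup>2)"

text \<open>Polynomial functions of total degree at most \<open>m\<close>, with vector or matrix coefficients
  \<open>c \<alpha>\<close> indexed by the multi-indices \<open>\<alpha>\<close>.\<close>

definition polys :: "nat \<Rightarrow> (real^'d \<Rightarrow> 'b::real_vector) set" where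
  "polys m = {p. \<exists>c. \<forall>x. p x =
     (\<Sum>\<alpha>\<in>{\<alpha>::'d \<Rightarrow> nat. (\<Sum>i\<in>UNIV. \<alpha> i) \<le> m}. (\<Prod>i\<in>UNIV. (x $ i) ^ \<alpha> i) *\<^sub>R c \<alpha>)}"

text \<open>The relation \<open>v|\<^sub>K \<in> P\<close> for \<open>L\<^sup>2\<close> functions, i.e. up to null sets.\<close>

definition restricts_to :: "(real^'d) set \<Rightarrow> (real^'d \<Rightarrow> 'b) \<Rightarrow> (real^'d \<Rightarrow> 'b) set \<Rightarrow> bool" where
  "restricts_to K v P \<longleftrightarrow> (\<exists>p\<in>P. AE x in lebesgue_on K. v x = p x)"


section \<open>Weak derivatives\<close>

definition C1_fun :: "(real^'d \<Rightarrow> real) \<Rightarrow> bool" where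
  "C1_fun \<phi> \<longleftrightarrow> (\<forall>x. \<phi> differentiable (at x)) \<and>
     (\<forall>e. continuous_on UNIV (\<lambda>x. frechet_derivative \<phi> (at x) e))"

definition partial :: "'d \<Rightarrow> (real^'d \<Rightarrow> real) \<Rightarrow> real^'d \<Rightarrow> real" where
  "partial j \<phi> x = frechet_derivative \<phi> (at x) (axis j 1)"

text \<open>Test functions are continuously differentiable with compact support; taking
  infinitely differentiable ones instead gives the same weak derivatives.\<close>

definition test_function :: "(real^'d) set \<Rightarrow> (real^'d \<Rightarrow> real) \<Rightarrow> bool" where
  "test_function D \<phi> \<longleftrightarrow> C1_fun \<phi> \<and> compact (closure {x. \<phi> x \<noteq> 0}) \<and> closure {x. \<phi> x \<noteq> 0} \<subseteq> D"

definition has_weak_grad :: "(real^'d) set \<Rightarrow> 'd vfield \<Rightarrow> 'd mfield \<Rightarrow> bool" where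
  "has_weak_grad D v G \<longleftrightarrow> square_integrable (lebesgue_on D) G \<and>
     (\<forall>\<phi> i j. test_function D \<phi> \<longrightarrow>
        (LINT x|lebesgue_on D. v x $ i * partial j \<phi> x) = - (LINT x|lebesgue_on D. G x $ i $ j * \<phi> x))"

definition has_weak_div :: "(real^'d) set \<Rightarrow> 'd mfield \<Rightarrow> 'd vfield \<Rightarrow> bool" where
  "has_weak_div D \<tau> w \<longleftrightarrow> square_integrable (lebesgue_on D) w \<and>
     (\<forall>\<phi> i. test_function D \<phi> \<longrightarrow>
        (LINT x|lebesgue_on D. (\<Sum>j\<in>UNIV. \<tau> x $ i $ j * partial j \<phi> x)) =
          - (LINT x|lebesgue_on D. w x $ i * \<phi> x))"

text \<open>These are determined almost everywhere on \<open>D\<close>.\<close>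

definition weak_grad :: "(real^'d) set \<Rightarrow> 'd vfield \<Rightarrow> 'd mfield" where
  "weak_grad D v = (SOME G. has_weak_grad D v G)"

definition weak_div :: "(real^'d) set \<Rightarrow> 'd mfield \<Rightarrow> 'd vfield" where
  "weak_div D \<tau> = (SOME w. has_weak_div D \<tau> w)"

definition H1 :: "(real^'d) set \<Rightarrow> 'd vfield set" where
  "H1 D = {v. square_integrable (lebesgue_on D) v \<and> (\<exists>G. has_weak_grad D v G)}"

definition Hdiv_sym :: "(real^'d) set \<Rightarrow> 'd mfield set" where
  "Hdiv_sym D = {\<tau>. square_integrable (lebesgue_on D) \<tau> \<and>
     (AE x in lebesgue_on D. transpose (\<tau> x) = \<tau> x) \<and> (\<exists>w. has_weak_div D \<tau> w)}"

definition eps :: "(real^'d) set \<Rightarrow> 'd vfield \<Rightarrow> 'd mfield" where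
  "eps D v x = (1/2) *\<^sub>R (weak_grad D v x + transpose (weak_grad D v x))"


section \<open>Facets, surface integrals and traces\<close>

text \<open>The \<open>(d-1)\<close>-dimensional surface measure on a set \<open>E\<close> spanning a hyperplane: the surface
  measure of \<open>A \<subseteq> E\<close> is the volume of the right cylinder of height \<open>1\<close> over \<open>A\<close>.\<close>

definition face_measure :: "(real^'d) set \<Rightarrow> (real^'d) measure" where
  "face_measure E =
     distr (lebesgue_on {x. closest_point (affine hull E) x \<in> E \<and> infdist x (affine hull E) \<le> 1/2})
       borel (closest_point (affine hull E))"

definition outer_normal :: "(real^'d) set \<Rightarrow> (real^'d) set \<Rightarrow> real^'d" where
  "outer_normal K E =
     (SOME n. norm n = 1 \<and> (\<exists>b. K \<subseteq> {x. n \<bullet> x \<le> b} \<and> E \<subseteq> {x. n \<bullet> x = b}))"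

definition facet_test_function :: "(real^'d) set \<Rightarrow> (real^'d) set \<Rightarrow> (real^'d \<Rightarrow> real) \<Rightarrow> bool" where
  "facet_test_function K E \<psi> \<longleftrightarrow> C1_fun \<psi> \<and> compact (closure {x. \<psi> x \<noteq> 0}) \<and>
     closure {x. \<psi> x \<noteq> 0} \<inter> frontier K \<subseteq> rel_interior E"

text \<open>The trace on the facet \<open>E\<close> of \<open>v|\<^sub>K \<in> H\<^sup>1(K)\<close>, and the normal trace \<open>\<tau>n\<close> of
  \<open>\<tau>|\<^sub>K \<in> H(div;K)\<close> in case it is square-integrable on \<open>E\<close>, are the functions on \<open>E\<close> for
  which Green's formula holds.\<close>

definition has_trace :: "(real^'d) set \<Rightarrow> (real^'d) set \<Rightarrow> 'd vfield \<Rightarrow> 'd vfield \<Rightarrow> bool" where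
  "has_trace K E v g \<longleftrightarrow> square_integrable (face_measure E) g \<and>
     (\<forall>\<psi> i j. facet_test_function K E \<psi> \<longrightarrow>
        (LINT x|face_measure E. g x $ i * \<psi> x * outer_normal K E $ j) =
        (LINT x|lebesgue_on (interior K).
           weak_grad (interior K) v x $ i $ j * \<psi> x + v x $ i * partial j \<psi> x))"

definition has_normal_trace :: "(real^'d) set \<Rightarrow> (real^'d) set \<Rightarrow> 'd mfield \<Rightarrow> 'd vfield \<Rightarrow> bool" where
  "has_normal_trace K E \<tau> t \<longleftrightarrow> square_integrable (face_measure E) t \<and>
     (\<forall>\<psi> i. facet_test_function K E \<psi> \<longrightarrow>
        (LINT x|face_measure E. t x $ i * \<psi> x) =
        (LINT x|lebesgue_on (interior K).
           weak_div (interior K) \<tau> x $ i * \<psi> x + (\<Sum>j\<in>UNIV. \<tau> x $ i $ j * partial j \<psi> x)))"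

definition face_trace :: "(real^'d) set \<Rightarrow> (real^'d) set \<Rightarrow> 'd vfield \<Rightarrow> 'd vfield" where
  "face_trace K E v = (SOME g. has_trace K E v g)"


section \<open>Domain and continuous problem\<close>

definition polyhedral_domain :: "(real^'d) set \<Rightarrow> bool" where
  "polyhedral_domain \<Omega> \<longleftrightarrow> open \<Omega> \<and> connected \<Omega> \<and> bounded \<Omega> \<and> \<Omega> \<noteq> {} \<and>
     interior (closure \<Omega>) = \<Omega> \<and> (\<exists>P. finite P \<and> (\<forall>Q\<in>P. polytope Q) \<and> closure \<Omega> = \<Union>P)"

definition boundary_split :: "(real^'d) set \<Rightarrow> (real^'d) set \<Rightarrow> (real^'d) set \<Rightarrow> bool" where
  "boundary_split \<Omega> \<Gamma>D \<Gamma>N \<longleftrightarrow> \<Gamma>D \<union> \<Gamma>N = frontier \<Omega> \<and> \<Gamma>D \<inter> \<Gamma>N = {} \<and>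
     (\<exists>E. (int CARD('d) - 1) simplex E \<and> emeasure (face_measure E) (\<Gamma>D \<inter> E) > 0)"

text \<open>Flat boundary pieces are seen as facets \<open>E\<close> of simplices \<open>K\<close> inside the domain. Since
  \<open>\<Gamma>D\<close> and \<open>\<Gamma>N\<close> are disjoint but closed facets are not, it is the relative interior of \<open>E\<close>
  that has to lie in \<open>\<Gamma>D\<close> or \<open>\<Gamma>N\<close>.\<close>

definition flat_piece :: "(real^'d) set \<Rightarrow> (real^'d) set \<Rightarrow> (real^'d) set \<Rightarrow> (real^'d) set \<Rightarrow> bool" where
  "flat_piece \<Omega> \<Gamma> K E \<longleftrightarrow>
     int CARD('d) simplex K \<and> K \<subseteq> closure \<Omega> \<and> E facet_of K \<and> rel_interior E \<subseteq> \<Gamma>"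

definition H1_vanishing :: "(real^'d) set \<Rightarrow> (real^'d) set \<Rightarrow> 'd vfield set" where
  "H1_vanishing \<Omega> \<Gamma>D = {v \<in> H1 \<Omega>. \<forall>K E. flat_piece \<Omega> \<Gamma>D K E \<longrightarrow> has_trace K E v (\<lambda>x. 0)}"

definition L2_traction :: "(real^'d) set \<Rightarrow> (real^'d) set \<Rightarrow> 'd vfield \<Rightarrow> bool" where
  "L2_traction \<Omega> \<Gamma>N g \<longleftrightarrow> (\<forall>K E. flat_piece \<Omega> \<Gamma>N K E \<longrightarrow> square_integrable (face_measure E) g)"

definition compliance :: "real \<Rightarrow> real \<Rightarrow> real^'d^'d \<Rightarrow> real^'d^'d" where
  "compliance \<mu> lam \<tau> =
     (1 / (2 * \<mu>)) *\<^sub>R (\<tau> - (lam / (2 * \<mu> + real CARD('d) * lam) * trace \<tau>) *\<^sub>R mat 1)"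

definition elasticity_solution ::
  "real \<Rightarrow> real \<Rightarrow> (real^'d) set \<Rightarrow> (real^'d) set \<Rightarrow> (real^'d) set \<Rightarrow> 'd vfield \<Rightarrow> 'd vfield \<Rightarrow>
     'd vfield \<Rightarrow> 'd mfield \<Rightarrow> bool" where
  "elasticity_solution \<mu> lam \<Omega> \<Gamma>D \<Gamma>N f g u \<sigma> \<longleftrightarrow>
     u \<in> H1_vanishing \<Omega> \<Gamma>D \<and> \<sigma> \<in> Hdiv_sym \<Omega> \<and>
     (AE x in lebesgue_on \<Omega>. compliance \<mu> lam (\<sigma> x) - eps \<Omega> u x = 0) \<and>
     (AE x in lebesgue_on \<Omega>. - weak_div \<Omega> \<sigma> x = f x) \<and>
     (\<forall>K E. flat_piece \<Omega> \<Gamma>N K E \<longrightarrow> has_normal_trace K E \<sigma> g)"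


section \<open>Meshes and mixed finite elements\<close>

definition mesh :: "(real^'d) set \<Rightarrow> (real^'d) set \<Rightarrow> (real^'d) set \<Rightarrow> (real^'d) set set \<Rightarrow> bool" where
  "mesh \<Omega> \<Gamma>D \<Gamma>N \<T> \<longleftrightarrow> triangulation \<T> \<and> (\<forall>K\<in>\<T>. int CARD('d) simplex K) \<and> \<Union>\<T> = closure \<Omega> \<and>
     (\<forall>K\<in>\<T>. \<forall>E. E facet_of K \<and> E \<subseteq> frontier \<Omega> \<longrightarrow> rel_interior E \<subseteq> \<Gamma>D \<or> rel_interior E \<subseteq> \<Gamma>N)"

datatype family = ADG | GN | AAW | JM

definition family_ok :: "family \<Rightarrow> nat \<Rightarrow> nat \<Rightarrow> bool" where
  "family_ok fam d k \<longleftrightarrow>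
     (case fam of ADG \<Rightarrow> d = 2 \<and> k \<ge> 2 | GN \<Rightarrow> d = 2 \<and> k \<ge> 2 | AAW \<Rightarrow> d = 3 \<and> k \<ge> 2 | JM \<Rightarrow> d = 2)"

definition displacement_degree :: "family \<Rightarrow> nat \<Rightarrow> nat" where
  "displacement_degree fam k = (if fam = JM then 1 else k - 1)"

definition facet_degree :: "family \<Rightarrow> nat \<Rightarrow> nat" where
  "facet_degree fam k = (if fam = JM then 1 else k)"

definition local_degree :: "family \<Rightarrow> nat \<Rightarrow> nat" where
  "local_degree fam k = (if fam = JM then 2 else k + 1)"

definition broken_polys :: "(real^'d) set \<Rightarrow> (real^'d) set set \<Rightarrow> nat \<Rightarrow> 'd vfield set" where
  "broken_polys \<Omega> \<T> m =
     {v. square_integrable (lebesgue_on \<Omega>) v \<and> (\<forall>K\<in>\<T>. restricts_to K v (polys m))}"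

definition displacement_space ::
  "family \<Rightarrow> nat \<Rightarrow> (real^'d) set \<Rightarrow> (real^'d) set set \<Rightarrow> 'd vfield set" where
  "displacement_space fam k \<Omega> \<T> = broken_polys \<Omega> \<T> (displacement_degree fam k)"

definition stress_space ::
  "((real^'d) set \<Rightarrow> 'd mfield set) \<Rightarrow> (real^'d) set \<Rightarrow> (real^'d) set set \<Rightarrow> 'd mfield set" where
  "stress_space S \<Omega> \<T> = {\<tau> \<in> Hdiv_sym \<Omega>. \<forall>K\<in>\<T>. restricts_to K \<tau> (S K)}"

definition barycenter :: "(real^'d) set \<Rightarrow> real^'d" where
  "barycenter K = (1 / real (card {v. v extreme_point_of K})) *\<^sub>R (\<Sum>v\<in>{v. v extreme_point_of K}. v)"

definition alfeld_split :: "(real^'d) set \<Rightarrow> (real^'d) set set" where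
  "alfeld_split K = {convex hull (insert (barycenter K) E) | E. E facet_of K}"

definition JM_space :: "(real^'d) set \<Rightarrow> 'd mfield set" where
  "JM_space K = {\<tau> \<in> Hdiv_sym (interior K). \<forall>T\<in>alfeld_split K. restricts_to T \<tau> (polys 1)}"

definition finite_dim_space :: "(real^'d) set \<Rightarrow> 'd mfield set \<Rightarrow> bool" where
  "finite_dim_space K S \<longleftrightarrow> (\<lambda>x. 0) \<in> S \<and> (\<forall>\<tau>\<in>S. \<forall>\<rho>\<in>S. (\<lambda>x. \<tau> x + \<rho> x) \<in> S) \<and>
     (\<forall>\<tau>\<in>S. \<forall>a. (\<lambda>x. a *\<^sub>R \<tau> x) \<in> S) \<and>
     (\<exists>B. finite B \<and> B \<subseteq> S \<and> (\<forall>\<tau>\<in>S. \<exists>c. AE x in lebesgue_on K. \<tau> x = (\<Sum>b\<in>B. c b *\<^sub>R b x)))"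

text \<open>The functionals \<open>\<tau> \<mapsto> \<integral>\<^sub>K \<tau> : \<epsilon>(v)\<close> for \<open>v \<in> [P\<^bsub>k-1\<^esub>(K)]\<^sup>d\<close> and
  \<open>\<tau> \<mapsto> \<integral>\<^sub>E \<tau>n \<sqdot> v\<close> for \<open>v \<in> [P\<^sub>k(E)]\<^sup>d\<close>, \<open>E\<close> a facet of \<open>K\<close>, belong to a set of degrees of
  freedom of \<open>S\<close>: their values, represented by \<open>p\<close> and \<open>q\<close>, can be prescribed independently.
  They need not determine \<open>\<tau>\<close>, as the families have further interior degrees of freedom for
  some \<open>k\<close>.\<close>

definition has_moment_dofs :: "nat \<Rightarrow> (real^'d) set \<Rightarrow> 'd mfield set \<Rightarrow> bool" where
  "has_moment_dofs k K S \<longleftrightarrow>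
     (\<forall>p\<in>polys (k - 1). \<forall>q. (\<forall>E. E facet_of K \<longrightarrow> q E \<in> polys k) \<longrightarrow>
       (\<exists>\<tau>\<in>S.
          (\<forall>v\<in>polys (k - 1). L2_inner (lebesgue_on K) \<tau> (eps (interior K) v) =
              L2_inner (lebesgue_on K) (eps (interior K) p) (eps (interior K) v)) \<and>
          (\<forall>E. E facet_of K \<longrightarrow> (\<exists>t. has_normal_trace K E \<tau> t \<and>
              (\<forall>v\<in>polys k. L2_inner (face_measure E) t v = L2_inner (face_measure E) (q E) v)))))"

text \<open>The local stress spaces of the families ADG, GN, AAW enter only through the following
  properties, which all three have; that of the Johnson--Mercier element is given explicitly.\<close>

definition mixed_element ::
  "family \<Rightarrow> nat \<Rightarrow> ((real^'d) set \<Rightarrow> 'd mfield set) \<Rightarrow> (real^'d) set \<Rightarrow> (real^'d) set set \<Rightarrow> bool" where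
  "mixed_element fam k S \<Omega> \<T> \<longleftrightarrow>
     (if fam = JM then (\<forall>K\<in>\<T>. S K = JM_space K)
      else
        (\<forall>K\<in>\<T>. finite_dim_space K (S K) \<and> S K \<subseteq> Hdiv_sym (interior K) \<and>
           (\<forall>p\<in>polys k. (\<forall>x. transpose (p x) = p x) \<longrightarrow> restricts_to K p (S K)) \<and>
           has_moment_dofs k K (S K)) \<and>
        (\<forall>\<tau>\<in>stress_space S \<Omega> \<T>. weak_div \<Omega> \<tau> \<in> displacement_space fam k \<Omega> \<T>))"

text \<open>\<open>q\<close> is the \<open>L\<^sup>2(E)\<close>-projection of \<open>g\<close> onto \<open>[P\<^sub>m(E)]\<^sup>d\<close>.\<close>

definition is_facet_projection :: "nat \<Rightarrow> (real^'d) set \<Rightarrow> 'd vfield \<Rightarrow> 'd vfield \<Rightarrow> bool" where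
  "is_facet_projection m E g q \<longleftrightarrow> q \<in> polys m \<and>
     (\<forall>v\<in>polys m. L2_inner (face_measure E) (\<lambda>x. g x - q x) v = 0)"

definition stress_space_traction ::
  "family \<Rightarrow> nat \<Rightarrow> ((real^'d) set \<Rightarrow> 'd mfield set) \<Rightarrow> (real^'d) set \<Rightarrow> (real^'d) set \<Rightarrow>
     (real^'d) set set \<Rightarrow> 'd vfield \<Rightarrow> 'd mfield set" where
  "stress_space_traction fam k S \<Omega> \<Gamma>N \<T> g = {\<tau> \<in> stress_space S \<Omega> \<T>.
     \<forall>K\<in>\<T>. \<forall>E. E facet_of K \<and> rel_interior E \<subseteq> \<Gamma>N \<longrightarrow>
       (\<exists>q. is_facet_projection (facet_degree fam k) E g q \<and> has_normal_trace K E \<tau> q)}"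

definition stress_space_0 ::
  "((real^'d) set \<Rightarrow> 'd mfield set) \<Rightarrow> (real^'d) set \<Rightarrow> (real^'d) set \<Rightarrow>
     (real^'d) set set \<Rightarrow> 'd mfield set" where
  "stress_space_0 S \<Omega> \<Gamma>N \<T> = {\<tau> \<in> stress_space S \<Omega> \<T>.
     \<forall>K\<in>\<T>. \<forall>E. E facet_of K \<and> rel_interior E \<subseteq> \<Gamma>N \<longrightarrow> has_normal_trace K E \<tau> (\<lambda>x. 0)}"

definition discrete_solution ::
  "real \<Rightarrow> real \<Rightarrow> family \<Rightarrow> nat \<Rightarrow> ((real^'d) set \<Rightarrow> 'd mfield set) \<Rightarrow> (real^'d) set \<Rightarrow>
     (real^'d) set \<Rightarrow> (real^'d) set set \<Rightarrow> 'd vfield \<Rightarrow> 'd vfield \<Rightarrow> 'd vfield \<Rightarrow> 'd mfield \<Rightarrow> bool" where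
  "discrete_solution \<mu> lam fam k S \<Omega> \<Gamma>N \<T> f g u\<^sub>h \<sigma>\<^sub>h \<longleftrightarrow>
     u\<^sub>h \<in> displacement_space fam k \<Omega> \<T> \<and> \<sigma>\<^sub>h \<in> stress_space_traction fam k S \<Omega> \<Gamma>N \<T> g \<and>
     (\<forall>\<tau>\<in>stress_space_0 S \<Omega> \<Gamma>N \<T>. \<forall>v\<in>displacement_space fam k \<Omega> \<T>.
        L2_inner (lebesgue_on \<Omega>) (\<lambda>x. compliance \<mu> lam (\<sigma>\<^sub>h x)) \<tau>
        + L2_inner (lebesgue_on \<Omega>) u\<^sub>h (weak_div \<Omega> \<tau>)
        + L2_inner (lebesgue_on \<Omega>) v (weak_div \<Omega> \<sigma>\<^sub>h)
        + L2_inner (lebesgue_on \<Omega>) f v = 0)"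


section \<open>Local problems\<close>

definition is_L2_projection ::
  "(real^'d) set \<Rightarrow> 'd vfield set \<Rightarrow> 'd vfield \<Rightarrow> 'd vfield \<Rightarrow> bool" where
  "is_L2_projection \<Omega> V w p \<longleftrightarrow> p \<in> V \<and> (\<forall>v\<in>V. L2_inner (lebesgue_on \<Omega>) (\<lambda>x. w x - p x) v = 0)"

text \<open>\<open>P\<^sub>h W\<close> and \<open>(I - P\<^sub>h) W\<close> for the \<open>L\<^sup>2\<close>-projection \<open>P\<^sub>h\<close> onto \<open>V\<close>.\<close>

definition proj_image :: "(real^'d) set \<Rightarrow> 'd vfield set \<Rightarrow> 'd vfield set \<Rightarrow> 'd vfield set" where
  "proj_image \<Omega> V W = {p. \<exists>w\<in>W. is_L2_projection \<Omega> V w p}"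

definition coproj_image :: "(real^'d) set \<Rightarrow> 'd vfield set \<Rightarrow> 'd vfield set \<Rightarrow> 'd vfield set" where
  "coproj_image \<Omega> V W = {v. \<exists>w\<in>W. \<exists>p. is_L2_projection \<Omega> V w p \<and> v = (\<lambda>x. w x - p x)}"

text \<open>The test functions \<open>v\<close> are taken from the global spaces; as they only enter through
  integrals over \<open>K\<close>, this amounts to testing with their restrictions to \<open>K\<close>.\<close>

definition residual_minimization ::
  "real \<Rightarrow> real \<Rightarrow> family \<Rightarrow> nat \<Rightarrow> (real^'d) set \<Rightarrow> (real^'d) set set \<Rightarrow>
     'd vfield \<Rightarrow> 'd mfield \<Rightarrow> 'd vfield \<Rightarrow> 'd vfield \<Rightarrow> bool" where
  "residual_minimization \<mu> lam fam k \<Omega> \<T> u\<^sub>h \<sigma>\<^sub>h r\<^sub>h w\<^sub>h \<longleftrightarrow>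
     (let V = displacement_space fam k \<Omega> \<T>; l = local_degree fam k in
       r\<^sub>h \<in> coproj_image \<Omega> V (broken_polys \<Omega> \<T> (l + 1)) \<and> w\<^sub>h \<in> broken_polys \<Omega> \<T> l \<and>
       (\<forall>K\<in>\<T>.
         (\<forall>v\<in>coproj_image \<Omega> V (broken_polys \<Omega> \<T> (l + 1)).
            L2_inner (lebesgue_on K) (eps (interior K) r\<^sub>h) (eps (interior K) v)
            + L2_inner (lebesgue_on K) (eps (interior K) w\<^sub>h) (eps (interior K) v)
            = L2_inner (lebesgue_on K) (\<lambda>x. compliance \<mu> lam (\<sigma>\<^sub>h x)) (eps (interior K) v)) \<and>
         (\<forall>v\<in>coproj_image \<Omega> V (broken_polys \<Omega> \<T> l).
            L2_inner (lebesgue_on K) (eps (interior K) v) (eps (interior K) r\<^sub>h) = 0) \<and>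
         (\<forall>v\<in>proj_image \<Omega> V (broken_polys \<Omega> \<T> l).
            L2_inner (lebesgue_on K) w\<^sub>h v = L2_inner (lebesgue_on K) u\<^sub>h v)))"

definition auxiliary_problem ::
  "real \<Rightarrow> real \<Rightarrow> family \<Rightarrow> nat \<Rightarrow> (real^'d) set \<Rightarrow> (real^'d) set set \<Rightarrow>
     'd vfield \<Rightarrow> 'd mfield \<Rightarrow> 'd vfield \<Rightarrow> bool" where
  "auxiliary_problem \<mu> lam fam k \<Omega> \<T> u\<^sub>h \<sigma>\<^sub>h z\<^sub>h \<longleftrightarrow>
     (let V = displacement_space fam k \<Omega> \<T>; l = local_degree fam k in
       z\<^sub>h \<in> broken_polys \<Omega> \<T> (l + 1) \<and>
       (\<forall>K\<in>\<T>.
         (\<forall>v\<in>coproj_image \<Omega> V (broken_polys \<Omega> \<T> (l + 1)).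
            L2_inner (lebesgue_on K) (eps (interior K) z\<^sub>h) (eps (interior K) v)
            = L2_inner (lebesgue_on K) (\<lambda>x. compliance \<mu> lam (\<sigma>\<^sub>h x)) (eps (interior K) v)) \<and>
         (\<forall>v\<in>proj_image \<Omega> V (broken_polys \<Omega> \<T> (l + 1)).
            L2_inner (lebesgue_on K) z\<^sub>h v = L2_inner (lebesgue_on K) u\<^sub>h v)))"


section \<open>Norm and error indicator\<close>

definition broken_eps :: "(real^'d) set set \<Rightarrow> 'd vfield \<Rightarrow> 'd mfield" where
  "broken_eps \<T> v x = (\<Sum>K\<in>\<T>. indicator (interior K) x *\<^sub>R eps (interior K) v x)"

definition interior_faces :: "(real^'d) set set \<Rightarrow> (real^'d) set set" where
  "interior_faces \<T> = {E. \<exists>K\<in>\<T>. \<exists>K'\<in>\<T>. K \<noteq> K' \<and> E facet_of K \<and> E facet_of K'}"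

definition dirichlet_faces :: "(real^'d) set \<Rightarrow> (real^'d) set set \<Rightarrow> (real^'d) set set" where
  "dirichlet_faces \<Gamma>D \<T> = {E. (\<exists>K\<in>\<T>. E facet_of K) \<and> rel_interior E \<subseteq> \<Gamma>D}"

text \<open>The order of the two simplices sharing \<open>E\<close>, hence the sign of the jump, is arbitrary.\<close>

definition jump :: "(real^'d) set set \<Rightarrow> (real^'d) set \<Rightarrow> 'd vfield \<Rightarrow> 'd vfield" where
  "jump \<T> E v =
     (let (K, K') = (SOME (K, K'). K \<in> \<T> \<and> K' \<in> \<T> \<and> K \<noteq> K' \<and> E facet_of K \<and> E facet_of K')
      in (\<lambda>x. face_trace K E v x - face_trace K' E v x))"

definition boundary_trace :: "(real^'d) set set \<Rightarrow> (real^'d) set \<Rightarrow> 'd vfield \<Rightarrow> 'd vfield" where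
  "boundary_trace \<T> E v = face_trace (SOME K. K \<in> \<T> \<and> E facet_of K) E v"

definition h_norm :: "(real^'d) set \<Rightarrow> (real^'d) set set \<Rightarrow> 'd vfield \<Rightarrow> real" where
  "h_norm \<Gamma>D \<T> v = sqrt (
     (\<Sum>K\<in>\<T>. (L2_norm (lebesgue_on K) (eps (interior K) v))\<^sup>2)
     + (\<Sum>E\<in>interior_faces \<T>. (L2_norm (face_measure E) (jump \<T> E v))\<^sup>2 / diameter E)
     + (\<Sum>E\<in>dirichlet_faces \<Gamma>D \<T>. (L2_norm (face_measure E) (boundary_trace \<T> E v))\<^sup>2 / diameter E))"

definition local_indicator_sq ::
  "real \<Rightarrow> real \<Rightarrow> (real^'d) set \<Rightarrow> (real^'d) set set \<Rightarrow> 'd mfield \<Rightarrow> 'd vfield \<Rightarrow> 'd vfield \<Rightarrow>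
     (real^'d) set \<Rightarrow> real" where
  "local_indicator_sq \<mu> lam \<Gamma>D \<T> \<sigma>\<^sub>h r\<^sub>h w\<^sub>h K =
     \<mu> * (L2_norm (lebesgue_on K) (eps (interior K) r\<^sub>h))\<^sup>2
     + \<mu> * (L2_norm (lebesgue_on K) (\<lambda>x. compliance \<mu> lam (\<sigma>\<^sub>h x) - eps (interior K) w\<^sub>h x))\<^sup>2
     + \<mu> / 2 * (\<Sum>E\<in>{E \<in> interior_faces \<T>. E facet_of K}.
         (L2_norm (face_measure E) (jump \<T> E w\<^sub>h))\<^sup>2 / diameter E)
     + \<mu> * (\<Sum>E\<in>{E \<in> dirichlet_faces \<Gamma>D \<T>. E facet_of K}.
         (L2_norm (face_measure E) (boundary_trace \<T> E w\<^sub>h))\<^sup>2 / diameter E)"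

definition error_indicator ::
  "real \<Rightarrow> real \<Rightarrow> (real^'d) set \<Rightarrow> (real^'d) set set \<Rightarrow> 'd mfield \<Rightarrow> 'd vfield \<Rightarrow> 'd vfield \<Rightarrow> real" where
  "error_indicator \<mu> lam \<Gamma>D \<T> \<sigma>\<^sub>h r\<^sub>h w\<^sub>h =
     sqrt (\<Sum>K\<in>\<T>. local_indicator_sq \<mu> lam \<Gamma>D \<T> \<sigma>\<^sub>h r\<^sub>h w\<^sub>h K)"

definition saturation ::
  "real \<Rightarrow> (real^'d) set \<Rightarrow> (real^'d) set set \<Rightarrow> 'd vfield \<Rightarrow> 'd vfield \<Rightarrow> 'd vfield \<Rightarrow> bool" where
  "saturation \<delta> \<Omega> \<T> u z\<^sub>h w\<^sub>h \<longleftrightarrow>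
     L2_norm (lebesgue_on \<Omega>) (broken_eps \<T> (\<lambda>x. u x - z\<^sub>h x))
       \<le> \<delta> * L2_norm (lebesgue_on \<Omega>) (broken_eps \<T> (\<lambda>x. u x - w\<^sub>h x))"

end

theory Submission
  imports Defs
begin

text \<open>
  The estimate rests on three identities, none of which sees the shape of the mesh, so that the
  constant depends on \<open>\<delta>\<close>, the dimension and the Lame parameters only.

  First, the two local problems are compared (\<open>eps_auxiliary_solution\<close>). The functions \<open>z\<^sub>h\<close> and \<open>w\<^sub>h\<close> have
  the same projection to the displacement space, so \<open>z\<^sub>h - w\<^sub>h - r\<^sub>h\<close> belongs to the space of test
  functions; testing with it gives \<open>\<epsilon>(z\<^sub>h - w\<^sub>h) = \<epsilon>(r\<^sub>h)\<close> on every simplex. By the saturation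
  assumption and Young's inequality, \<open>\<epsilon>(u - w\<^sub>h)\<close> is then bounded by \<open>\<epsilon>(r\<^sub>h)\<close>
  (\<open>strain_error_le\<close>). Second, the constitutive law \<open>\<C>\<sigma> = \<epsilon>(u)\<close> turns the stress error into
  \<open>\<epsilon>(u - w\<^sub>h) + (\<epsilon>(w\<^sub>h) - \<C>\<sigma>\<^sub>h)\<close> up to the inverse of \<open>\<C>\<close> (\<open>stress_error_le\<close>). Third, \<open>u\<close> has no
  jumps and vanishes on \<open>\<Gamma>D\<close>, so the face terms of \<open>u - w\<^sub>h\<close> are those of \<open>w\<^sub>h\<close>, which the indicator
  contains (\<open>jump_error_le\<close>, \<open>boundary_trace_error\<close>).

  The third point takes most of the work, because traces and weak gradients are defined through
  Green's formula and picked by a choice operator. Both are unique almost everywhere, since test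
  functions separate integrable functions (\<open>AE_zero_if_orthogonal_to_test_functions\<close>). A piecewise
  polynomial has its boundary values as traces (\<open>has_trace_piecewise_C1\<close>): this is the divergence
  theorem on a simplex for functions whose support meets the boundary in a single facet, which
  reduces to that on a half-space (\<open>halfspace_divergence\<close>). A function in \<open>H\<^sup>1(\<Omega>)\<close> has the same traces
  from both sides of an interior face (\<open>has_trace_opposite_simplex\<close>).
\<close>

section \<open>Continuously differentiable functions and cut-offs\<close>

lemma C1_funI:
  assumes "\<And>x. (\<phi> has_derivative D x) (at x)" and "\<And>e. continuous_on UNIV (\<lambda>x. D x e)"
  shows "C1_fun \<phi>"
proof -
  have "frechet_derivative \<phi> (at x) = D x" for x
    using frechet_derivative_at[OF assms(1)] by simp
  then show ?thesis
    using assms unfolding C1_fun_def differentiable_def by auto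
qed

lemma C1_fun_derivative:
  assumes "C1_fun \<phi>"
  shows "(\<phi> has_derivative frechet_derivative \<phi> (at x)) (at x)"
  using assms unfolding C1_fun_def by (metis frechet_derivative_works)

lemma C1_fun_continuous_derivative:
  "C1_fun \<phi> \<Longrightarrow> continuous_on UNIV (\<lambda>x. frechet_derivative \<phi> (at x) e)"
  unfolding C1_fun_def by auto

lemma C1_fun_continuous: "C1_fun \<phi> \<Longrightarrow> continuous_on A \<phi>"
  by (meson C1_fun_derivative continuous_at_imp_continuous_on has_derivative_continuous)

lemma continuous_on_partial: "C1_fun \<phi> \<Longrightarrow> continuous_on A (partial j \<phi>)"
  unfolding partial_def using C1_fun_continuous_derivative continuous_on_subset by blast

lemma C1_fun_const: "C1_fun (\<lambda>x. c)"
  by (rule C1_funI[of _ "\<lambda>x e. 0"]) auto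

lemma C1_fun_component: "C1_fun (\<lambda>x. x $ i)"
  by (rule C1_funI[of _ "\<lambda>x e. e $ i"]) (auto intro!: derivative_eq_intros bounded_linear_imp_has_derivative)

lemma C1_fun_add:
  assumes "C1_fun f" "C1_fun g" shows "C1_fun (\<lambda>x. f x + g x)"
  by (rule C1_funI, rule has_derivative_add[OF C1_fun_derivative[OF assms(1)] C1_fun_derivative[OF assms(2)]])
     (intro continuous_intros C1_fun_continuous_derivative assms)

lemma C1_fun_mult:
  assumes "C1_fun f" "C1_fun g" shows "C1_fun (\<lambda>x. f x * g x)"
  by (rule C1_funI, rule has_derivative_mult[OF C1_fun_derivative[OF assms(1)] C1_fun_derivative[OF assms(2)]])
     (intro continuous_intros C1_fun_continuous_derivative C1_fun_continuous assms)

lemma C1_fun_diff: "C1_fun f \<Longrightarrow> C1_fun g \<Longrightarrow> C1_fun (\<lambda>x. f x - g x)"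
  using C1_fun_add[OF _ C1_fun_mult[OF C1_fun_const[of "-1"]], of f g] by simp

lemma C1_fun_sum: "(\<And>a. a \<in> A \<Longrightarrow> C1_fun (f a)) \<Longrightarrow> C1_fun (\<lambda>x. \<Sum>a\<in>A. f a x)"
  by (induction A rule: infinite_finite_induct) (auto intro: C1_fun_const C1_fun_add)

lemma C1_fun_prod: "(\<And>a. a \<in> A \<Longrightarrow> C1_fun (f a)) \<Longrightarrow> C1_fun (\<lambda>x. \<Prod>a\<in>A. f a x)"
  by (induction A rule: infinite_finite_induct) (auto intro: C1_fun_const C1_fun_mult)

lemma C1_fun_power: "C1_fun f \<Longrightarrow> C1_fun (\<lambda>x. f x ^ n)"
  by (induction n) (auto intro: C1_fun_const C1_fun_mult)

lemma partial_mult: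
  assumes "C1_fun f" "C1_fun g"
  shows "partial j (\<lambda>x. f x * g x) x = partial j f x * g x + f x * partial j g x"
proof -
  have "frechet_derivative (\<lambda>x. f x * g x) (at x)
    = (\<lambda>h. f x * frechet_derivative g (at x) h + frechet_derivative f (at x) h * g x)"
    by (rule frechet_derivative_at[symmetric],
        rule has_derivative_mult[OF C1_fun_derivative[OF assms(1)] C1_fun_derivative[OF assms(2)]])
  then show ?thesis unfolding partial_def by simp
qed

text \<open>The truncated square \<open>t \<mapsto> (max 0 t)\<^sup>2\<close> has the derivative \<open>2 max 0 t\<close>, since its first-order
  Taylor error is at most quadratic. It is the building block of the cut-off functions below.\<close>

lemma C1_fun_truncated_square:
  assumes "C1_fun f"
  shows "C1_fun (\<lambda>x. (max 0 (f x))\<^sup>2)"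
proof (rule C1_funI)
  fix x
  have "((\<lambda>t::real. (max 0 t)\<^sup>2) has_derivative (\<lambda>h. 2 * max 0 s * h)) (at s)" for s
  proof (rule has_derivativeI_sandwich[where H="\<lambda>y. norm (y - s)" and e=1])
    fix y :: real
    assume "y \<noteq> s"
    have "\<bar>(max 0 y)\<^sup>2 - (max 0 s)\<^sup>2 - 2 * max 0 s * (y - s)\<bar> \<le> (y - s)\<^sup>2"
    proof -
      have "y \<le> 0 \<Longrightarrow> s \<ge> 0 \<Longrightarrow> s * y \<le> 0" "y \<ge> 0 \<Longrightarrow> s \<le> 0 \<Longrightarrow> s * y \<le> 0"
        by (auto simp: mult_nonneg_nonpos mult_nonpos_nonneg)
      moreover have "0 \<le> (y - s)\<^sup>2" by simp
      ultimately show ?thesis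
        by (cases "y \<ge> 0"; cases "s \<ge> 0")
           (simp_all add: max_def power2_eq_square algebra_simps,
            use zero_le_square[of s] zero_le_square[of y] in linarith)
    qed
    then have "norm ((max 0 y)\<^sup>2 - (max 0 s)\<^sup>2 - 2 * max 0 s * (y - s)) \<le> norm (y - s) * norm (y - s)"
      by (simp add: power2_eq_square)
    then show "norm ((max 0 y)\<^sup>2 - (max 0 s)\<^sup>2 - 2 * max 0 s * (y - s)) / norm (y - s) \<le> norm (y - s)"
      using \<open>y \<noteq> s\<close> by (simp add: divide_le_eq)
  next
    show "((\<lambda>y. norm (y - s)) \<longlongrightarrow> 0) (at s)"
      by (auto intro!: tendsto_eq_intros)
  qed (auto intro!: bounded_linear_intros)
  from has_derivative_compose[OF C1_fun_derivative[OF assms] this]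
  show "((\<lambda>x. (max 0 (f x))\<^sup>2) has_derivative (\<lambda>e. 2 * max 0 (f x) * frechet_derivative f (at x) e)) (at x)" .
next
  fix e
  show "continuous_on UNIV (\<lambda>x. 2 * max 0 (f x) * frechet_derivative f (at x) e)"
    by (intro continuous_intros C1_fun_continuous_derivative C1_fun_continuous assms)
qed

lemma compact_closure_mono:
  fixes A B :: "(real^'d) set"
  assumes "compact (closure B)" "A \<subseteq> B"
  shows "compact (closure A)"
  using assms closure_mono[of A B] bounded_subset compact_eq_bounded_closed by blast

text \<open>A sum \<open>s\<close> of bumps, each positive exactly on a ball in \<open>U\<close>, is at least some \<open>m > 0\<close> on \<open>C\<close> if
  the balls cover \<open>C\<close>. Composing \<open>s / m\<close> with a function that equals \<open>0\<close> at \<open>0\<close> and \<open>1\<close> beyond \<open>1\<close>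
  flattens it to \<open>1\<close> on \<open>C\<close>.\<close>

lemma C1_cutoff:
  fixes C U :: "(real^'d) set"
  assumes "compact C" "open U" "C \<subseteq> U"
  obtains \<kappa> where "C1_fun \<kappa>" "\<And>x. 0 \<le> \<kappa> x" "\<And>x. \<kappa> x \<le> 1" "\<And>x. x \<in> C \<Longrightarrow> \<kappa> x = 1"
    "compact (closure {x. \<kappa> x \<noteq> 0})" "closure {x. \<kappa> x \<noteq> 0} \<subseteq> U"
proof -
  have "\<forall>a\<in>C. \<exists>r>0. cball a r \<subseteq> U"
    using assms open_contains_cball by blast
  then obtain r where r: "\<And>a. a \<in> C \<Longrightarrow> r a > 0" "\<And>a. a \<in> C \<Longrightarrow> cball a (r a) \<subseteq> U"
    by metis
  have "C \<subseteq> (\<Union>a\<in>C. ball a (r a))"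
    using r(1) by auto
  then obtain A where A: "A \<subseteq> C" "finite A" "C \<subseteq> (\<Union>a\<in>A. ball a (r a))"
    using compactE_image[OF assms(1), of C "\<lambda>a. ball a (r a)"] by auto
  define s where "s x = (\<Sum>a\<in>A. (max 0 ((r a)\<^sup>2 - (\<Sum>i\<in>UNIV. (x $ i - a $ i)\<^sup>2)))\<^sup>2)" for x :: "real^'d"
  have dist_sq: "(\<Sum>i\<in>UNIV. (x $ i - a $ i)\<^sup>2) = (dist x a)\<^sup>2" for x a :: "real^'d"
    by (simp add: dist_norm norm_eq_sqrt_inner inner_vec_def power2_eq_square sum_nonneg)
  have "C1_fun s"
    unfolding s_def
    by (intro C1_fun_sum C1_fun_truncated_square C1_fun_diff C1_fun_const C1_fun_power C1_fun_component)
  have s_nonneg: "s x \<ge> 0" for x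
    unfolding s_def by (intro sum_nonneg) simp
  have s_pos: "s x > 0 \<longleftrightarrow> x \<in> (\<Union>a\<in>A. ball a (r a))" for x
  proof -
    have "s x = 0 \<longleftrightarrow> (\<forall>a\<in>A. (max 0 ((r a)\<^sup>2 - (dist x a)\<^sup>2))\<^sup>2 = 0)"
      unfolding s_def dist_sq by (rule sum_nonneg_eq_0_iff) (auto simp: A)
    also have "\<dots> \<longleftrightarrow> (\<forall>a\<in>A. r a \<le> dist x a)"
    proof (intro ball_cong refl)
      fix a assume "a \<in> A"
      then have "r a > 0" using r A by auto
      then have "(r a)\<^sup>2 \<le> (dist x a)\<^sup>2 \<longleftrightarrow> r a \<le> dist x a"
        using abs_le_square_iff[of "r a" "dist x a"] by simp
      then show "((max 0 ((r a)\<^sup>2 - (dist x a)\<^sup>2))\<^sup>2 = 0) = (r a \<le> dist x a)"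
        by (auto simp: max_def)
    qed
    finally show ?thesis
      using s_nonneg[of x] by (auto simp: dist_commute not_le less_le)
  qed
  obtain m where m: "m > 0" "\<And>x. x \<in> C \<Longrightarrow> s x \<ge> m"
  proof (cases "C = {}")
    case False
    obtain x where "x \<in> C" "\<And>y. y \<in> C \<Longrightarrow> s x \<le> s y"
      using continuous_attains_inf[OF assms(1) False C1_fun_continuous[OF \<open>C1_fun s\<close>]] by blast
    moreover from this have "s x > 0" unfolding s_pos using A by blast
    ultimately show ?thesis by (intro that)
  qed (use that[of 1] in auto)
  define \<kappa> where "\<kappa> x = 1 - (max 0 (1 - (1/m) * s x))\<^sup>2" for x
  have max_bds: "0 \<le> max 0 (1 - (1/m) * s x)" "max 0 (1 - (1/m) * s x) \<le> 1" for x
    using m s_nonneg[of x] by auto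
  have C1: "C1_fun \<kappa>"
    unfolding \<kappa>_def by (intro C1_fun_diff C1_fun_truncated_square C1_fun_const C1_fun_mult \<open>C1_fun s\<close>)
  have ge0: "0 \<le> \<kappa> x" for x
    unfolding \<kappa>_def using power_mono[OF max_bds(2) max_bds(1), of x 2] by simp
  have le1: "\<kappa> x \<le> 1" for x
    unfolding \<kappa>_def by simp
  have eq1: "\<kappa> x = 1" if "x \<in> C" for x
    using m(2)[OF that] m(1) by (simp add: \<kappa>_def max_def field_simps)
  have sub: "closure {x. \<kappa> x \<noteq> 0} \<subseteq> (\<Union>a\<in>A. cball a (r a))"
  proof (rule closure_minimal)
    show "{x. \<kappa> x \<noteq> 0} \<subseteq> (\<Union>a\<in>A. cball a (r a))"
    proof
      fix x assume "x \<in> {x. \<kappa> x \<noteq> 0}"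
      then have "s x \<noteq> 0" by (auto simp: \<kappa>_def)
      then have "s x > 0" using s_nonneg[of x] by simp
      then show "x \<in> (\<Union>a\<in>A. cball a (r a))" using s_pos ball_subset_cball by blast
    qed
    show "closed (\<Union>a\<in>A. cball a (r a))" using A by auto
  qed
  have cpt: "compact (closure {x. \<kappa> x \<noteq> 0})"
  proof -
    have "bounded (\<Union>a\<in>A. cball a (r a))" using A by auto
    then show ?thesis
      using bounded_subset[OF _ sub] compact_eq_bounded_closed closed_closure by blast
  qed
  have "(\<Union>a\<in>A. cball a (r a)) \<subseteq> U"
    using r A by blast
  with sub have "closure {x. \<kappa> x \<noteq> 0} \<subseteq> U" by (rule order_trans)
  with C1 ge0 le1 eq1 cpt show thesis by (rule that)
qed

section \<open>The divergence theorem on a half-space\<close>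

lemma C1_fun_direction:
  assumes "C1_fun F"
  shows "((\<lambda>s. F (x - s *\<^sub>R e)) has_real_derivative - frechet_derivative F (at (x - s *\<^sub>R e)) e) (at s)"
proof -
  let ?D = "frechet_derivative F (at (x - s *\<^sub>R e))"
  have "linear ?D"
    using C1_fun_derivative[OF assms] has_derivative_linear by blast
  then have "(\<lambda>h. ?D (- (h *\<^sub>R e))) = (*) (- ?D e)"
    by (auto simp: linear_neg linear_scale)
  moreover have "((\<lambda>s. x - s *\<^sub>R e) has_derivative (\<lambda>h. - (h *\<^sub>R e))) (at s)"
    by (auto intro!: derivative_eq_intros)
  from has_derivative_compose[OF this C1_fun_derivative[OF assms]]
  have "((\<lambda>s. F (x - s *\<^sub>R e)) has_derivative (\<lambda>h. ?D (- (h *\<^sub>R e)))) (at s)" .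
  ultimately show ?thesis
    unfolding has_field_derivative_def by simp
qed

lemma frechet_derivative_outside_support:
  fixes F :: "real^'d \<Rightarrow> real"
  assumes "x \<notin> closure {x. F x \<noteq> 0}"
  shows "frechet_derivative F (at x) = (\<lambda>e. 0)"
proof -
  have "(F has_derivative (\<lambda>e. 0)) (at x)"
  proof (rule has_derivative_transform_within_open[where f="\<lambda>x. 0"])
    show "open (- closure {x. F x \<noteq> 0})" by auto
    show "0 = F y" if "y \<in> - closure {x. F x \<noteq> 0}" for y
      using that closure_subset[of "{x. F x \<noteq> 0}"] by auto
  qed (use assms in auto)
  then show ?thesis by (simp add: frechet_derivative_at[symmetric])
qed

lemma bounded_compact_support:
  fixes F :: "real^'d \<Rightarrow> real"
  assumes "continuous_on UNIV F" "compact A" "\<And>x. x \<notin> A \<Longrightarrow> F x = 0"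
  obtains M where "M \<ge> 0" "\<And>x. \<bar>F x\<bar> \<le> M"
proof -
  have "compact (F ` A)"
    by (intro compact_continuous_image continuous_on_subset[OF assms(1)] assms) auto
  then obtain M where "\<And>x. x \<in> A \<Longrightarrow> \<bar>F x\<bar> \<le> M"
    by (metis (no_types, lifting) bounded_iff compact_imp_bounded imageI real_norm_def)
  then have "\<bar>F x\<bar> \<le> max M 0" for x
    using assms(3)[of x] by (cases "x \<in> A") (auto simp: le_max_iff_disj)
  then show ?thesis by (intro that[of "max M 0"]) auto
qed

lemma C1_fun_bounded_derivative:
  assumes "C1_fun F" "compact (closure {x. F x \<noteq> 0})"
  obtains L where "L \<ge> 0" "\<And>x. \<bar>frechet_derivative F (at x) e\<bar> \<le> L"
  using bounded_compact_support[OF C1_fun_continuous_derivative[OF assms(1)] assms(2)]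
  by (metis frechet_derivative_outside_support)

lemma C1_fun_increment_bound:
  assumes "C1_fun F" "\<And>x. \<bar>frechet_derivative F (at x) e\<bar> \<le> L" "t \<ge> 0"
  shows "\<bar>F x - F (x - t *\<^sub>R e)\<bar> \<le> t * L"
proof (cases "t = 0")
  case False
  then have "t > 0" using assms by simp
  obtain s where "F (x - t *\<^sub>R e) - F (x - 0 *\<^sub>R e) = (t - 0) * - frechet_derivative F (at (x - s *\<^sub>R e)) e"
    using MVT2[OF \<open>t > 0\<close> C1_fun_direction[OF assms(1)], of x e] by blast
  then have "F x - F (x - t *\<^sub>R e) = t * frechet_derivative F (at (x - s *\<^sub>R e)) e"
    by simp
  then have "\<bar>F x - F (x - t *\<^sub>R e)\<bar> = t * \<bar>frechet_derivative F (at (x - s *\<^sub>R e)) e\<bar>"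
    using \<open>t > 0\<close> by (simp add: abs_mult)
  then show ?thesis using assms(2) \<open>t > 0\<close> by (simp add: mult_left_mono)
qed auto

lemma integral_translation:
  fixes f :: "real^'d \<Rightarrow> real"
  assumes "f \<in> borel_measurable borel"
  shows "(\<integral>x. f (x - a) \<partial>lborel) = (\<integral>x. f x \<partial>lborel)"
proof -
  have "(\<integral>x. f x \<partial>lborel) = (\<integral>x. f x \<partial>distr lborel borel ((+) (- a)))"
    by (simp add: lborel_distr_plus)
  also have "\<dots> = (\<integral>x. f (- a + x) \<partial>lborel)"
    by (rule integral_distr) (use assms in auto)
  finally show ?thesis by simp
qed

lemma integrable_translation:
  fixes f :: "real^'d \<Rightarrow> real"
  assumes "integrable lborel f"
  shows "integrable lborel (\<lambda>x. f (x - a))"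
proof -
  have "integrable (distr lborel borel ((+) (- a))) f"
    using assms by (simp add: lborel_distr_plus)
  from integrable_distr[OF _ this] show ?thesis by simp
qed

lemma integrable_compact_support:
  assumes "continuous_on UNIV (F :: real^'d \<Rightarrow> real)" "compact A" "\<And>x. x \<notin> A \<Longrightarrow> F x = 0"
  shows "integrable lborel F"
proof -
  have "integrable lborel (\<lambda>x. indicator A x *\<^sub>R F x)"
    using assms by (intro borel_integrable_compact) (auto intro: continuous_on_subset)
  also have "(\<lambda>x. indicator A x *\<^sub>R F x) = F"
  proof
    show "indicator A x *\<^sub>R F x = F x" for x
      using assms(3)[of x] by (cases "x \<in> A") auto
  qed
  finally show ?thesis .
qed

text \<open>Directional derivatives are integrated by passing to the limit in difference quotients;
  the translates of \<open>F\<close> can then be compared by the translation invariance of the volume.\<close>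

lemma integral_difference_quotient_tendsto:
  fixes F :: "real^'d \<Rightarrow> real"
  assumes F: "C1_fun F" "compact (closure {x. F x \<noteq> 0})" and S: "S \<in> sets borel"
  shows "(\<lambda>N. real (Suc N) * (\<integral>x. indicator S x * (F x - F (x - (1 / real (Suc N)) *\<^sub>R e)) \<partial>lborel))
    \<longlonglongrightarrow> (\<integral>x. indicator S x * frechet_derivative F (at x) e \<partial>lborel)"
proof -
  let ?\<tau> = "\<lambda>N. 1 / real (Suc N)"
  obtain L where L: "L \<ge> 0" "\<And>x. \<bar>frechet_derivative F (at x) e\<bar> \<le> L"
    using C1_fun_bounded_derivative[OF F] by metis
  obtain R where R: "\<And>x. x \<in> closure {x. F x \<noteq> 0} \<Longrightarrow> norm x \<le> R"
    using compact_imp_bounded[OF F(2)] unfolding bounded_iff by auto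
  have R0: "F x = 0" if "norm x > R" for x
    using R[of x] that closure_subset[of "{x. F x \<noteq> 0}"] by force
  have Fm[measurable]: "F \<in> borel_measurable borel"
    using C1_fun_continuous[OF F(1)] by (rule borel_measurable_continuous_onI)
  have Dm[measurable]: "(\<lambda>x. frechet_derivative F (at x) e) \<in> borel_measurable borel"
    using C1_fun_continuous_derivative[OF F(1)] by (rule borel_measurable_continuous_onI)
  note S[measurable]
  have "(\<lambda>N. \<integral>x. real (Suc N) * (indicator S x * (F x - F (x - ?\<tau> N *\<^sub>R e))) \<partial>lborel)
    \<longlonglongrightarrow> (\<integral>x. indicator S x * frechet_derivative F (at x) e \<partial>lborel)"
  proof (rule integral_dominated_convergence[where w="\<lambda>x. L * indicator (cball 0 (R + norm e)) x"])
    have "emeasure lborel (cball (0::real^'d) (R + norm e)) < \<infinity>"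
      by (intro emeasure_bounded_finite) auto
    then show "integrable lborel (\<lambda>x. L * indicator (cball (0::real^'d) (R + norm e)) x)"
      by (intro integrable_mult_right integrable_real_indicator) auto
    show "AE x in lborel. (\<lambda>N. real (Suc N) * (indicator S x * (F x - F (x - ?\<tau> N *\<^sub>R e))))
        \<longlonglongrightarrow> indicator S x * frechet_derivative F (at x) e"
    proof (rule AE_I2)
      fix x
      have "((\<lambda>s. (F (x - s *\<^sub>R e) - F x) / s) \<longlongrightarrow> - frechet_derivative F (at x) e) (at 0)"
        using C1_fun_direction[OF F(1), of x e 0] by (simp add: has_field_derivative_iff)
      moreover have "filterlim (\<lambda>N. ?\<tau> N) (at 0) sequentially"
        unfolding filterlim_at using LIMSEQ_inverse_real_of_nat by (auto simp: inverse_eq_divide)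
      ultimately have "(\<lambda>N. (F (x - ?\<tau> N *\<^sub>R e) - F x) / (?\<tau> N))
          \<longlonglongrightarrow> - frechet_derivative F (at x) e"
        by (rule filterlim_compose)
      then have "(\<lambda>N. - indicator S x * ((F (x - ?\<tau> N *\<^sub>R e) - F x) / (?\<tau> N)))
          \<longlonglongrightarrow> - indicator S x * - frechet_derivative F (at x) e"
        by (rule tendsto_mult_left)
      then show "(\<lambda>N. real (Suc N) * (indicator S x * (F x - F (x - ?\<tau> N *\<^sub>R e))))
        \<longlonglongrightarrow> indicator S x * frechet_derivative F (at x) e"
        by (simp add: algebra_simps)
    qed
    fix N
    show "AE x in lborel. norm (real (Suc N) * (indicator S x * (F x - F (x - ?\<tau> N *\<^sub>R e))))
        \<le> L * indicator (cball 0 (R + norm e)) x"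
    proof (rule AE_I2)
      fix x
      let ?t = "?\<tau> N"
      show "norm (real (Suc N) * (indicator S x * (F x - F (x - ?t *\<^sub>R e))))
        \<le> L * indicator (cball 0 (R + norm e)) x"
      proof (cases "norm x \<le> R + norm e")
        case True
        have "\<bar>F x - F (x - ?t *\<^sub>R e)\<bar> \<le> ?t * L"
          by (rule C1_fun_increment_bound[OF F(1) L(2)]) auto
        then have "real (Suc N) * \<bar>F x - F (x - ?t *\<^sub>R e)\<bar> \<le> L"
          by (simp add: field_simps)
        moreover have "norm (real (Suc N) * (indicator S x * (F x - F (x - ?t *\<^sub>R e))))
          \<le> real (Suc N) * \<bar>F x - F (x - ?t *\<^sub>R e)\<bar>"
          by (auto simp: abs_mult indicator_def)
        ultimately show ?thesis using True by (simp add: indicator_def)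
      next
        case False
        have "norm x \<le> norm (x - ?t *\<^sub>R e) + norm (?t *\<^sub>R e)"
          using norm_triangle_ineq[of "x - ?t *\<^sub>R e" "?t *\<^sub>R e"] by simp
        moreover have "norm (?t *\<^sub>R e) \<le> 1 * norm e"
          unfolding norm_scaleR by (intro mult_right_mono) auto
        ultimately have "F (x - ?t *\<^sub>R e) = 0" using False by (intro R0) simp
        moreover have "F x = 0" using False norm_ge_zero[of e] by (intro R0) linarith
        ultimately show ?thesis using L(1) by simp
      qed
    qed
  qed measurable
  then show ?thesis by simp
qed

text \<open>The slab is a stack of \<open>m\<close> translates of a thin one, which an integrand that is constant along
  the normal \<open>n\<close> cannot tell apart.\<close>

lemma slab_integral_multiple:
  fixes G :: "real^'d \<Rightarrow> real"
  assumes n: "norm n = 1" and inv: "\<And>x s. G (x + s *\<^sub>R n) = G x" and "G \<in> borel_measurable borel"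
    and int: "\<And>s. integrable lborel (\<lambda>x. indicator {x. b - s < n \<bullet> x \<and> n \<bullet> x \<le> b} x * G x)"
    and t: "t \<ge> 0"
  shows "(\<integral>x. indicator {x. b - real m * t < n \<bullet> x \<and> n \<bullet> x \<le> b} x * G x \<partial>lborel)
    = real m * (\<integral>x. indicator {x. b - t < n \<bullet> x \<and> n \<bullet> x \<le> b} x * G x \<partial>lborel)"
proof (induction m)
  case (Suc m)
  note [measurable] = assms(3)
  let ?S = "\<lambda>s. {x. b - s < n \<bullet> x \<and> n \<bullet> x \<le> b}"
  have nn: "n \<bullet> n = 1" using n by (simp add: norm_eq_1)
  let ?a = "- (real m * t) *\<^sub>R n"
  let ?f = "\<lambda>x. indicator (?S t) x * G x"
  have split: "indicator (?S (real (Suc m) * t)) x * G x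
      = indicator (?S (real m * t)) x * G x + ?f (x - ?a)" for x
  proof -
    have "G (x - ?a) = G x" using inv[of x "real m * t"] by simp
    moreover have "n \<bullet> (x - ?a) = n \<bullet> x + real m * t" by (simp add: inner_diff_right inner_add_right nn)
    moreover obtain u where "u = real m * t" "u \<ge> 0" using t by auto
    moreover have "real (Suc m) * t = real m * t + t" by (simp add: algebra_simps)
    moreover have "b - t < q + u \<and> q + u \<le> b \<longleftrightarrow> b - (u + t) < q \<and> q \<le> b \<and> \<not> (b - u < q)"
      if "u \<ge> 0" for q u :: real using that t by linarith
    ultimately have eqs: "x - ?a \<in> ?S t \<longleftrightarrow> x \<in> ?S (u + t) \<and> x \<notin> ?S u" "x \<in> ?S u \<longrightarrow> x \<in> ?S (u + t)"
      "real m * t = u" "real (Suc m) * t = u + t" "G (x - ?a) = G x"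
      using t by auto
    have "indicator A x * g = indicator B x * g + indicator A' y * g"
      if "y \<in> A' \<longleftrightarrow> x \<in> A \<and> x \<notin> B" "x \<in> B \<longrightarrow> x \<in> A" for A B A' :: "(real^'d) set" and x y and g :: real
      using that by (auto simp: indicator_def)
    from this[OF eqs(1,2), of "G x"] show ?thesis
      unfolding eqs(5) unfolding eqs(3,4) .
  qed
  have int2: "integrable lborel (\<lambda>x. ?f (x - ?a))"
  proof -
    have "(\<lambda>x. ?f (x - ?a))
       = (\<lambda>x. indicator (?S (real (Suc m) * t)) x * G x - indicator (?S (real m * t)) x * G x)"
      by (subst split) auto
    then show ?thesis using Bochner_Integration.integrable_diff[OF int int] by simp
  qed
  have "(\<integral>x. indicator (?S (real (Suc m) * t)) x * G x \<partial>lborel)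
     = (\<integral>x. indicator (?S (real m * t)) x * G x \<partial>lborel) + (\<integral>x. ?f (x - ?a) \<partial>lborel)"
    unfolding split by (rule Bochner_Integration.integral_add[OF int int2])
  also have "(\<integral>x. ?f (x - ?a) \<partial>lborel) = (\<integral>x. ?f x \<partial>lborel)"
    by (rule integral_translation) measurable
  finally show ?case using Suc by (simp add: algebra_simps)
next
  case 0
  have "{x. b - real 0 * t < n \<bullet> x \<and> n \<bullet> x \<le> b} = {}" by auto
  then show ?case by (simp only:) simp
qed

definition hyperplane_proj :: "real^'d \<Rightarrow> real \<Rightarrow> real^'d \<Rightarrow> real^'d" where
  "hyperplane_proj n b x = x - (n \<bullet> x - b) *\<^sub>R n"

lemma measurable_hyperplane_proj[measurable]: "hyperplane_proj n b \<in> borel_measurable borel"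
  unfolding hyperplane_proj_def by measurable

lemma hyperplane_proj_translate:
  "norm n = 1 \<Longrightarrow> hyperplane_proj n b (x + s *\<^sub>R n) = hyperplane_proj n b x"
  by (simp add: hyperplane_proj_def inner_add_right norm_eq_1 algebra_simps)

lemma inner_hyperplane_proj: "norm n = 1 \<Longrightarrow> n \<bullet> hyperplane_proj n b x = b"
  by (simp add: hyperplane_proj_def inner_diff_right norm_eq_1)

lemma integrable_slab:
  fixes g :: "real^'d \<Rightarrow> real"
  assumes n: "norm n = 1" and "g \<in> borel_measurable borel" and S: "S \<in> sets borel"
    and S_thin: "\<And>x. x \<in> S \<Longrightarrow> \<bar>n \<bullet> x - b\<bar> \<le> s"
    and M: "\<And>x. \<bar>g x\<bar> \<le> M" and R: "\<And>x. norm x > R \<Longrightarrow> g x = 0"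
  shows "integrable lborel (\<lambda>x. indicator S x * g (hyperplane_proj n b x))"
proof (rule Bochner_Integration.integrable_bound[where f="\<lambda>x. M * indicator (cball 0 (R + s)) x"])
  have "emeasure lborel (cball (0::real^'d) (R + s)) < \<infinity>"
    by (intro emeasure_bounded_finite) auto
  then show "integrable lborel (\<lambda>x. M * indicator (cball (0::real^'d) (R + s)) x)"
    by (intro integrable_mult_right integrable_real_indicator) auto
  note [measurable] = assms(2) S
  show "(\<lambda>x. indicator S x * g (hyperplane_proj n b x)) \<in> borel_measurable lborel"
    by measurable
  show "AE x in lborel. norm (indicator S x * g (hyperplane_proj n b x)) \<le> norm (M * indicator (cball 0 (R + s)) x)"
  proof (rule AE_I2)
    fix x
    have "M \<ge> 0" using M[of x] by linarith
    show "norm (indicator S x * g (hyperplane_proj n b x)) \<le> norm (M * indicator (cball 0 (R + s)) x)"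
    proof (cases "x \<in> S \<and> g (hyperplane_proj n b x) \<noteq> 0")
      case True
      then have "norm (hyperplane_proj n b x) \<le> R" using R by force
      moreover have "norm x \<le> norm (hyperplane_proj n b x) + norm ((n \<bullet> x - b) *\<^sub>R n)"
        using norm_triangle_ineq[of "hyperplane_proj n b x" "(n \<bullet> x - b) *\<^sub>R n"] by (simp add: hyperplane_proj_def)
      ultimately have "norm x \<le> R + s" using S_thin[of x] True n by simp
      then show ?thesis using M \<open>M \<ge> 0\<close> True by (simp add: indicator_def)
    qed auto
  qed
qed

text \<open>For a tangential direction the two terms of the difference quotient cancel. For the direction
  \<open>n\<close> they leave the mean of \<open>F\<close> over a thin slab below the hyperplane, on which \<open>F\<close> may be replaced
  by its value at the projected point, and such means do not depend on the thickness.\<close>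

lemma halfspace_divergence:
  fixes F :: "real^'d \<Rightarrow> real"
  assumes F: "C1_fun F" "compact (closure {x. F x \<noteq> 0})" and n: "norm n = 1"
  shows "(\<integral>x. indicator {x. n \<bullet> x \<le> b} x * frechet_derivative F (at x) e \<partial>lborel)
    = (n \<bullet> e) * (\<integral>x. indicator {x. \<bar>n \<bullet> x - b\<bar> \<le> 1/2} x * F (hyperplane_proj n b x) \<partial>lborel)"
proof -
  let ?H = "{x. n \<bullet> x \<le> b}"
  let ?S = "\<lambda>s. {x. b - s < n \<bullet> x \<and> n \<bullet> x \<le> b}"
  let ?p = "hyperplane_proj n b"
  have nn: "n \<bullet> n = 1" using n by (simp add: norm_eq_1)
  have Fm[measurable]: "F \<in> borel_measurable borel"
    using C1_fun_continuous[OF F(1)] by (rule borel_measurable_continuous_onI)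
  have F_supp: "F x = 0" if "x \<notin> closure {x. F x \<noteq> 0}" for x
    using that closure_subset[of "{x. F x \<noteq> 0}"] by force
  have F_int: "integrable lborel F"
    by (rule integrable_compact_support[OF C1_fun_continuous[OF F(1)] F(2) F_supp])
  have F_int_on: "integrable lborel (\<lambda>x. indicator A x * F x)" if "A \<in> sets borel" for A
    using integrable_mult_indicator[OF _ F_int, of A] that by simp
  have F_int_shift: "integrable lborel (\<lambda>x. indicator A x * F (x - a))" if "A \<in> sets borel" for A a
    using integrable_mult_indicator[OF _ integrable_translation[OF F_int], of A] that by simp
  have shift: "(\<integral>x. indicator ?H x * (F x - F (x - a)) \<partial>lborel)
      = (\<integral>x. indicator ?H x * F x \<partial>lborel) - (\<integral>x. indicator {x. n \<bullet> x \<le> b - n \<bullet> a} x * F x \<partial>lborel)" for a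
  proof -
    have "(\<integral>x. indicator ?H x * (F x - F (x - a)) \<partial>lborel)
       = (\<integral>x. indicator ?H x * F x \<partial>lborel) - (\<integral>x. indicator ?H x * F (x - a) \<partial>lborel)"
      unfolding right_diff_distrib by (intro Bochner_Integration.integral_diff F_int_on F_int_shift) measurable
    also have "(\<integral>x. indicator ?H x * F (x - a) \<partial>lborel)
       = (\<integral>x. indicator {x. n \<bullet> x \<le> b - n \<bullet> a} (x - a) * F (x - a) \<partial>lborel)"
      by (intro Bochner_Integration.integral_cong refl) (auto simp: indicator_def inner_diff_right)
    also have "\<dots> = (\<integral>x. indicator {x. n \<bullet> x \<le> b - n \<bullet> a} x * F x \<partial>lborel)"
      by (rule integral_translation) measurable
    finally show ?thesis .
  qed
  have tangential: "(\<integral>x. indicator ?H x * frechet_derivative F (at x) e \<partial>lborel) = 0" if "n \<bullet> e = 0" for e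
  proof -
    have "(\<lambda>N. real (Suc N) * (\<integral>x. indicator ?H x * (F x - F (x - (1 / real (Suc N)) *\<^sub>R e)) \<partial>lborel)) = (\<lambda>N. 0)"
      unfolding shift by (simp add: that)
    with integral_difference_quotient_tendsto[OF F, of ?H e] show ?thesis
      by (simp add: LIMSEQ_const_iff)
  qed
  define I where "I = (\<integral>x. indicator (?S 1) x * F (?p x) \<partial>lborel)"
  obtain R where R: "\<And>x. x \<in> closure {x. F x \<noteq> 0} \<Longrightarrow> norm x \<le> R"
    using compact_imp_bounded[OF F(2)] unfolding bounded_iff by auto
  have R0: "F x = 0" if "norm x > R" for x
    using R[of x] that by (intro F_supp) auto
  obtain M where M: "\<And>x. \<bar>F x\<bar> \<le> M"
    using bounded_compact_support[OF C1_fun_continuous[OF F(1)] F(2) F_supp] by metis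
  have int_Fp: "integrable lborel (\<lambda>x. indicator A x * F (?p x))"
    if "A \<in> sets borel" "\<And>x. x \<in> A \<Longrightarrow> \<bar>n \<bullet> x - b\<bar> \<le> s" for A s
    by (rule integrable_slab[OF n Fm that(1) that(2) M R0])
  obtain L where L: "L \<ge> 0" "\<And>x. \<bar>frechet_derivative F (at x) n\<bar> \<le> L"
    using C1_fun_bounded_derivative[OF F] by metis
  \<comment> \<open>Slabs of thickness at most \<open>1\<close> meet the support of \<open>F\<close>, which has radius \<open>R\<close>, only over this disc.\<close>
  let ?G = "\<lambda>x. indicator (cball 0 (R + 1)) (?p x) :: real"
  have int_G: "integrable lborel (\<lambda>x. indicator (?S s) x * ?G x)" for s
    by (rule integrable_slab[where s="\<bar>s\<bar>" and M=1 and R="R + 1", OF n]) (auto simp: indicator_def)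
  have normal: "(\<integral>x. indicator ?H x * frechet_derivative F (at x) n \<partial>lborel) = I"
  proof -
    define c where "c = (\<integral>x. indicator (?S 1) x * ?G x \<partial>lborel)"
    have int_S: "integrable lborel (\<lambda>x. indicator (?S s) x * F (?p x))" for s
      by (rule int_Fp[where s="\<bar>s\<bar>"]) auto
    define J where "J N = real (Suc N) * (\<integral>x. indicator (?S (1 / real (Suc N))) x * F x \<partial>lborel)" for N
    have J: "J N = real (Suc N) * (\<integral>x. indicator ?H x * (F x - F (x - (1 / real (Suc N)) *\<^sub>R n)) \<partial>lborel)" for N
    proof -
      let ?t = "1 / real (Suc N)"
      have "(\<integral>x. indicator (?S ?t) x * F x \<partial>lborel)
        = (\<integral>x. indicator ?H x * F x - indicator {x. n \<bullet> x \<le> b - ?t} x * F x \<partial>lborel)"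
      proof (intro Bochner_Integration.integral_cong refl)
        fix x
        have "b - ?t \<le> b" by simp
        then have "n \<bullet> x \<le> b" if "n \<bullet> x \<le> b - ?t" using that by (rule order_trans[rotated])
        then show "indicator (?S ?t) x * F x = indicator ?H x * F x - indicator {x. n \<bullet> x \<le> b - ?t} x * F x"
          by (auto simp: indicator_def simp del: of_nat_Suc)
      qed
      also have "\<dots> = (\<integral>x. indicator ?H x * F x \<partial>lborel) - (\<integral>x. indicator {x. n \<bullet> x \<le> b - ?t} x * F x \<partial>lborel)"
        by (intro Bochner_Integration.integral_diff F_int_on) measurable
      finally show ?thesis unfolding J_def shift by (simp add: nn)
    qed
    have [measurable]: "?G \<in> borel_measurable borel"
      by (rule measurable_compose[OF measurable_hyperplane_proj borel_measurable_indicator]) simp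
    have close: "\<bar>J N - I\<bar> \<le> L * c / real (Suc N)" for N
    proof -
      let ?t = "1 / real (Suc N)"
      have one: "real (Suc N) * ?t = 1" by simp
      have I: "I = real (Suc N) * (\<integral>x. indicator (?S ?t) x * F (?p x) \<partial>lborel)"
        using slab_integral_multiple[OF n, of "\<lambda>x. F (?p x)" b ?t "Suc N", unfolded one]
        unfolding I_def by (auto simp: hyperplane_proj_translate[OF n] int_S)
      have c: "c = real (Suc N) * (\<integral>x. indicator (?S ?t) x * ?G x \<partial>lborel)"
        using slab_integral_multiple[OF n, of ?G b ?t "Suc N", unfolded one]
        unfolding c_def by (auto simp: hyperplane_proj_translate[OF n] int_G)
      let ?d = "\<lambda>x. indicator (?S ?t) x * F x - indicator (?S ?t) x * F (?p x)"
      have "J N - I = real (Suc N) * (\<integral>x. ?d x \<partial>lborel)"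
        unfolding I J_def
        by (subst Bochner_Integration.integral_diff) (auto simp: right_diff_distrib F_int_on int_S)
      then have "\<bar>J N - I\<bar> = real (Suc N) * \<bar>\<integral>x. ?d x \<partial>lborel\<bar>"
        by (simp add: abs_mult)
      also have "\<dots> \<le> real (Suc N) * (\<integral>x. ?t * L * (indicator (?S ?t) x * ?G x) \<partial>lborel)"
      proof (intro mult_left_mono)
        have "\<bar>\<integral>x. ?d x \<partial>lborel\<bar>
          \<le> (\<integral>x. norm (?d x) \<partial>lborel)"
          using integral_norm_bound[of lborel ?d] by simp
        also have "\<dots> \<le> (\<integral>x. ?t * L * (indicator (?S ?t) x * ?G x) \<partial>lborel)"
        proof (rule integral_mono)
          show "integrable lborel (\<lambda>x. norm (?d x))"
            by (intro integrable_norm Bochner_Integration.integrable_diff F_int_on int_Fp[where s="?t"]) auto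
          show "integrable lborel (\<lambda>x. ?t * L * (indicator (?S ?t) x * ?G x))"
            by (intro integrable_mult_right int_G)
          fix x
          show "norm (?d x) \<le> ?t * L * (indicator (?S ?t) x * ?G x)"
          proof (cases "x \<in> ?S ?t")
            case True
            define s where "s = b - n \<bullet> x"
            have s: "0 \<le> s" "s \<le> ?t" "?t \<le> 1" using True by (auto simp: s_def)
            have x: "x = ?p x - s *\<^sub>R n" by (simp add: hyperplane_proj_def s_def algebra_simps)
            have "\<bar>F (?p x) - F (?p x - s *\<^sub>R n)\<bar> \<le> s * L"
              by (rule C1_fun_increment_bound[OF F(1) L(2) s(1)])
            then have "\<bar>F x - F (?p x)\<bar> \<le> s * L" using x by (simp add: abs_minus_commute)
            also have "\<dots> \<le> ?t * L" using s L by (intro mult_right_mono)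
            finally have bd: "\<bar>F x - F (?p x)\<bar> \<le> ?t * L" .
            show ?thesis
            proof (cases "norm (?p x) \<le> R + 1")
              case True
              then show ?thesis using bd \<open>x \<in> ?S ?t\<close> by (simp add: indicator_def)
            next
              case False
              have "norm (?p x) \<le> norm x + norm (s *\<^sub>R n)"
                using norm_triangle_ineq[of x "s *\<^sub>R n"] x by (metis add_diff_cancel add.commute diff_add_cancel)
              then have "norm (?p x) \<le> norm x + s" using s(1) n by simp
              then have "norm x > R" using False s(2,3) by linarith
              then have "F x = 0" "F (?p x) = 0" using R0 False by auto
              then show ?thesis using L by (simp add: indicator_def)
            qed
          qed auto
        qed
        finally show "\<bar>\<integral>x. ?d x \<partial>lborel\<bar>
          \<le> (\<integral>x. ?t * L * (indicator (?S ?t) x * ?G x) \<partial>lborel)" .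
      qed auto
      also have "\<dots> = L * (\<integral>x. indicator (?S ?t) x * ?G x \<partial>lborel)" by simp
      also have "\<dots> = L * c / real (Suc N)" unfolding c by simp
      finally show ?thesis .
    qed
    have "(\<lambda>N. L * c / real (Suc N)) \<longlonglongrightarrow> 0"
      using tendsto_mult_right_zero[OF LIMSEQ_inverse_real_of_nat, of "L * c"] by (simp add: divide_inverse)
    then have "(\<lambda>N. J N - I) \<longlonglongrightarrow> 0"
      by (rule Lim_null_comparison[rotated]) (use close in auto)
    then have "J \<longlonglongrightarrow> I" by (rule LIM_zero_cancel)
    have "?H \<in> sets borel" by measurable
    from integral_difference_quotient_tendsto[OF F this, of n]
    have "J \<longlonglongrightarrow> (\<integral>x. indicator ?H x * frechet_derivative F (at x) n \<partial>lborel)"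
      unfolding J[abs_def] by simp
    then show ?thesis using \<open>J \<longlonglongrightarrow> I\<close> by (rule LIMSEQ_unique)
  qed
  \<comment> \<open>The slab below the hyperplane is moved by \<open>1/2\<close> to the one around it; the two differ by a boundary plane.\<close>
  have I_sym: "I = (\<integral>x. indicator {x. \<bar>n \<bullet> x - b\<bar> \<le> 1/2} x * F (?p x) \<partial>lborel)"
  proof -
    have "I = (\<integral>x. indicator (?S 1) (x - (1/2) *\<^sub>R n) * F (?p (x - (1/2) *\<^sub>R n)) \<partial>lborel)"
      unfolding I_def by (rule integral_translation[symmetric]) measurable
    also have "\<dots> = (\<integral>x. indicator {x. \<bar>n \<bullet> x - b\<bar> \<le> 1/2} x * F (?p x) \<partial>lborel)"
    proof (rule integral_cong_AE)
      have "n \<noteq> 0" using n by auto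
      then have "negligible {x. n \<bullet> x = b - 1/2}" by (intro negligible_hyperplane) auto
      then have "{x. n \<bullet> x = b - 1/2} \<in> null_sets lborel"
        by (simp add: negligible_iff_null_sets null_sets_completion_iff)
      from AE_not_in[OF this] have "AE x in lborel. n \<bullet> x \<noteq> b - 1/2" by simp
      then show "AE x in lborel. indicator (?S 1) (x - (1/2) *\<^sub>R n) * F (?p (x - (1/2) *\<^sub>R n))
        = indicator {x. \<bar>n \<bullet> x - b\<bar> \<le> 1/2} x * F (?p x)"
      proof eventually_elim
        case (elim x)
        have "?p (x - (1/2) *\<^sub>R n) = ?p x"
          using hyperplane_proj_translate[OF n, of b x "- (1/2)"] by simp
        then show ?case using elim by (auto simp: indicator_def inner_diff_right nn abs_if)
      qed
    qed measurable
    finally show ?thesis .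
  qed
  define e' where "e' = e - (n \<bullet> e) *\<^sub>R n"
  have ne': "n \<bullet> e' = 0" by (simp add: e'_def inner_diff_right nn)
  have int_D: "integrable lborel (\<lambda>x. indicator ?H x * frechet_derivative F (at x) v)" for v
  proof -
    have "integrable lborel (\<lambda>x. frechet_derivative F (at x) v)"
      by (rule integrable_compact_support[OF C1_fun_continuous_derivative[OF F(1)] F(2)])
         (simp add: frechet_derivative_outside_support)
    then show ?thesis using integrable_mult_indicator[of ?H lborel "\<lambda>x. frechet_derivative F (at x) v"] by simp
  qed
  have "frechet_derivative F (at x) e = (n \<bullet> e) * frechet_derivative F (at x) n + frechet_derivative F (at x) e'" for x
  proof -
    have "linear (frechet_derivative F (at x))"
      using C1_fun_derivative[OF F(1)] has_derivative_linear by blast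
    then have "frechet_derivative F (at x) ((n \<bullet> e) *\<^sub>R n + e')
      = (n \<bullet> e) * frechet_derivative F (at x) n + frechet_derivative F (at x) e'"
      by (simp add: linear_add linear_scale)
    then show ?thesis by (simp add: e'_def)
  qed
  then have "(\<integral>x. indicator ?H x * frechet_derivative F (at x) e \<partial>lborel)
    = (\<integral>x. (n \<bullet> e) * (indicator ?H x * frechet_derivative F (at x) n) + indicator ?H x * frechet_derivative F (at x) e' \<partial>lborel)"
    by (simp add: algebra_simps)
  also have "\<dots> = (n \<bullet> e) * I"
    using normal tangential[OF ne'] int_D by simp
  finally show ?thesis using I_sym by simp
qed

section \<open>Facets of simplices\<close>

lemma integral_lebesgue_on_borel:
  fixes f :: "real^'d \<Rightarrow> real"
  assumes "A \<in> sets borel" "f \<in> borel_measurable borel"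
  shows "(LINT x|lebesgue_on A. f x) = (\<integral>x. indicator A x * f x \<partial>lborel)"
proof -
  note [measurable] = assms
  have "(LINT x|lebesgue_on A. f x) = (\<integral>x. indicator A x *\<^sub>R f x \<partial>lebesgue)"
    using assms by (intro integral_restrict_space) auto
  also have "\<dots> = (\<integral>x. indicator A x *\<^sub>R f x \<partial>lborel)"
    by (rule integral_completion) measurable
  finally show ?thesis by simp
qed

text \<open>The gradient of a cut-off vanishes where the cut-off attains its maximum \<open>1\<close>.\<close>

lemma cutoff_transparent:
  fixes F \<kappa> :: "real^'d \<Rightarrow> real"
  assumes F: "C1_fun F" and k: "C1_fun \<kappa>" "\<And>x. \<kappa> x \<le> 1"
    and one: "x \<in> closure {x. F x \<noteq> 0} \<Longrightarrow> \<kappa> x = 1"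
  shows "F x * \<kappa> x = F x"
    and "frechet_derivative (\<lambda>x. F x * \<kappa> x) (at x) = frechet_derivative F (at x)"
proof -
  have dG: "frechet_derivative (\<lambda>x. F x * \<kappa> x) (at x)
      = (\<lambda>e. F x * frechet_derivative \<kappa> (at x) e + frechet_derivative F (at x) e * \<kappa> x)"
    by (rule frechet_derivative_at[symmetric],
        rule has_derivative_mult[OF C1_fun_derivative[OF F] C1_fun_derivative[OF k(1)]])
  have "F x * \<kappa> x = F x \<and> frechet_derivative (\<lambda>x. F x * \<kappa> x) (at x) = frechet_derivative F (at x)"
  proof (cases "x \<in> closure {x. F x \<noteq> 0}")
    case True
    then have "\<kappa> x = 1" by (rule one)
    moreover have "frechet_derivative \<kappa> (at x) = (\<lambda>v. 0)"
      using differential_zero_maxmin[of x UNIV \<kappa>, OF _ _ C1_fun_derivative[OF k(1)]] k(2) \<open>\<kappa> x = 1\<close> by auto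
    ultimately show ?thesis unfolding dG by simp
  next
    case False
    then have "F x = 0" using closure_subset[of "{x. F x \<noteq> 0}"] by auto
    then show ?thesis unfolding dG by (simp add: frechet_derivative_outside_support[OF False])
  qed
  then show "F x * \<kappa> x = F x"
    "frechet_derivative (\<lambda>x. F x * \<kappa> x) (at x) = frechet_derivative F (at x)" by auto
qed

locale simplex_facet =
  fixes K E :: "(real^'d) set"
  assumes simplex: "int CARD('d) simplex K" and facet: "E facet_of K"
begin

abbreviation normal :: "real^'d" where "normal \<equiv> outer_normal K E"

definition offset :: real where "offset = normal \<bullet> (SOME a. a \<in> E)"

abbreviation proj :: "real^'d \<Rightarrow> real^'d" where "proj \<equiv> hyperplane_proj normal offset"

lemma polytope_K: "polytope K" and polyhedron_K: "polyhedron K"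
  using simplex by (auto intro: simplex_imp_polytope simplex_imp_polyhedron)

lemma compact_K: "compact K" and convex_K: "convex K" and closed_K: "closed K"
  using polytope_K by (auto intro: polytope_imp_compact polytope_imp_convex polytope_imp_closed)

lemma face_E: "E face_of K" and E_subset_K: "E \<subseteq> K" and E_nonempty: "E \<noteq> {}"
  using facet by (auto simp: facet_of_def dest: face_of_imp_subset)

lemma convex_E: "convex E" and compact_E: "compact E"
  using face_of_imp_convex[OF face_E] face_of_imp_compact[OF convex_K compact_K face_E] by auto

lemma rel_interior_K: "rel_interior K = interior K"
  using aff_dim_simplex[OF simplex] by (intro interior_rel_interior) simp

lemma interior_K_nonempty: "interior K \<noteq> {}"
  using rel_interior_eq_empty[OF convex_K] rel_interior_K E_nonempty E_subset_K by auto

lemma closure_interior_K: "closure (interior K) = K"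
  using convex_closure_interior[OF convex_K interior_K_nonempty] closed_K by simp

lemma frontier_K: "frontier K = \<Union> {F. F facet_of K}"
  using rel_boundary_of_polyhedron[OF polyhedron_K] closed_K rel_interior_K by (simp add: frontier_def)

lemma
  shows norm_normal: "norm normal = 1"
    and K_subset: "K \<subseteq> {x. normal \<bullet> x \<le> offset}"
    and E_subset: "E \<subseteq> {x. normal \<bullet> x = offset}"
proof -
  obtain a c where a: "a \<noteq> 0" and K: "K \<subseteq> {x. a \<bullet> x \<le> c}" and E: "E = K \<inter> {x. a \<bullet> x = c}"
    using facet_of_polyhedron[OF polyhedron_K facet] by blast
  have "norm ((1 / norm a) *\<^sub>R a) = 1" using a by simp
  moreover have "K \<subseteq> {x. ((1 / norm a) *\<^sub>R a) \<bullet> x \<le> c / norm a}"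
    using a K by (auto simp: divide_right_mono)
  moreover have "E \<subseteq> {x. ((1 / norm a) *\<^sub>R a) \<bullet> x = c / norm a}"
    using E by auto
  ultimately have "\<exists>n. norm n = 1 \<and> (\<exists>b. K \<subseteq> {x. n \<bullet> x \<le> b} \<and> E \<subseteq> {x. n \<bullet> x = b})"
    by blast
  from someI_ex[OF this]
  obtain b where b: "norm normal = 1" "K \<subseteq> {x. normal \<bullet> x \<le> b}" "E \<subseteq> {x. normal \<bullet> x = b}"
    unfolding outer_normal_def by blast
  moreover have "offset = b"
    unfolding offset_def using b(3) E_nonempty some_in_eq[of E] by blast
  ultimately show "norm normal = 1" "K \<subseteq> {x. normal \<bullet> x \<le> offset}" "E \<subseteq> {x. normal \<bullet> x = offset}"
    by simp_all
qed

lemma normal_nonzero: "normal \<noteq> 0"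
  using norm_normal by auto

lemma affine_hull_E: "affine hull E = {x. normal \<bullet> x = offset}"
proof (rule affine_dim_equal)
  show "affine hull E \<subseteq> {x. normal \<bullet> x = offset}"
    using E_subset affine_hyperplane by (intro hull_minimal) auto
  have "aff_dim E = int CARD('d) - 1"
    using facet aff_dim_simplex[OF simplex] by (simp add: facet_of_def)
  then show "aff_dim (affine hull E) = aff_dim {x. normal \<bullet> x = offset}"
    using normal_nonzero by simp
qed (use E_nonempty affine_hyperplane in auto)

lemma interior_K_subset: "interior K \<subseteq> {x. normal \<bullet> x < offset}"
  using interior_mono[OF K_subset] normal_nonzero by simp

text \<open>A facet spans a hyperplane, which determines its unit normals up to sign.\<close>

lemma unit_normal_cases:
  assumes "norm m = 1" "E \<subseteq> {x. m \<bullet> x = c}"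
  shows "m = normal \<or> m = - normal"
proof -
  obtain a where a: "a \<in> E" using E_nonempty by blast
  have "affine hull E \<subseteq> {x. m \<bullet> x = c}"
    using assms affine_hyperplane by (intro hull_minimal) auto
  then have *: "m \<bullet> x = c" if "normal \<bullet> x = offset" for x
    using that affine_hull_E by auto
  define v where "v = m - (normal \<bullet> m) *\<^sub>R normal"
  have nv: "normal \<bullet> v = 0"
    using norm_normal by (simp add: v_def inner_diff_right norm_eq_1)
  have "m \<bullet> (a + v) = c" "m \<bullet> a = c"
    using *[of "a + v"] *[of a] a E_subset nv by (auto simp: inner_add_right)
  then have "m \<bullet> v = 0" by (simp add: inner_add_right)
  then have "v \<bullet> v = 0" using nv by (simp add: v_def inner_diff_left)
  then have m: "m = (normal \<bullet> m) *\<^sub>R normal" by (simp add: v_def)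
  then have "\<bar>normal \<bullet> m\<bar> = 1" using assms(1) norm_normal by (metis norm_scaleR mult.right_neutral)
  then have "normal \<bullet> m = 1 \<or> normal \<bullet> m = - 1" by linarith
  then show ?thesis using m by (metis scaleR_one scaleR_minus1_left)
qed

text \<open>Near a relative interior point of \<open>E\<close> the simplex coincides with its supporting half-space,
  since the other facets, which make up the rest of the boundary, stay at a positive distance.\<close>

lemma facet_neighbourhood:
  assumes a: "a \<in> rel_interior E"
  obtains r where "r > 0" "ball a r \<inter> {x. normal \<bullet> x < offset} \<subseteq> interior K"
    "ball a r \<inter> {x. normal \<bullet> x = offset} \<subseteq> rel_interior E"
proof -
  have aE: "a \<in> E" using a rel_interior_subset by blast
  let ?Z = "\<Union> ({F. F facet_of K} - {E})"
  have "finite {F. F facet_of K}" using finite_polytope_facets[OF polytope_K] by simp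
  moreover have "closed F" if "F facet_of K" for F
    using that face_of_imp_compact[OF convex_K compact_K] compact_imp_closed by (auto simp: facet_of_def)
  ultimately have "closed ?Z" by (intro closed_Union) auto
  moreover have "a \<notin> ?Z"
  proof
    assume "a \<in> ?Z"
    then obtain F where F: "F facet_of K" "F \<noteq> E" "a \<in> F" by auto
    have "E \<subseteq> F"
      using F a E_subset_K by (intro subset_of_face_of[of F K E]) (auto simp: facet_of_def)
    then have "E face_of F"
      using face_of_subset[OF face_E] F facet_of_imp_subset by blast
    moreover have "convex F" using F by (auto simp: facet_of_def intro: face_of_imp_convex)
    ultimately have "aff_dim E < aff_dim F" using F face_of_aff_dim_lt by blast
    then show False using F facet by (simp add: facet_of_def)
  qed
  ultimately have "open (- ?Z) \<and> a \<in> - ?Z" by blast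
  then obtain r1 where r1: "r1 > 0" "ball a r1 \<subseteq> - ?Z"
    using openE by blast
  obtain r2 where r2: "r2 > 0" "ball a r2 \<inter> affine hull E \<subseteq> E"
    using a by (auto simp: mem_rel_interior_ball)
  define r where "r = min r1 r2"
  have r: "r > 0" using r1 r2 by (simp add: r_def)
  have eqpart: "ball a r \<inter> {x. normal \<bullet> x = offset} \<subseteq> rel_interior E"
  proof
    fix y assume y: "y \<in> ball a r \<inter> {x. normal \<bullet> x = offset}"
    obtain s where s: "s > 0" "ball y s \<subseteq> ball a r"
      using y openE[OF open_ball, of y a r] by blast
    have "ball y s \<subseteq> ball a r2" using s(2) by (rule order_trans) (auto simp: r_def)
    then have "ball y s \<inter> affine hull E \<subseteq> E"
      using r2 by blast
    moreover have "y \<in> E" using y r2 affine_hull_E by (auto simp: r_def)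
    ultimately show "y \<in> rel_interior E"
      using s by (auto simp: mem_rel_interior_ball)
  qed
  let ?B = "ball a r \<inter> {x. normal \<bullet> x < offset}"
  have "?B \<subseteq> interior K"
  proof (rule ccontr)
    assume "\<not> ?B \<subseteq> interior K"
    moreover have "?B \<inter> frontier K = {}"
      using r1 E_subset unfolding frontier_K r_def by fastforce
    moreover have "connected ?B"
      by (intro convex_connected convex_Int convex_ball convex_halfspace_lt)
    moreover have "?B \<inter> K \<noteq> {}"
    proof -
      have "a \<in> closure (interior K)" using aE E_subset_K closure_interior_K by auto
      then obtain y where "y \<in> interior K" "dist y a < r"
        using r closure_approachable by blast
      then have "y \<in> ?B \<inter> K"
        using interior_K_subset interior_subset by (auto simp: dist_commute)
      then show ?thesis by blast
    qed
    moreover have "?B - K \<noteq> {}"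
      using calculation(1,2) closed_K by (auto simp: frontier_def)
    ultimately show False using connected_Int_frontier[of ?B K] by blast
  qed
  then show ?thesis using that r eqpart by blast
qed

text \<open>The collar of \<open>E\<close>: an open set that meets the half-space \<open>normal \<bullet> x \<le> offset\<close> in \<open>K\<close> only, and meets the boundary of
  \<open>K\<close> in the relative interior of \<open>E\<close> only. Cut-off functions supported in it localize to \<open>E\<close>.\<close>

lemma open_facet_collar: "open (interior K \<union> rel_interior E \<union> {x. normal \<bullet> x > offset})"
proof (subst open_contains_ball, intro ballI)
  let ?U = "interior K \<union> rel_interior E \<union> {x. normal \<bullet> x > offset}"
  fix x assume "x \<in> ?U"
  then consider "x \<in> interior K \<union> {x. normal \<bullet> x > offset}" | "x \<in> rel_interior E" by blast
  then show "\<exists>r>0. ball x r \<subseteq> ?U"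
  proof cases
    case 1
    have "open (interior K \<union> {x. normal \<bullet> x > offset})"
      by (intro open_Un open_interior open_halfspace_gt)
    then show ?thesis using 1 open_contains_ball by (metis (no_types, lifting) Un_assoc Un_commute le_supI1)
  next
    case 2
    from facet_neighbourhood[OF 2] obtain r where "r > 0" "ball x r \<inter> {x. normal \<bullet> x < offset} \<subseteq> interior K"
      "ball x r \<inter> {x. normal \<bullet> x = offset} \<subseteq> rel_interior E" .
    moreover have "ball x r \<subseteq> (ball x r \<inter> {x. normal \<bullet> x < offset}) \<union> (ball x r \<inter> {x. normal \<bullet> x = offset})
        \<union> {x. normal \<bullet> x > offset}"
      by auto
    ultimately show ?thesis by blast
  qed
qed

lemma closest_point_eq_proj: "closest_point (affine hull E) x = proj x"
proof (rule sym, rule closest_point_unique)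
  show "proj x \<in> affine hull E"
    unfolding affine_hull_E using inner_hyperplane_proj[OF norm_normal] by simp
  show "\<forall>z\<in>affine hull E. dist x (proj x) \<le> dist x z"
  proof
    fix z assume "z \<in> affine hull E"
    then have "normal \<bullet> (x - z) = normal \<bullet> x - offset"
      by (simp add: affine_hull_E inner_diff_right)
    moreover have "\<bar>normal \<bullet> (x - z)\<bar> \<le> norm normal * norm (x - z)" by (rule Cauchy_Schwarz_ineq2)
    ultimately show "dist x (proj x) \<le> dist x z"
      by (simp add: hyperplane_proj_def dist_norm norm_normal)
  qed
qed (auto intro: affine_imp_convex closed_affine_hull)

lemma infdist_affine_hull: "infdist x (affine hull E) = \<bar>normal \<bullet> x - offset\<bar>"
proof -
  have ne: "affine hull E \<noteq> {}" using E_nonempty by simp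
  have "infdist x (affine hull E) = dist x (proj x)"
    using setdist_closest_point[OF closed_affine_hull ne, of x] ne closest_point_eq_proj infdist_eq_setdist by metis
  then show ?thesis by (simp add: hyperplane_proj_def dist_norm norm_normal)
qed

text \<open>The cylinder whose volume is the surface measure of \<open>E\<close>.\<close>

definition cylinder :: "(real^'d) set" where
  "cylinder = {x. proj x \<in> E \<and> \<bar>normal \<bullet> x - offset\<bar> \<le> 1/2}"

lemma face_measure_eq: "face_measure E = distr (lebesgue_on cylinder) borel proj"
proof -
  have "closest_point (affine hull E) = proj"
    using closest_point_eq_proj by auto
  then show ?thesis
    unfolding face_measure_def cylinder_def by (simp add: infdist_affine_hull)
qed

lemma cylinder_eq: "cylinder = (\<lambda>(y, s). y + s *\<^sub>R normal) ` (E \<times> {-1/2..1/2})"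
proof (intro subset_antisym subsetI)
  fix x assume "x \<in> cylinder"
  moreover have "x = proj x + (normal \<bullet> x - offset) *\<^sub>R normal" by (simp add: hyperplane_proj_def)
  ultimately show "x \<in> (\<lambda>(y, s). y + s *\<^sub>R normal) ` (E \<times> {-1/2..1/2})"
    by (intro image_eqI[of _ _ "(proj x, normal \<bullet> x - offset)"]) (auto simp: cylinder_def abs_if split: if_splits)
next
  fix x assume "x \<in> (\<lambda>(y, s). y + s *\<^sub>R normal) ` (E \<times> {-1/2..1/2})"
  then obtain y s where y: "y \<in> E" and "s \<in> {-1/2..1/2}" and x: "x = y + s *\<^sub>R normal"
    by (elim imageE SigmaE) simp
  then have s: "\<bar>s\<bar> \<le> 1/2" unfolding atLeastAtMost_iff by linarith
  have "proj x = y" "normal \<bullet> x - offset = s"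
    using y E_subset norm_normal unfolding x by (auto simp: hyperplane_proj_def inner_add_right norm_eq_1)
  then show "x \<in> cylinder" using y s by (simp add: cylinder_def)
qed

lemma compact_cylinder: "compact cylinder" and convex_cylinder: "convex cylinder"
proof -
  have "continuous_on (E \<times> {-1/2..1/2}) (\<lambda>(y, s). y + s *\<^sub>R normal)"
    unfolding case_prod_unfold by (intro continuous_intros)
  then show "compact cylinder"
    unfolding cylinder_eq by (rule compact_continuous_image) (intro compact_Times compact_E compact_Icc)
  have "linear (\<lambda>(y, s). y + s *\<^sub>R normal)"
    by (rule linearI) (auto simp: algebra_simps)
  then show "convex cylinder"
    unfolding cylinder_eq by (rule convex_linear_image) (intro convex_Times convex_E convex_real_interval)
qed

lemma proj_measurable: "proj \<in> measurable (lebesgue_on cylinder) borel"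
  by (intro measurable_restrict_space1 measurable_completion) simp

lemma sets_cylinder: "cylinder \<in> sets borel"
  using compact_cylinder by (simp add: borel_compact)

lemma sets_face_measure: "sets (face_measure E) = sets borel"
  by (simp add: face_measure_eq)

lemma finite_face_measure: "finite_measure (face_measure E)"
  unfolding face_measure_eq
  by (intro finite_measure.finite_measure_distr finite_measure_lebesgue_on proj_measurable
      lmeasurable_compact compact_cylinder)

lemma integral_face_measure:
  assumes "h \<in> borel_measurable borel"
  shows "(LINT x|face_measure E. h x) = (\<integral>x. indicator cylinder x * h (proj x) \<partial>lborel :: real)"
proof -
  have "(LINT x|face_measure E. h x) = (LINT x|lebesgue_on cylinder. h (proj x))"
    unfolding face_measure_eq by (rule integral_distr[OF proj_measurable assms])
  also have "\<dots> = (\<integral>x. indicator cylinder x * h (proj x) \<partial>lborel)"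
    by (rule integral_lebesgue_on_borel[OF sets_cylinder measurable_compose[OF measurable_hyperplane_proj assms]])
  finally show ?thesis .
qed

lemma sets_rel_interior_E: "rel_interior E \<in> sets borel"
proof -
  obtain T where "open T" "rel_interior E = affine hull E \<inter> T"
    using openin_rel_interior[of E] by (auto simp: openin_open)
  then show ?thesis using closed_affine_hull[of E] by auto
qed

text \<open>The part of the cylinder over the relative boundary of \<open>E\<close> lies in the boundary of a convex
  set, hence has volume zero.\<close>

lemma AE_face_measure_rel_interior: "AE x in face_measure E. x \<in> rel_interior E"
proof -
  have "x \<in> frontier cylinder" if "x \<in> cylinder" "proj x \<notin> rel_interior E" for x
  proof (rule ccontr)
    assume "x \<notin> frontier cylinder"
    then have "x \<in> interior cylinder" using that closure_subset by (auto simp: frontier_def)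
    then obtain r where r: "r > 0" "ball x r \<subseteq> cylinder"
      using mem_interior by blast
    have "ball (proj x) r \<inter> affine hull E \<subseteq> E"
    proof
      fix y assume y: "y \<in> ball (proj x) r \<inter> affine hull E"
      let ?z = "x + (y - proj x)"
      have "?z \<in> ball x r" using y by (simp add: dist_norm norm_minus_commute)
      then have "proj ?z \<in> E" using r by (auto simp: cylinder_def)
      moreover have "proj ?z = y"
        using y inner_hyperplane_proj[OF norm_normal, of offset x]
        by (simp add: affine_hull_E hyperplane_proj_def[of _ _ ?z] inner_add_right inner_diff_right)
           (simp add: hyperplane_proj_def)
      ultimately show "y \<in> E" by simp
    qed
    then show False using that r by (auto simp: mem_rel_interior_ball cylinder_def)
  qed
  then have "negligible {x \<in> cylinder. proj x \<notin> rel_interior E}"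
    by (intro negligible_subset[OF negligible_convex_frontier[OF convex_cylinder]]) auto
  then have "{x \<in> cylinder. proj x \<notin> rel_interior E} \<in> null_sets lebesgue"
    by (simp add: negligible_iff_null_sets)
  from AE_not_in[OF this] have "AE x in lebesgue. x \<in> cylinder \<longrightarrow> proj x \<in> rel_interior E"
    by eventually_elim auto
  then have "AE x in lebesgue_on cylinder. proj x \<in> rel_interior E"
    using sets_cylinder by (subst AE_restrict_space_iff) auto
  then show ?thesis
    unfolding face_measure_eq using sets_rel_interior_E by (subst AE_distr_iff[OF proj_measurable]) auto
qed

text \<open>The simplex and its supporting half-space differ only away from the support of \<open>F\<close> in \<open>K\<close>: a
  cut-off that is \<open>1\<close> on this support and vanishes in the rest of the half-space turns integrals of
  \<open>F\<close> over \<open>K\<close> into integrals over the half-space.\<close>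

lemma simplex_divergence:
  assumes F: "C1_fun F" "compact (closure {x. F x \<noteq> 0})"
    and supp: "closure {x. F x \<noteq> 0} \<inter> frontier K \<subseteq> rel_interior E"
  shows "(LINT x|lebesgue_on (interior K). frechet_derivative F (at x) e)
    = (normal \<bullet> e) * (LINT x|face_measure E. F x)"
proof -
  let ?A = "closure {x. F x \<noteq> 0} \<inter> K"
  let ?U = "interior K \<union> rel_interior E \<union> {x. normal \<bullet> x > offset}"
  have "compact ?A" using F closed_K by (intro compact_Int_closed)
  moreover have "?A \<subseteq> ?U"
    using supp closed_K by (auto simp: frontier_def)
  ultimately obtain \<kappa> where k: "C1_fun \<kappa>" "\<And>x. 0 \<le> \<kappa> x" "\<And>x. \<kappa> x \<le> 1" "\<And>x. x \<in> ?A \<Longrightarrow> \<kappa> x = 1"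
    "compact (closure {x. \<kappa> x \<noteq> 0})" "closure {x. \<kappa> x \<noteq> 0} \<subseteq> ?U"
    using C1_cutoff[OF _ open_facet_collar] by blast
  define G where "G x = F x * \<kappa> x" for x
  have G: "C1_fun G" unfolding G_def by (intro C1_fun_mult F k)
  have Gc: "compact (closure {x. G x \<noteq> 0})"
    by (rule compact_closure_mono[OF F(2)]) (auto simp: G_def)
  have dG: "frechet_derivative G (at x) e = F x * frechet_derivative \<kappa> (at x) e + frechet_derivative F (at x) e * \<kappa> x" for x
    unfolding G_def
    using frechet_derivative_at[OF has_derivative_mult[OF C1_fun_derivative[OF F(1), of x] C1_fun_derivative[OF k(1)]]]
    by (metis (no_types, lifting))
  have k0: "\<kappa> x = 0" if "x \<notin> ?U" for x
    using that k(6) closure_subset[of "{x. \<kappa> x \<noteq> 0}"] by blast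
  have inside: "F x * \<kappa> x = F x" "frechet_derivative G (at x) e = frechet_derivative F (at x) e" if "x \<in> K" for x
    using cutoff_transparent[OF F(1) k(1) k(3), of x] k(4)[of x] that unfolding G_def[abs_def] by auto
  have outside: "frechet_derivative G (at x) e = 0" if "normal \<bullet> x < offset" "x \<notin> interior K" for x
  proof -
    have "x \<notin> ?U" using that rel_interior_subset[of E] E_subset by force
    then have "x \<notin> closure {x. \<kappa> x \<noteq> 0}" using k(6) by blast
    from frechet_derivative_outside_support[OF this] show ?thesis
      using k0[OF \<open>x \<notin> ?U\<close>] unfolding dG by simp
  qed
  have [measurable]: "(\<lambda>x. frechet_derivative F (at x) e) \<in> borel_measurable borel"
    "(\<lambda>x. frechet_derivative G (at x) e) \<in> borel_measurable borel"
    using C1_fun_continuous_derivative[OF F(1)] C1_fun_continuous_derivative[OF G]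
    by (auto intro: borel_measurable_continuous_onI)
  have Fm[measurable]: "F \<in> borel_measurable borel"
    using C1_fun_continuous[OF F(1)] by (rule borel_measurable_continuous_onI)
  have [measurable]: "interior K \<in> sets borel" by simp
  have "(LINT x|lebesgue_on (interior K). frechet_derivative F (at x) e)
      = (\<integral>x. indicator (interior K) x * frechet_derivative F (at x) e \<partial>lborel)"
    by (intro integral_lebesgue_on_borel) measurable
  also have "\<dots> = (\<integral>x. indicator {x. normal \<bullet> x \<le> offset} x * frechet_derivative G (at x) e \<partial>lborel)"
  proof (rule integral_cong_AE)
    have "negligible {x. normal \<bullet> x = offset}" using normal_nonzero by (intro negligible_hyperplane) auto
    then have "{x. normal \<bullet> x = offset} \<in> null_sets lborel"
      by (simp add: negligible_iff_null_sets null_sets_completion_iff)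
    from AE_not_in[OF this]
    show "AE x in lborel. indicator (interior K) x * frechet_derivative F (at x) e
      = indicator {x. normal \<bullet> x \<le> offset} x * frechet_derivative G (at x) e"
    proof eventually_elim
      case (elim x)
      then show ?case
        using inside(2)[of x] outside[of x] interior_K_subset interior_subset[of K] by (auto simp: indicator_def)
    qed
  qed measurable
  also have "\<dots> = (normal \<bullet> e) * (\<integral>x. indicator {x. \<bar>normal \<bullet> x - offset\<bar> \<le> 1/2} x * G (proj x) \<partial>lborel)"
    by (rule halfspace_divergence[OF G Gc norm_normal])
  also have "(\<integral>x. indicator {x. \<bar>normal \<bullet> x - offset\<bar> \<le> 1/2} x * G (proj x) \<partial>lborel)
      = (\<integral>x. indicator cylinder x * F (proj x) \<partial>lborel)"
  proof (intro Bochner_Integration.integral_cong refl)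
    fix x
    have p: "normal \<bullet> proj x = offset" by (rule inner_hyperplane_proj[OF norm_normal])
    show "indicator {x. \<bar>normal \<bullet> x - offset\<bar> \<le> 1/2} x * G (proj x) = indicator cylinder x * F (proj x)"
    proof (cases "proj x \<in> E")
      case True
      then have "G (proj x) = F (proj x)"
        using inside(1)[of "proj x"] E_subset_K by (auto simp: G_def)
      then show ?thesis using True by (simp add: cylinder_def indicator_def)
    next
      case False
      then have "proj x \<notin> ?U"
        using p interior_K_subset rel_interior_subset[of E] by auto
      then show ?thesis using False k0 by (simp add: cylinder_def G_def)
    qed
  qed
  also have "\<dots> = (LINT x|face_measure E. F x)"
    by (rule integral_face_measure[OF Fm, symmetric])
  finally show ?thesis .
qed

end

section \<open>The fundamental lemma of the calculus of variations\<close>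

text \<open>Test functions approximate the indicators of compact subsets of \<open>V\<close>. The integrals of \<open>f\<close> over
  these determine those over all Borel subsets of a compact set, by Dynkin's argument, and \<open>V\<close> is a
  countable union of compact boxes.\<close>

lemma AE_zero_if_orthogonal_to_test_functions:
  fixes f :: "real^'d \<Rightarrow> real"
  assumes M: "sets M = sets borel" and f: "integrable M f" and V: "open V"
    and orth: "\<And>\<psi>. C1_fun \<psi> \<Longrightarrow> compact (closure {x. \<psi> x \<noteq> 0}) \<Longrightarrow> closure {x. \<psi> x \<noteq> 0} \<subseteq> V
      \<Longrightarrow> (LINT x|M. \<psi> x * f x) = 0"
  shows "AE x in M. x \<in> V \<longrightarrow> f x = 0"
proof -
  have space: "space M = UNIV" using sets_eq_imp_space_eq[OF M] by simp
  have meas: "h \<in> borel_measurable M" if "h \<in> borel_measurable borel" for h :: "real^'d \<Rightarrow> real"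
    using that measurable_cong_sets[OF M refl] by blast
  have fm[measurable]: "f \<in> borel_measurable M" using f by auto
  have compact: "(LINT x|M. indicator C x * f x) = 0" if C: "compact C" "C \<subseteq> V" for C
  proof (cases "C = {}")
    case False
    define V' where "V' i = V \<inter> {x. infdist x C < 1 / real (Suc i)}" for i
    have "open (V' i)" for i
      unfolding V'_def by (intro open_Int V open_Collect_less continuous_intros)
    moreover have "C \<subseteq> V' i" for i
      using C unfolding V'_def by auto
    ultimately have "\<exists>\<psi>. C1_fun \<psi> \<and> (\<forall>x. 0 \<le> \<psi> x \<and> \<psi> x \<le> 1) \<and> (\<forall>x\<in>C. \<psi> x = 1)
        \<and> compact (closure {x. \<psi> x \<noteq> 0}) \<and> closure {x. \<psi> x \<noteq> 0} \<subseteq> V' i" for i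
      by (rule C1_cutoff[OF C(1)]) (intro exI conjI allI ballI)
    from choice[OF allI[OF this]] obtain \<psi> where
      "\<forall>i. C1_fun (\<psi> i) \<and> (\<forall>x. 0 \<le> \<psi> i x \<and> \<psi> i x \<le> 1) \<and> (\<forall>x\<in>C. \<psi> i x = 1)
        \<and> compact (closure {x. \<psi> i x \<noteq> 0}) \<and> closure {x. \<psi> i x \<noteq> 0} \<subseteq> V' i" ..
    then have p: "\<And>i. C1_fun (\<psi> i)" "\<And>i x. 0 \<le> \<psi> i x" "\<And>i x. \<psi> i x \<le> 1"
      "\<And>i x. x \<in> C \<Longrightarrow> \<psi> i x = 1" "\<And>i. compact (closure {x. \<psi> i x \<noteq> 0})" "\<And>i. closure {x. \<psi> i x \<noteq> 0} \<subseteq> V' i"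
      by simp_all
    have pm[measurable]: "\<psi> i \<in> borel_measurable M" for i
      by (intro meas borel_measurable_continuous_onI C1_fun_continuous p)
    have [measurable]: "C \<in> sets M" using C M by (simp add: borel_compact)
    have "(\<lambda>i. LINT x|M. \<psi> i x * f x) \<longlonglongrightarrow> (LINT x|M. indicator C x * f x)"
    proof (rule integral_dominated_convergence[where w="\<lambda>x. norm (f x)"])
      show "AE x in M. (\<lambda>i. \<psi> i x * f x) \<longlonglongrightarrow> indicator C x * f x"
      proof (rule AE_I2, rule tendsto_mult_right)
        fix x
        show "(\<lambda>i. \<psi> i x) \<longlonglongrightarrow> indicator C x"
        proof (cases "x \<in> C")
          case False
          then have "infdist x C > 0"
            using C \<open>C \<noteq> {}\<close> compact_imp_closed in_closed_iff_infdist_zero infdist_nonneg by (metis less_eq_real_def)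
          then obtain N where N: "1 / real (Suc N) < infdist x C"
            using reals_Archimedean by (auto simp: inverse_eq_divide)
          have "\<psi> i x = 0" if "i \<ge> N" for i
          proof (rule ccontr)
            assume "\<psi> i x \<noteq> 0"
            then have "x \<in> V' i" using p(6)[of i] closure_subset[of "{x. \<psi> i x \<noteq> 0}"] by auto
            then have "infdist x C < 1 / real (Suc i)" by (simp add: V'_def)
            also have "\<dots> \<le> 1 / real (Suc N)" using that by (intro divide_left_mono) auto
            finally show False using N by simp
          qed
          then have "\<forall>\<^sub>F i in sequentially. \<psi> i x = 0" using eventually_at_top_linorder by blast
          then show ?thesis using False by (simp add: tendsto_eventually)
        qed (simp add: p)
      qed
      show "AE x in M. norm (\<psi> i x * f x) \<le> norm (f x)" for i
        using p(2,3)[of i] by (intro AE_I2) (auto simp: abs_mult intro: mult_left_le_one_le)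
    qed (use f in auto)
    moreover have "(LINT x|M. \<psi> i x * f x) = 0" for i
      using p(6)[of i] by (intro orth p) (auto simp: V'_def)
    ultimately show ?thesis by (simp add: LIMSEQ_const_iff)
  qed simp
  have on_compact: "AE x in M. x \<in> C \<longrightarrow> f x = 0" if C: "compact C" "C \<subseteq> V" for C
  proof -
    have CM[measurable]: "C \<in> sets M" using C M by (simp add: borel_compact)
    let ?g = "\<lambda>x. indicator C x * f x"
    have g: "integrable M ?g" using integrable_mult_indicator[OF CM f] by simp
    have g_on: "set_integrable M A ?g" if "A \<in> sets M" for A
      unfolding set_integrable_def by (rule integrable_mult_indicator[OF that g])
    have "(LINT x:A|M. ?g x) = 0" if "A \<in> sets M" for A
    proof -
      have M': "sets M = sigma_sets UNIV (Collect closed)"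
        unfolding M borel_eq_closed by (rule sets_measure_of) simp
      have "Int_stable (Collect closed :: (real^'d) set set)" by (auto simp: Int_stable_def)
      moreover have "Collect closed \<subseteq> Pow (UNIV :: (real^'d) set)" by simp
      moreover have "A \<in> sigma_sets UNIV (Collect closed)" using that M' by simp
      ultimately show ?thesis
      proof (induct rule: sigma_sets_induct_disjoint)
        case (basic B)
        have "compact (B \<inter> C)" using basic C by (auto intro: closed_Int_compact)
        then have "(LINT x|M. indicator (B \<inter> C) x * f x) = 0" using C by (intro compact) auto
        then show ?case by (simp add: set_lebesgue_integral_def indicator_inter_arith mult.assoc)
      next
        case (compl B)
        then have B: "B \<in> sets M" using M' by simp
        then have B': "UNIV - B \<in> sets M" using M by auto
        have "(LINT x:(B \<union> (UNIV - B))|M. ?g x) = (LINT x:B|M. ?g x) + (LINT x:(UNIV - B)|M. ?g x)"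
          by (rule set_integral_Un[OF _ g_on[OF B] g_on[OF B']]) auto
        moreover have "B \<union> (UNIV - B) = UNIV" by auto
        moreover have "(LINT x:UNIV|M. ?g x) = 0"
          using compact[OF C] by (simp add: set_lebesgue_integral_def)
        ultimately show ?case using compl by simp
      next
        case (union B)
        have B: "B i \<in> sets M" for i
          using union(2) M' by auto
        have "(LINT x:(\<Union>i. B i)|M. ?g x) = (\<Sum>i. (LINT x:(B i)|M. ?g x))"
          using union(1) B g_on[of "\<Union>i. B i"]
          by (intro lebesgue_integral_countable_add) (auto simp: disjoint_family_on_def)
        then show ?case using union by simp
      qed (auto simp: set_lebesgue_integral_def)
    qed
    then have "AE x in M. ?g x = 0"
      using density_unique_real[OF g integrable_zero] by (simp add: set_lebesgue_integral_def)
    then show ?thesis by eventually_elim (auto simp: indicator_def)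
  qed
  obtain \<D> where D: "countable \<D>" "\<D> \<subseteq> Pow V" "\<And>X. X \<in> \<D> \<Longrightarrow> \<exists>a b. X = cbox a b" "\<Union>\<D> = V"
    using open_countable_Union_open_cbox[OF V] by metis
  have "AE x in M. \<forall>X\<in>\<D>. x \<in> X \<longrightarrow> f x = 0"
  proof (rule AE_ball_countable[OF D(1), THEN iffD2], rule ballI)
    fix X assume X: "X \<in> \<D>"
    then obtain a b where "X = cbox a b" using D by blast
    then show "AE x in M. x \<in> X \<longrightarrow> f x = 0"
      using X D by (intro on_compact) auto
  qed
  then show ?thesis
    by eventually_elim (use D in blast)
qed

text \<open>A Lebesgue measurable function is replaced by a Borel representative.\<close>

lemma AE_zero_on_open_if_orthogonal:
  fixes f :: "real^'d \<Rightarrow> real"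
  assumes D: "open D" and f: "integrable (lebesgue_on D) f"
    and orth: "\<And>\<phi>. test_function D \<phi> \<Longrightarrow> (LINT x|lebesgue_on D. f x * \<phi> x) = 0"
  shows "AE x in lebesgue_on D. f x = 0"
proof -
  have Ds: "D \<inter> space lebesgue \<in> sets lebesgue" using D by auto
  have int: "integrable lebesgue (\<lambda>x. indicator D x * f x)"
    using f integrable_restrict_space[OF Ds, of f] by simp
  then have "(\<lambda>x. indicator D x * f x) \<in> borel_measurable (completion lborel)" by auto
  then obtain g where g[measurable]: "g \<in> borel_measurable lborel" and ae: "AE x in lborel. indicator D x * f x = g x"
    using completion_ex_borel_measurable_real by blast
  have ae': "AE x in lebesgue. indicator D x * f x = g x" by (rule AE_completion[OF ae])
  have "integrable lebesgue g"
    using int by (subst integrable_cong_AE[OF _ _ ae', symmetric]) (auto intro: measurable_completion)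
  then have gi: "integrable lborel g" using integrable_completion[OF g] by simp
  have "AE x in lborel. x \<in> D \<longrightarrow> g x = 0"
  proof (rule AE_zero_if_orthogonal_to_test_functions[OF _ gi D])
    fix \<psi> :: "real^'d \<Rightarrow> real"
    assume p: "C1_fun \<psi>" "compact (closure {x. \<psi> x \<noteq> 0})" "closure {x. \<psi> x \<noteq> 0} \<subseteq> D"
    have pm[measurable]: "\<psi> \<in> borel_measurable borel"
      by (intro borel_measurable_continuous_onI C1_fun_continuous p)
    have "(\<integral>x. \<psi> x * g x \<partial>lborel) = (\<integral>x. \<psi> x * g x \<partial>lebesgue)"
      by (rule integral_completion[symmetric]) measurable
    also have "\<dots> = (\<integral>x. indicator D x *\<^sub>R (f x * \<psi> x) \<partial>lebesgue)"
    proof (rule integral_cong_AE)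
      have "\<psi> \<in> borel_measurable lebesgue" by (rule measurable_completion) simp
      moreover have "g \<in> borel_measurable lebesgue" by (rule measurable_completion) simp
      moreover have "(\<lambda>x. (indicator D x * f x) * \<psi> x) \<in> borel_measurable lebesgue"
        by (rule borel_measurable_times[OF borel_measurable_integrable[OF int]]) fact
      ultimately show "(\<lambda>x. \<psi> x * g x) \<in> borel_measurable lebesgue"
        "(\<lambda>x. indicator D x *\<^sub>R (f x * \<psi> x)) \<in> borel_measurable lebesgue"
        by (auto simp: mult.assoc)
      show "AE x in lebesgue. \<psi> x * g x = indicator D x *\<^sub>R (f x * \<psi> x)"
        using ae' by eventually_elim (simp add: algebra_simps flip: mult.assoc)
    qed
    also have "\<dots> = (LINT x|lebesgue_on D. f x * \<psi> x)"
      by (rule integral_restrict_space[OF Ds, symmetric])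
    also have "\<dots> = 0" using p by (intro orth) (simp add: test_function_def)
    finally show "(\<integral>x. \<psi> x * g x \<partial>lborel) = 0" .
  qed simp
  then have "AE x in lborel. x \<in> D \<longrightarrow> f x = 0"
    using ae by eventually_elim (auto simp: indicator_def)
  then show ?thesis
    using Ds AE_completion by (subst AE_restrict_space_iff) auto
qed


section \<open>Square-integrable functions\<close>

lemma square_integrable_bound:
  fixes f :: "'a \<Rightarrow> 'b::euclidean_space" and g :: "'a \<Rightarrow> 'c::euclidean_space"
  assumes f: "square_integrable M f" and g: "g \<in> borel_measurable M"
    and le: "AE x in M. norm (g x) \<le> B * norm (f x)"
  shows "square_integrable M g"
  unfolding square_integrable_def
proof
  show "integrable M (\<lambda>x. (norm (g x))\<^sup>2)"
  proof (rule Bochner_Integration.integrable_bound[where f="\<lambda>x. B\<^sup>2 * (norm (f x))\<^sup>2"])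
    show "integrable M (\<lambda>x. B\<^sup>2 * (norm (f x))\<^sup>2)"
      using f unfolding square_integrable_def by simp
    show "AE x in M. norm ((norm (g x))\<^sup>2) \<le> norm (B\<^sup>2 * (norm (f x))\<^sup>2)"
      using le
    proof eventually_elim
      case (elim x)
      then have "(norm (g x))\<^sup>2 \<le> (B * norm (f x))\<^sup>2" by (intro power_mono) auto
      then show ?case by (simp add: power_mult_distrib)
    qed
  qed (use g in measurable)
qed (rule g)

lemma square_integrable_linear:
  fixes f :: "'a \<Rightarrow> 'b::euclidean_space" and L :: "'b \<Rightarrow> 'c::euclidean_space"
  assumes f: "square_integrable M f" and L: "linear L"
  shows "square_integrable M (\<lambda>x. L (f x))"
proof -
  obtain B where B: "\<And>y. norm (L y) \<le> B * norm y"
    using linear_bounded[OF L] by blast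
  have "L \<in> borel_measurable borel"
    using linear_continuous_on[OF linear_conv_bounded_linear[THEN iffD1, OF L]] by (rule borel_measurable_continuous_onI)
  then have "(\<lambda>x. L (f x)) \<in> borel_measurable M"
    using f unfolding square_integrable_def by (auto intro: measurable_compose)
  then show ?thesis by (rule square_integrable_bound[OF f]) (use B in auto)
qed

lemma square_integrable_add:
  fixes f g :: "'a \<Rightarrow> 'b::euclidean_space"
  assumes "square_integrable M f" "square_integrable M g"
  shows "square_integrable M (\<lambda>x. f x + g x)"
proof -
  have [measurable]: "f \<in> borel_measurable M" "g \<in> borel_measurable M"
    using assms unfolding square_integrable_def by auto
  have "integrable M (\<lambda>x. (norm (f x + g x))\<^sup>2)"
  proof (rule Bochner_Integration.integrable_bound[where f="\<lambda>x. 2 * ((norm (f x))\<^sup>2 + (norm (g x))\<^sup>2)"])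
    show "integrable M (\<lambda>x. 2 * ((norm (f x))\<^sup>2 + (norm (g x))\<^sup>2))"
      using assms unfolding square_integrable_def by simp
    show "AE x in M. norm ((norm (f x + g x))\<^sup>2) \<le> norm (2 * ((norm (f x))\<^sup>2 + (norm (g x))\<^sup>2))"
    proof (rule AE_I2)
      fix x
      have "(norm (f x + g x))\<^sup>2 \<le> (norm (f x) + norm (g x))\<^sup>2"
        by (intro power_mono norm_triangle_ineq) auto
      also have "\<dots> \<le> 2 * ((norm (f x))\<^sup>2 + (norm (g x))\<^sup>2)"
        using sum_squares_bound[of "norm (f x)" "norm (g x)"] by (simp add: power2_sum)
      finally show "norm ((norm (f x + g x))\<^sup>2) \<le> norm (2 * ((norm (f x))\<^sup>2 + (norm (g x))\<^sup>2))" by simp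
    qed
  qed measurable
  then show ?thesis unfolding square_integrable_def by simp
qed

lemma square_integrable_scale: "square_integrable M f \<Longrightarrow> square_integrable M (\<lambda>x. c *\<^sub>R f x)"
  by (rule square_integrable_linear) (auto intro: linearI simp: scaleR_add_right)

lemma square_integrable_add_scale:
  "square_integrable M f \<Longrightarrow> square_integrable M g \<Longrightarrow> square_integrable M (\<lambda>x. f x + c *\<^sub>R g x)"
  by (intro square_integrable_add square_integrable_scale)

lemma square_integrable_diff:
  "square_integrable M f \<Longrightarrow> square_integrable M g \<Longrightarrow> square_integrable M (\<lambda>x. f x - g x)"
  using square_integrable_add_scale[of M f g "-1"] by simp

lemma square_integrable_nth:
  fixes f :: "'a \<Rightarrow> 'b::euclidean_space^'n"
  shows "square_integrable M f \<Longrightarrow> square_integrable M (\<lambda>x. f x $ i)"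
  by (rule square_integrable_linear) (auto intro: linearI)

lemma square_integrable_inner:
  fixes f g :: "'a \<Rightarrow> 'b::euclidean_space"
  assumes "square_integrable M f" "square_integrable M g"
  shows "integrable M (\<lambda>x. f x \<bullet> g x)"
proof (rule Bochner_Integration.integrable_bound[where f="\<lambda>x. (norm (f x))\<^sup>2 + (norm (g x))\<^sup>2"])
  have [measurable]: "f \<in> borel_measurable M" "g \<in> borel_measurable M"
    using assms unfolding square_integrable_def by auto
  show "(\<lambda>x. f x \<bullet> g x) \<in> borel_measurable M" by measurable
  show "integrable M (\<lambda>x. (norm (f x))\<^sup>2 + (norm (g x))\<^sup>2)"
    using assms unfolding square_integrable_def by simp
  show "AE x in M. norm (f x \<bullet> g x) \<le> norm ((norm (f x))\<^sup>2 + (norm (g x))\<^sup>2)"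
  proof (rule AE_I2)
    fix x
    have "\<bar>f x \<bullet> g x\<bar> \<le> norm (f x) * norm (g x)" by (rule Cauchy_Schwarz_ineq2)
    also have "2 * \<dots> \<le> (norm (f x))\<^sup>2 + (norm (g x))\<^sup>2"
      using sum_squares_bound[of "norm (f x)" "norm (g x)"] by simp
    finally have "\<bar>f x \<bullet> g x\<bar> \<le> (norm (f x))\<^sup>2 + (norm (g x))\<^sup>2"
      using mult_nonneg_nonneg[OF norm_ge_zero norm_ge_zero, of "f x" "g x"] by linarith
    then show "norm (f x \<bullet> g x) \<le> norm ((norm (f x))\<^sup>2 + (norm (g x))\<^sup>2)" by simp
  qed
qed

lemma square_integrable_mult:
  fixes f g :: "'a \<Rightarrow> real"
  shows "square_integrable M f \<Longrightarrow> square_integrable M g \<Longrightarrow> integrable M (\<lambda>x. f x * g x)"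
  using square_integrable_inner[of M f g] by simp

lemma square_integrable_bounded:
  fixes f :: "'a \<Rightarrow> 'b::euclidean_space"
  assumes "finite_measure M" "f \<in> borel_measurable M" "AE x in M. norm (f x) \<le> B"
  shows "square_integrable M f"
proof (rule square_integrable_bound[where f="\<lambda>x. 1 :: real"])
  show "square_integrable M (\<lambda>x. 1 :: real)"
    using finite_measure.integrable_const[OF assms(1)] by (simp add: square_integrable_def)
  show "AE x in M. norm (f x) \<le> B * norm (1::real)" using assms(3) by simp
qed fact

lemma square_integrable_integrable:
  fixes f :: "'a \<Rightarrow> real"
  assumes "finite_measure M" "square_integrable M f"
  shows "integrable M f"
  using square_integrable_mult[OF assms(2) square_integrable_bounded[OF assms(1), of "\<lambda>x. 1" 1]] by simp

lemma AE_lebesgue_on_subset: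
  assumes "AE x in lebesgue_on A. P x" "B \<subseteq> A" "A \<in> sets lebesgue" "B \<in> sets lebesgue"
  shows "AE x in lebesgue_on B. P x"
  using assms by (auto simp: AE_restrict_space_iff elim!: eventually_mono)

lemma square_integrable_subset:
  assumes f: "square_integrable (lebesgue_on A) f" and "B \<subseteq> A" "A \<in> sets lebesgue" "B \<in> sets lebesgue"
  shows "square_integrable (lebesgue_on B) f"
proof -
  have "f \<in> borel_measurable (lebesgue_on B)"
    using f assms(2) unfolding square_integrable_def by (meson measurable_restrict_mono)
  moreover have "integrable (lebesgue_on B) (\<lambda>x. (norm (f x))\<^sup>2)"
  proof -
    have "integrable lebesgue (\<lambda>x. indicator A x *\<^sub>R (norm (f x))\<^sup>2)"
      using f assms(3) integrable_restrict_space[of A lebesgue "\<lambda>x. (norm (f x))\<^sup>2"]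
      unfolding square_integrable_def by simp
    from integrable_mult_indicator[OF assms(4) this]
    have "integrable lebesgue (\<lambda>x. indicator B x *\<^sub>R (indicator A x *\<^sub>R (norm (f x))\<^sup>2))" .
    also have "(\<lambda>x. indicator B x *\<^sub>R (indicator A x *\<^sub>R (norm (f x))\<^sup>2)) = (\<lambda>x. indicator B x *\<^sub>R (norm (f x))\<^sup>2)"
      using assms(2) by (auto simp: fun_eq_iff indicator_def)
    finally show ?thesis using assms by (subst integrable_restrict_space) auto
  qed
  ultimately show ?thesis unfolding square_integrable_def by simp
qed

lemma finite_measure_bounded_open: "open D \<Longrightarrow> bounded D \<Longrightarrow> finite_measure (lebesgue_on (D :: (real^'d) set))"
  by (intro finite_measure_lebesgue_on lmeasurable_open)

lemma square_integrable_continuous: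
  fixes f :: "real^'d \<Rightarrow> 'b::euclidean_space"
  assumes "open D" "bounded D" "continuous_on UNIV f"
  shows "square_integrable (lebesgue_on D) f"
proof -
  have "compact (closure D)" using assms by (simp add: compact_closure)
  then have "bounded (f ` closure D)"
    by (intro compact_imp_bounded compact_continuous_image continuous_on_subset[OF assms(3)]) auto
  then obtain B where "\<And>x. x \<in> closure D \<Longrightarrow> norm (f x) \<le> B"
    unfolding bounded_iff by auto
  then have "\<And>x. x \<in> D \<Longrightarrow> norm (f x) \<le> B" using closure_subset by blast
  then have "AE x in lebesgue_on D. norm (f x) \<le> B" by (intro AE_I2) simp
  moreover have "f \<in> borel_measurable (lebesgue_on D)"
    by (intro measurable_restrict_space1 measurable_completion) (simp add: borel_measurable_continuous_onI[OF assms(3)])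
  ultimately show ?thesis by (rule square_integrable_bounded[OF finite_measure_bounded_open[OF assms(1,2)], rotated])
qed

lemma integral_lebesgue_on_supported:
  fixes f :: "real^'d \<Rightarrow> real"
  assumes "A \<in> sets lebesgue" "B \<in> sets lebesgue" "B \<subseteq> A" "\<And>x. x \<in> A \<Longrightarrow> x \<notin> B \<Longrightarrow> f x = 0"
  shows "(LINT x|lebesgue_on A. f x) = (LINT x|lebesgue_on B. f x)"
proof -
  have "(\<lambda>x. indicator A x *\<^sub>R f x) = (\<lambda>x. indicator B x *\<^sub>R f x)"
  proof
    fix x
    show "indicator A x *\<^sub>R f x = indicator B x *\<^sub>R f x"
      using assms(3) assms(4)[of x] by (cases "x \<in> A"; cases "x \<in> B") auto
  qed
  then show ?thesis
    using assms(1,2) integral_restrict_space[of A lebesgue f] integral_restrict_space[of B lebesgue f] by simp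
qed

section \<open>Weak gradients\<close>

lemma integral_derivative_compact_support:
  fixes F :: "real^'d \<Rightarrow> real"
  assumes F: "C1_fun F" "compact (closure {x. F x \<noteq> 0})"
  shows "(\<integral>x. frechet_derivative F (at x) e \<partial>lborel) = 0"
proof -
  have Fm: "F \<in> borel_measurable borel"
    by (intro borel_measurable_continuous_onI C1_fun_continuous F)
  have supp: "F x = 0" if "x \<notin> closure {x. F x \<noteq> 0}" for x
    using that closure_subset[of "{x. F x \<noteq> 0}"] by auto
  have int: "integrable lborel F"
    by (rule integrable_compact_support[OF C1_fun_continuous[OF F(1)] F(2) supp])
  have "(\<integral>x. F x - F (x - a) \<partial>lborel) = 0" for a
    using Bochner_Integration.integral_diff[OF int integrable_translation[OF int, of a]] integral_translation[OF Fm, of a] by simp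
  then show ?thesis
    using integral_difference_quotient_tendsto[OF F, of UNIV e] by (simp add: LIMSEQ_const_iff)
qed

lemma outside_support:
  fixes F :: "real^'d \<Rightarrow> real"
  assumes "x \<notin> closure {x. F x \<noteq> 0}"
  shows "F x = 0" "partial j F x = 0"
  using assms closure_subset[of "{x. F x \<noteq> 0}"]
  unfolding partial_def by (auto simp: frechet_derivative_outside_support[OF assms])

definition jacobian :: "('d::finite) vfield \<Rightarrow> 'd mfield" where
  "jacobian p x = (\<chi> i j. partial j (\<lambda>x. p x $ i) x)"

lemma continuous_jacobian:
  assumes "\<And>i. C1_fun (\<lambda>x. p x $ i)"
  shows "continuous_on UNIV (jacobian p)"
  unfolding jacobian_def[abs_def] by (intro continuous_intros continuous_on_vec_lambda continuous_on_partial assms)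

lemma test_function_square_integrable:
  assumes "open D" "bounded D" "C1_fun \<phi>"
  shows "square_integrable (lebesgue_on D) \<phi>" "square_integrable (lebesgue_on D) (partial j \<phi>)"
  by (intro square_integrable_continuous C1_fun_continuous continuous_on_partial assms)+

text \<open>The product of \<open>p\<close> with a test function has compact support in \<open>D\<close>, so its derivatives have
  mean zero.\<close>

lemma has_weak_grad_jacobian:
  assumes D: "open D" "bounded D" and p: "\<And>i. C1_fun (\<lambda>x. p x $ i)"
    and v: "v \<in> borel_measurable (lebesgue_on D)" "AE x in lebesgue_on D. v x = p x"
  shows "has_weak_grad D v (jacobian p)"
  unfolding has_weak_grad_def
proof (intro conjI allI impI)
  show "square_integrable (lebesgue_on D) (jacobian p)"
    by (rule square_integrable_continuous[OF D continuous_jacobian[OF p]])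
  fix \<phi> i j assume "test_function D \<phi>"
  then have phi: "C1_fun \<phi>" "compact (closure {x. \<phi> x \<noteq> 0})" "closure {x. \<phi> x \<noteq> 0} \<subseteq> D"
    by (auto simp: test_function_def)
  let ?F = "\<lambda>x. p x $ i * \<phi> x"
  note sq = test_function_square_integrable[OF D phi(1)] test_function_square_integrable[OF D p]
  have F: "C1_fun ?F" by (intro C1_fun_mult p phi)
  have sub: "closure {x. ?F x \<noteq> 0} \<subseteq> closure {x. \<phi> x \<noteq> 0}"
    by (intro closure_mono) auto
  have Fc: "compact (closure {x. ?F x \<noteq> 0})"
    by (rule compact_closure_mono[OF phi(2)]) auto
  have "(LINT x|lebesgue_on D. partial j ?F x) = (\<integral>x. indicator D x * partial j ?F x \<partial>lborel)"
    by (intro integral_lebesgue_on_borel borel_measurable_continuous_onI continuous_on_partial F) (use D in auto)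
  also have "\<dots> = (\<integral>x. partial j ?F x \<partial>lborel)"
  proof (intro Bochner_Integration.integral_cong refl)
    fix x
    show "indicator D x * partial j ?F x = partial j ?F x"
      using outside_support(2)[of x ?F] sub phi(3) by (cases "x \<in> D") auto
  qed
  also have "\<dots> = 0"
    unfolding partial_def by (rule integral_derivative_compact_support[OF F Fc])
  finally have "(LINT x|lebesgue_on D. partial j (\<lambda>x. p x $ i) x * \<phi> x + p x $ i * partial j \<phi> x) = 0"
    by (simp add: partial_mult[OF p phi(1)])
  then have "(LINT x|lebesgue_on D. partial j (\<lambda>x. p x $ i) x * \<phi> x) + (LINT x|lebesgue_on D. p x $ i * partial j \<phi> x) = 0"
    by (subst (asm) Bochner_Integration.integral_add) (intro square_integrable_mult sq)+
  moreover have "(LINT x|lebesgue_on D. v x $ i * partial j \<phi> x) = (LINT x|lebesgue_on D. p x $ i * partial j \<phi> x)"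
  proof (rule integral_cong_AE)
    have "(\<lambda>x. v x $ i) \<in> borel_measurable (lebesgue_on D)"
      using v(1) by (rule measurable_compose) (intro borel_measurable_continuous_onI continuous_intros)
    then show "(\<lambda>x. v x $ i * partial j \<phi> x) \<in> borel_measurable (lebesgue_on D)"
      using sq(2) unfolding square_integrable_def by (intro borel_measurable_times) auto
    show "(\<lambda>x. p x $ i * partial j \<phi> x) \<in> borel_measurable (lebesgue_on D)"
      using square_integrable_mult[OF sq(3) sq(2)] by auto
    show "AE x in lebesgue_on D. v x $ i * partial j \<phi> x = p x $ i * partial j \<phi> x"
      using v(2) by eventually_elim simp
  qed
  ultimately show "(LINT x|lebesgue_on D. v x $ i * partial j \<phi> x)
      = - (LINT x|lebesgue_on D. jacobian p x $ i $ j * \<phi> x)"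
    by (simp add: jacobian_def)
qed

lemma has_weak_grad_unique:
  assumes D: "open D" "bounded D" and G: "has_weak_grad D v G" "has_weak_grad D v H"
  shows "AE x in lebesgue_on D. G x = H x"
proof -
  have sq: "square_integrable (lebesgue_on D) (\<lambda>x. G x $ i $ j)" "square_integrable (lebesgue_on D) (\<lambda>x. H x $ i $ j)" for i j
    using G by (auto simp: has_weak_grad_def intro!: square_integrable_nth)
  have "AE x in lebesgue_on D. G x $ i $ j - H x $ i $ j = 0" for i j
  proof (rule AE_zero_on_open_if_orthogonal[OF D(1)])
    show "integrable (lebesgue_on D) (\<lambda>x. G x $ i $ j - H x $ i $ j)"
      by (intro Bochner_Integration.integrable_diff square_integrable_integrable finite_measure_bounded_open D sq)
    fix \<phi> assume phi: "test_function D \<phi>"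
    then have "square_integrable (lebesgue_on D) \<phi>"
      using test_function_square_integrable[OF D] by (simp add: test_function_def)
    then have "(LINT x|lebesgue_on D. (G x $ i $ j - H x $ i $ j) * \<phi> x)
      = (LINT x|lebesgue_on D. G x $ i $ j * \<phi> x) - (LINT x|lebesgue_on D. H x $ i $ j * \<phi> x)"
      unfolding left_diff_distrib by (intro Bochner_Integration.integral_diff square_integrable_mult sq)
    then show "(LINT x|lebesgue_on D. (G x $ i $ j - H x $ i $ j) * \<phi> x) = 0"
      using G phi by (simp add: has_weak_grad_def)
  qed
  then have "AE x in lebesgue_on D. \<forall>i j. G x $ i $ j - H x $ i $ j = 0"
    by (simp add: eventually_all_finite)
  then show ?thesis by eventually_elim (simp add: vec_eq_iff)
qed

lemma has_weak_grad_weak_grad: "has_weak_grad D v G \<Longrightarrow> has_weak_grad D v (weak_grad D v)"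
  unfolding weak_grad_def by (rule someI[of "has_weak_grad D v"])

lemma weak_grad_AE_eq:
  "open D \<Longrightarrow> bounded D \<Longrightarrow> has_weak_grad D v G \<Longrightarrow> AE x in lebesgue_on D. weak_grad D v x = G x"
  using has_weak_grad_unique has_weak_grad_weak_grad by blast

lemma H1_weak_grad: "v \<in> H1 D \<Longrightarrow> has_weak_grad D v (weak_grad D v)"
  unfolding H1_def using has_weak_grad_weak_grad by blast

lemma H1_square_integrable: "v \<in> H1 D \<Longrightarrow> square_integrable (lebesgue_on D) v"
  unfolding H1_def by simp

lemma square_integrable_weak_grad: "v \<in> H1 D \<Longrightarrow> square_integrable (lebesgue_on D) (weak_grad D v)"
  using H1_weak_grad by (auto simp: has_weak_grad_def)

lemma has_weak_grad_add_scale: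
  assumes D: "open D" "bounded D"
    and v: "square_integrable (lebesgue_on D) v" "has_weak_grad D v G"
    and w: "square_integrable (lebesgue_on D) w" "has_weak_grad D w H"
  shows "has_weak_grad D (\<lambda>x. v x + c *\<^sub>R w x) (\<lambda>x. G x + c *\<^sub>R H x)"
  unfolding has_weak_grad_def
proof (intro conjI allI impI)
  have GH: "square_integrable (lebesgue_on D) G" "square_integrable (lebesgue_on D) H"
    using v w by (auto simp: has_weak_grad_def)
  then show "square_integrable (lebesgue_on D) (\<lambda>x. G x + c *\<^sub>R H x)"
    by (rule square_integrable_add_scale)
  fix \<phi> i j assume phi: "test_function D \<phi>"
  then have p: "square_integrable (lebesgue_on D) \<phi>" "square_integrable (lebesgue_on D) (partial j \<phi>)"
    using test_function_square_integrable[OF D] by (auto simp: test_function_def)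
  have "(LINT x|lebesgue_on D. (v x + c *\<^sub>R w x) $ i * partial j \<phi> x)
    = (LINT x|lebesgue_on D. v x $ i * partial j \<phi> x + c * (w x $ i * partial j \<phi> x))"
    by (simp add: algebra_simps)
  also have "\<dots> = (LINT x|lebesgue_on D. v x $ i * partial j \<phi> x) + c * (LINT x|lebesgue_on D. w x $ i * partial j \<phi> x)"
    by (subst Bochner_Integration.integral_add)
       (auto intro!: square_integrable_mult square_integrable_nth v w p)
  also have "\<dots> = - ((LINT x|lebesgue_on D. G x $ i $ j * \<phi> x) + c * (LINT x|lebesgue_on D. H x $ i $ j * \<phi> x))"
    using v w phi by (simp add: has_weak_grad_def)
  also have "(LINT x|lebesgue_on D. G x $ i $ j * \<phi> x) + c * (LINT x|lebesgue_on D. H x $ i $ j * \<phi> x)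
    = (LINT x|lebesgue_on D. G x $ i $ j * \<phi> x + c * (H x $ i $ j * \<phi> x))"
    by (subst Bochner_Integration.integral_add)
       (auto intro!: square_integrable_mult square_integrable_nth GH p)
  also have "\<dots> = (LINT x|lebesgue_on D. (G x + c *\<^sub>R H x) $ i $ j * \<phi> x)"
    by (simp add: algebra_simps)
  finally show "(LINT x|lebesgue_on D. (v x + c *\<^sub>R w x) $ i * partial j \<phi> x)
    = - (LINT x|lebesgue_on D. (G x + c *\<^sub>R H x) $ i $ j * \<phi> x)" .
qed

lemma H1_add_scale:
  assumes "open D" "bounded D" "v \<in> H1 D" "w \<in> H1 D"
  shows "(\<lambda>x. v x + c *\<^sub>R w x) \<in> H1 D"
  using has_weak_grad_add_scale[OF assms(1,2) H1_square_integrable H1_weak_grad H1_square_integrable H1_weak_grad] assms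
  unfolding H1_def[of D] by (blast intro: square_integrable_add_scale H1_square_integrable)

lemma weak_grad_add_scale:
  assumes "open D" "bounded D" "v \<in> H1 D" "w \<in> H1 D"
  shows "AE x in lebesgue_on D. weak_grad D (\<lambda>x. v x + c *\<^sub>R w x) x = weak_grad D v x + c *\<^sub>R weak_grad D w x"
  using assms by (intro weak_grad_AE_eq has_weak_grad_add_scale H1_square_integrable H1_weak_grad)

lemma has_weak_grad_subset:
  assumes D: "open D'" "open D" "D' \<subseteq> D" and G: "has_weak_grad D v G"
  shows "has_weak_grad D' v G"
  unfolding has_weak_grad_def
proof (intro conjI allI impI)
  show "square_integrable (lebesgue_on D') G"
    using G D by (intro square_integrable_subset[of D G D']) (auto simp: has_weak_grad_def)
  fix \<phi> i j assume phi: "test_function D' \<phi>"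
  then have supp: "closure {x. \<phi> x \<noteq> 0} \<subseteq> D'" by (simp add: test_function_def)
  have zero: "\<phi> x = 0" "partial j \<phi> x = 0" if "x \<notin> D'" for x
    using that supp by (auto intro!: outside_support)
  have "test_function D \<phi>" using phi D by (auto simp: test_function_def)
  then have "(LINT x|lebesgue_on D. v x $ i * partial j \<phi> x) = - (LINT x|lebesgue_on D. G x $ i $ j * \<phi> x)"
    using G by (simp add: has_weak_grad_def)
  then show "(LINT x|lebesgue_on D'. v x $ i * partial j \<phi> x) = - (LINT x|lebesgue_on D'. G x $ i $ j * \<phi> x)"
    using D zero by (simp add: integral_lebesgue_on_supported[of D D'])
qed

lemma H1_subset:
  assumes "open D'" "open D" "D' \<subseteq> D" "v \<in> H1 D"
  shows "v \<in> H1 D'"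
  using has_weak_grad_subset[OF assms(1-3) H1_weak_grad[OF assms(4)]]
    square_integrable_subset[OF H1_square_integrable[OF assms(4)] assms(3)] assms(1,2)
  unfolding H1_def[of D'] by auto

lemma H1_piecewise_C1:
  assumes "open D" "bounded D" "\<And>i. C1_fun (\<lambda>x. p x $ i)"
    "square_integrable (lebesgue_on D) v" "AE x in lebesgue_on D. v x = p x"
  shows "v \<in> H1 D"
  using has_weak_grad_jacobian[of D p v] assms unfolding H1_def square_integrable_def by blast


section \<open>Traces on facets\<close>

context simplex_facet
begin

lemma open_bounded_interior: "open (interior K)" "bounded (interior K)"
  using compact_imp_bounded[OF compact_K] bounded_subset interior_subset by auto

lemma square_integrable_face_continuous:
  fixes f :: "real^'d \<Rightarrow> 'b::euclidean_space"
  assumes "continuous_on UNIV f"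
  shows "square_integrable (face_measure E) f"
proof -
  have "bounded (f ` E)"
    by (intro compact_imp_bounded compact_continuous_image continuous_on_subset[OF assms] compact_E) auto
  then obtain B where "\<And>x. x \<in> E \<Longrightarrow> norm (f x) \<le> B"
    unfolding bounded_iff by auto
  then have "AE x in face_measure E. norm (f x) \<le> B"
    using AE_face_measure_rel_interior rel_interior_subset by (auto elim!: eventually_mono)
  moreover have "f \<in> borel_measurable (face_measure E)"
    using borel_measurable_continuous_onI[OF assms] measurable_cong_sets[OF sets_face_measure refl] by blast
  ultimately show ?thesis by (rule square_integrable_bounded[OF finite_face_measure, rotated])
qed

text \<open>The test functions supported in the collar of \<open>E\<close> see all of the relative interior of \<open>E\<close>, whose
  complement in \<open>E\<close> is a null set of the surface measure.\<close>

lemma has_trace_unique: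
  assumes g: "has_trace K E v g" "has_trace K E v h"
  shows "AE x in face_measure E. g x = h x"
proof -
  have sq: "square_integrable (face_measure E) (\<lambda>x. g x $ i)" "square_integrable (face_measure E) (\<lambda>x. h x $ i)" for i
    using g by (auto simp: has_trace_def intro!: square_integrable_nth)
  obtain j where j: "normal $ j \<noteq> 0" using normal_nonzero by (auto simp: vec_eq_iff)
  let ?V = "interior K \<union> rel_interior E \<union> {x. normal \<bullet> x > offset}"
  have "AE x in face_measure E. x \<in> ?V \<longrightarrow> g x $ i - h x $ i = 0" for i
  proof (rule AE_zero_if_orthogonal_to_test_functions[OF sets_face_measure _ open_facet_collar])
    show "integrable (face_measure E) (\<lambda>x. g x $ i - h x $ i)"
      by (intro Bochner_Integration.integrable_diff square_integrable_integrable finite_face_measure sq)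
    fix \<psi> :: "real^'d \<Rightarrow> real"
    assume p: "C1_fun \<psi>" "compact (closure {x. \<psi> x \<noteq> 0})" "closure {x. \<psi> x \<noteq> 0} \<subseteq> ?V"
    have "?V \<inter> frontier K \<subseteq> rel_interior E"
      using K_subset closed_K by (auto simp: frontier_def)
    then have "facet_test_function K E \<psi>"
      using p unfolding facet_test_function_def by blast
    then have eq: "(LINT x|face_measure E. g x $ i * \<psi> x * normal $ j) = (LINT x|face_measure E. h x $ i * \<psi> x * normal $ j)"
      using g by (simp add: has_trace_def)
    have "square_integrable (face_measure E) \<psi>"
      by (intro square_integrable_face_continuous C1_fun_continuous p)
    then have "(LINT x|face_measure E. \<psi> x * (g x $ i - h x $ i))
      = (LINT x|face_measure E. g x $ i * \<psi> x) - (LINT x|face_measure E. h x $ i * \<psi> x)"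
      by (subst Bochner_Integration.integral_diff[symmetric]) (auto intro!: square_integrable_mult sq simp: algebra_simps)
    then show "(LINT x|face_measure E. \<psi> x * (g x $ i - h x $ i)) = 0"
      using eq j by simp
  qed
  then have "AE x in face_measure E. \<forall>i. x \<in> ?V \<longrightarrow> g x $ i - h x $ i = 0"
    by (simp add: eventually_all_finite)
  then show ?thesis
    using AE_face_measure_rel_interior by eventually_elim (simp add: vec_eq_iff)
qed

lemma has_trace_add_scale:
  assumes v: "v \<in> H1 (interior K)" "has_trace K E v g"
    and w: "w \<in> H1 (interior K)" "has_trace K E w h"
  shows "has_trace K E (\<lambda>x. v x + c *\<^sub>R w x) (\<lambda>x. g x + c *\<^sub>R h x)"
  unfolding has_trace_def
proof (intro conjI allI impI)
  have gh: "square_integrable (face_measure E) g" "square_integrable (face_measure E) h"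
    using v w by (auto simp: has_trace_def)
  then show "square_integrable (face_measure E) (\<lambda>x. g x + c *\<^sub>R h x)"
    by (rule square_integrable_add_scale)
  let ?D = "interior K"
  let ?vw = "\<lambda>x. v x + c *\<^sub>R w x"
  fix \<psi> i j assume psi: "facet_test_function K E \<psi>"
  then have C1: "C1_fun \<psi>" by (simp add: facet_test_function_def)
  note p = test_function_square_integrable[OF open_bounded_interior C1]
  have pE: "square_integrable (face_measure E) \<psi>"
    by (intro square_integrable_face_continuous C1_fun_continuous C1)
  have vw: "?vw \<in> H1 ?D" by (rule H1_add_scale[OF open_bounded_interior v(1) w(1)])
  note sq = square_integrable_weak_grad[OF v(1)] square_integrable_weak_grad[OF w(1)]
    square_integrable_weak_grad[OF vw] H1_square_integrable[OF v(1)] H1_square_integrable[OF w(1)]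
    H1_square_integrable[OF vw]
  let ?I = "\<lambda>v x. weak_grad ?D v x $ i $ j * \<psi> x + v x $ i * partial j \<psi> x"
  have int: "integrable (lebesgue_on ?D) (?I v)" "integrable (lebesgue_on ?D) (?I w)" "integrable (lebesgue_on ?D) (?I ?vw)"
    by (intro Bochner_Integration.integrable_add square_integrable_mult square_integrable_nth sq p)+
  have "(LINT x|face_measure E. (g x + c *\<^sub>R h x) $ i * \<psi> x * normal $ j)
    = (LINT x|face_measure E. g x $ i * \<psi> x * normal $ j + c * (h x $ i * \<psi> x * normal $ j))"
    by (simp add: algebra_simps)
  also have "\<dots> = (LINT x|face_measure E. g x $ i * \<psi> x * normal $ j) + c * (LINT x|face_measure E. h x $ i * \<psi> x * normal $ j)"
    by (subst Bochner_Integration.integral_add)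
       (auto intro!: integrable_mult_right integrable_mult_left square_integrable_mult square_integrable_nth gh pE)
  also have "\<dots> = (LINT x|lebesgue_on ?D. ?I v x) + c * (LINT x|lebesgue_on ?D. ?I w x)"
    using v w psi by (simp add: has_trace_def)
  also have "\<dots> = (LINT x|lebesgue_on ?D. ?I v x + c * ?I w x)"
    unfolding Bochner_Integration.integral_add[OF int(1) integrable_mult_right[OF int(2), of c]] integral_mult_right_zero ..
  also have "\<dots> = (LINT x|lebesgue_on ?D. ?I ?vw x)"
  proof (rule integral_cong_AE)
    show "AE x in lebesgue_on ?D. ?I v x + c * ?I w x = ?I ?vw x"
      using weak_grad_add_scale[OF open_bounded_interior v(1) w(1), of c]
      by eventually_elim (simp add: algebra_simps)
    show "(\<lambda>x. ?I v x + c * ?I w x) \<in> borel_measurable (lebesgue_on ?D)"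
      by (rule borel_measurable_integrable[OF Bochner_Integration.integrable_add[OF int(1) integrable_mult_right[OF int(2)]]])
    show "?I ?vw \<in> borel_measurable (lebesgue_on ?D)"
      using int(3) by (rule borel_measurable_integrable)
  qed
  finally show "(LINT x|face_measure E. (g x + c *\<^sub>R h x) $ i * \<psi> x * normal $ j) = (LINT x|lebesgue_on ?D. ?I ?vw x)" .
qed

text \<open>For a smooth function the defining formula of the trace is the divergence theorem for its
  product with the test function.\<close>

lemma has_trace_piecewise_C1:
  assumes p: "\<And>i. C1_fun (\<lambda>x. p x $ i)"
    and v: "square_integrable (lebesgue_on (interior K)) v" "AE x in lebesgue_on (interior K). v x = p x"
  shows "has_trace K E v p"
  unfolding has_trace_def
proof (intro conjI allI impI)
  let ?D = "interior K"
  have "continuous_on UNIV p"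
    using p by (auto simp: continuous_on_componentwise[of UNIV p] Basis_vec_def inner_axis intro: C1_fun_continuous)
  then show "square_integrable (face_measure E) p"
    by (rule square_integrable_face_continuous)
  fix \<psi> i j assume "facet_test_function K E \<psi>"
  then have psi: "C1_fun \<psi>" "compact (closure {x. \<psi> x \<noteq> 0})" "closure {x. \<psi> x \<noteq> 0} \<inter> frontier K \<subseteq> rel_interior E"
    by (auto simp: facet_test_function_def)
  note sq = test_function_square_integrable[OF open_bounded_interior psi(1)]
  let ?F = "\<lambda>x. p x $ i * \<psi> x"
  have F: "C1_fun ?F" by (intro C1_fun_mult p psi)
  have sub: "closure {x. ?F x \<noteq> 0} \<subseteq> closure {x. \<psi> x \<noteq> 0}"
    by (intro closure_mono) auto
  have Fc: "compact (closure {x. ?F x \<noteq> 0})"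
    by (rule compact_closure_mono[OF psi(2)]) auto
  have vH: "v \<in> H1 ?D"
    by (rule H1_piecewise_C1[OF open_bounded_interior p v])
  have wg: "AE x in lebesgue_on ?D. weak_grad ?D v x = jacobian p x"
    using v by (intro weak_grad_AE_eq open_bounded_interior has_weak_grad_jacobian p) (auto simp: square_integrable_def)
  have "(LINT x|face_measure E. p x $ i * \<psi> x * normal $ j) = (normal \<bullet> axis j 1) * (LINT x|face_measure E. ?F x)"
    by (simp add: inner_axis)
  also have "\<dots> = (LINT x|lebesgue_on ?D. partial j ?F x)"
    unfolding partial_def by (rule simplex_divergence[OF F Fc, symmetric]) (use sub psi in blast)
  also have "\<dots> = (LINT x|lebesgue_on ?D. weak_grad ?D v x $ i $ j * \<psi> x + v x $ i * partial j \<psi> x)"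
  proof (rule integral_cong_AE)
    show "partial j ?F \<in> borel_measurable (lebesgue_on ?D)"
      using test_function_square_integrable(2)[OF open_bounded_interior F] by (simp add: square_integrable_def)
    show "(\<lambda>x. weak_grad ?D v x $ i $ j * \<psi> x + v x $ i * partial j \<psi> x) \<in> borel_measurable (lebesgue_on ?D)"
      by (intro borel_measurable_integrable Bochner_Integration.integrable_add square_integrable_mult
          square_integrable_nth square_integrable_weak_grad[OF vH] v sq)
    show "AE x in lebesgue_on ?D. partial j ?F x = weak_grad ?D v x $ i $ j * \<psi> x + v x $ i * partial j \<psi> x"
      using wg v(2) by eventually_elim (simp add: partial_mult[OF p psi(1)] jacobian_def)
  qed
  finally show "(LINT x|face_measure E. p x $ i * \<psi> x * normal $ j)
    = (LINT x|lebesgue_on ?D. weak_grad ?D v x $ i $ j * \<psi> x + v x $ i * partial j \<psi> x)" .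
qed

lemma has_trace_face_trace: "has_trace K E v g \<Longrightarrow> has_trace K E v (face_trace K E v)"
  unfolding face_trace_def by (rule someI[of "has_trace K E v"])

end

lemma C1_fun_polys:
  assumes "p \<in> polys m"
  shows "C1_fun (\<lambda>x. p x $ i)"
proof -
  from assms obtain c where "\<And>x. p x = (\<Sum>\<alpha>\<in>{\<alpha>. (\<Sum>i\<in>UNIV. \<alpha> i) \<le> m}. (\<Prod>i\<in>UNIV. (x $ i) ^ \<alpha> i) *\<^sub>R c \<alpha>)"
    unfolding polys_def by blast
  then have "(\<lambda>x. p x $ i) = (\<lambda>x. \<Sum>\<alpha>\<in>{\<alpha>. (\<Sum>i\<in>UNIV. \<alpha> i) \<le> m}. (\<Prod>i\<in>UNIV. (x $ i) ^ \<alpha> i) * c \<alpha> $ i)"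
    by simp
  then show ?thesis
    by (simp only:) (intro C1_fun_sum C1_fun_mult C1_fun_prod C1_fun_power C1_fun_component C1_fun_const)
qed

context simplex_facet
begin

text \<open>If both simplices lay on the same side of \<open>E\<close>, they would share a half-ball at each relative
  interior point of \<open>E\<close>.\<close>

lemma opposite_simplex:
  assumes K': "simplex_facet K' E" and disj: "interior K \<inter> interior K' = {}"
  shows "outer_normal K' E = - normal" and "simplex_facet.offset K' E = - offset"
proof -
  interpret K': simplex_facet K' E by fact
  obtain a where a: "a \<in> rel_interior E"
    using rel_interior_eq_empty[OF convex_E] E_nonempty by blast
  then have aE: "a \<in> E" using rel_interior_subset by blast
  have off: "offset = normal \<bullet> a" "K'.offset = K'.normal \<bullet> a"
    using aE E_subset K'.E_subset by auto
  show opp: "K'.normal = - normal"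
  proof (rule ccontr)
    assume "K'.normal \<noteq> - normal"
    then have eq: "K'.normal = normal"
      using unit_normal_cases[OF K'.norm_normal K'.E_subset] by blast
    obtain r where r: "r > 0" "ball a r \<inter> {x. normal \<bullet> x < offset} \<subseteq> interior K"
      using facet_neighbourhood[OF a] by metis
    obtain r' where r': "r' > 0" "ball a r' \<inter> {x. K'.normal \<bullet> x < K'.offset} \<subseteq> interior K'"
      using K'.facet_neighbourhood[OF a] by metis
    define s where "s = min r r' / 2"
    have s: "s > 0" "s < r" "s < r'" using r r' by (auto simp: s_def)
    let ?y = "a - s *\<^sub>R normal"
    have "normal \<bullet> ?y < offset"
      using s norm_normal by (simp add: off inner_diff_right norm_eq_1)
    moreover have "dist a ?y = s" using s norm_normal by (simp add: dist_norm)
    ultimately have "?y \<in> interior K \<inter> interior K'"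
      using r r' s off eq by auto
    then show False using disj by blast
  qed
  show "K'.offset = - offset" using off opp by simp
qed

lemma open_two_sided_collar:
  assumes K': "simplex_facet K' E" and disj: "interior K \<inter> interior K' = {}"
  shows "open (interior K \<union> rel_interior E \<union> interior K')"
proof -
  interpret K': simplex_facet K' E by fact
  have "interior K \<union> rel_interior E \<union> interior K'
    = (interior K \<union> rel_interior E \<union> {x. normal \<bullet> x > offset}) \<inter> (interior K' \<union> rel_interior E \<union> {x. K'.normal \<bullet> x > K'.offset})"
    using opposite_simplex[OF K' disj] interior_K_subset K'.interior_K_subset E_subset
      rel_interior_subset[of E] by fastforce
  then show ?thesis using open_facet_collar K'.open_facet_collar by (metis open_Int)
qed

text \<open>A test function for \<open>E\<close> seen from \<open>K'\<close>, cut off to the two simplices, is a test function on \<open>\<Omega>\<close>, so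
  that the right-hand sides of Green's formula on \<open>K\<close> and on \<open>K'\<close> add up to zero. As the normals are
  opposite, a function in \<open>H\<^sup>1(\<Omega>)\<close> has on either side the same traces.\<close>

lemma has_trace_opposite_simplex:
  assumes K': "simplex_facet K' E" and disj: "interior K \<inter> interior K' = {}"
    and \<Omega>: "open \<Omega>" "bounded \<Omega>" "interior K \<union> rel_interior E \<union> interior K' \<subseteq> \<Omega>"
    and u: "u \<in> H1 \<Omega>" and g: "has_trace K E u g"
  shows "has_trace K' E u g"
  unfolding has_trace_def
proof (intro conjI allI impI)
  interpret K': simplex_facet K' E by fact
  note opp = opposite_simplex[OF K' disj]
  show sqg: "square_integrable (face_measure E) g" using g by (simp add: has_trace_def)
  let ?W = "interior K \<union> rel_interior E \<union> interior K'"
  have lt: "normal \<bullet> x < offset" if "x \<in> interior K" for x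
    using that interior_K_subset by blast
  have gt: "normal \<bullet> x > offset" if "x \<in> interior K'" for x
    using that K'.interior_K_subset opp by auto
  have eq: "normal \<bullet> x = offset" if "x \<in> rel_interior E" for x
    using that E_subset rel_interior_subset by blast
  note W = open_two_sided_collar[OF K' disj]
  fix \<psi> i j assume "facet_test_function K' E \<psi>"
  then have psi: "C1_fun \<psi>" "compact (closure {x. \<psi> x \<noteq> 0})" "closure {x. \<psi> x \<noteq> 0} \<inter> frontier K' \<subseteq> rel_interior E"
    by (auto simp: facet_test_function_def)
  let ?C = "closure {x. \<psi> x \<noteq> 0} \<inter> K'"
  have cC: "compact ?C" using psi K'.closed_K by (intro compact_Int_closed)
  have CW: "?C \<subseteq> ?W"
    using psi(3) K'.closed_K by (auto simp: frontier_def)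
  obtain \<kappa> where k: "C1_fun \<kappa>" "\<And>x. 0 \<le> \<kappa> x" "\<And>x. \<kappa> x \<le> 1" "\<And>x. x \<in> ?C \<Longrightarrow> \<kappa> x = 1"
    "compact (closure {x. \<kappa> x \<noteq> 0})" "closure {x. \<kappa> x \<noteq> 0} \<subseteq> ?W"
    by (rule C1_cutoff[OF cC W CW]) (rule that)
  define \<phi> where "\<phi> = (\<lambda>x. \<psi> x * \<kappa> x)"
  have C1: "C1_fun \<phi>" unfolding \<phi>_def by (intro C1_fun_mult psi k)
  have cpt: "compact (closure {x. \<phi> x \<noteq> 0})"
    by (rule compact_closure_mono[OF psi(2)]) (auto simp: \<phi>_def)
  have "closure {x. \<phi> x \<noteq> 0} \<subseteq> closure {x. \<kappa> x \<noteq> 0}"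
    by (intro closure_mono) (auto simp: \<phi>_def)
  with k(6) have supp: "closure {x. \<phi> x \<noteq> 0} \<subseteq> ?W" by (rule order_trans[rotated])
  have same: "\<phi> x = \<psi> x" "partial j \<phi> x = partial j \<psi> x" if "x \<in> K'" for x
    using cutoff_transparent[OF psi(1) k(1) k(3), of x] k(4)[of x] that unfolding \<phi>_def partial_def by auto
  have test: "test_function \<Omega> \<phi>" using C1 cpt supp \<Omega> by (auto simp: test_function_def)
  have "?W \<inter> frontier K \<subseteq> rel_interior E"
  proof
    fix x assume x: "x \<in> ?W \<inter> frontier K"
    then have "x \<in> K" using closed_K by (auto simp: frontier_def)
    then have "x \<notin> interior K'" using gt K_subset by force
    then show "x \<in> rel_interior E" using x by (auto simp: frontier_def)
  qed
  then have facet_test: "facet_test_function K E \<phi>"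
    using C1 cpt supp unfolding facet_test_function_def by blast
  let ?G = "weak_grad \<Omega> u"
  let ?h = "\<lambda>x. ?G x $ i $ j * \<phi> x + u x $ i * partial j \<phi> x"
  let ?I = "\<lambda>L \<psi> x. weak_grad (interior L) u x $ i $ j * \<psi> x + u x $ i * partial j \<psi> x"
  have sub: "interior K \<subseteq> \<Omega>" "interior K' \<subseteq> \<Omega>" using \<Omega> by auto
  have int: "integrable (lebesgue_on D) ?h" if "open D" "bounded D" "D \<subseteq> \<Omega>" for D
  proof -
    have sq: "square_integrable (lebesgue_on D) ?G" "square_integrable (lebesgue_on D) u"
      using square_integrable_subset[OF square_integrable_weak_grad[OF u] that(3)]
        square_integrable_subset[OF H1_square_integrable[OF u] that(3)] that(1) \<Omega>(1) by auto
    show ?thesis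
      by (intro Bochner_Integration.integrable_add square_integrable_mult square_integrable_nth sq
          test_function_square_integrable that C1)
  qed
  have local: "(LINT x|lebesgue_on (interior L). ?I L \<phi> x)
      = (LINT x|lebesgue_on (interior L). ?h x)"
    if L: "interior L \<subseteq> \<Omega>" "bounded (interior L)" for L
  proof (rule integral_cong_AE)
    have uL: "u \<in> H1 (interior L)" by (rule H1_subset[OF open_interior \<Omega>(1) L(1) u])
    show "AE x in lebesgue_on (interior L). ?I L \<phi> x = ?h x"
      using weak_grad_AE_eq[OF open_interior L(2) has_weak_grad_subset[OF open_interior \<Omega>(1) L(1) H1_weak_grad[OF u]]]
      by eventually_elim simp
    show "?I L \<phi> \<in> borel_measurable (lebesgue_on (interior L))"
      by (intro borel_measurable_integrable Bochner_Integration.integrable_add square_integrable_mult square_integrable_nth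
          square_integrable_weak_grad[OF uL] H1_square_integrable[OF uL] test_function_square_integrable open_interior L C1)
    show "?h \<in> borel_measurable (lebesgue_on (interior L))"
      by (rule borel_measurable_integrable[OF int[OF open_interior L(2,1)]])
  qed
  have split: "(LINT x|lebesgue_on \<Omega>. ?h x) = (LINT x|lebesgue_on (interior K). ?h x) + (LINT x|lebesgue_on (interior K'). ?h x)"
  proof -
    have I: "integrable lebesgue (\<lambda>x. indicator D x *\<^sub>R ?h x)" if "open D" "bounded D" "D \<subseteq> \<Omega>" for D
      using int[OF that] that by (subst (asm) integrable_restrict_space) auto
    have "(LINT x|lebesgue_on \<Omega>. ?h x) = (\<integral>x. indicator \<Omega> x *\<^sub>R ?h x \<partial>lebesgue)"
      using \<Omega> by (intro integral_restrict_space) auto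
    also have "\<dots> = (\<integral>x. indicator (interior K) x *\<^sub>R ?h x + indicator (interior K') x *\<^sub>R ?h x \<partial>lebesgue)"
    proof (rule integral_cong_AE)
      have "negligible {x. normal \<bullet> x = offset}" using normal_nonzero by (intro negligible_hyperplane) auto
      then have "{x. normal \<bullet> x = offset} \<in> null_sets lebesgue" by (simp add: negligible_iff_null_sets)
      from AE_not_in[OF this]
      show "AE x in lebesgue. indicator \<Omega> x *\<^sub>R ?h x = indicator (interior K) x *\<^sub>R ?h x + indicator (interior K') x *\<^sub>R ?h x"
      proof eventually_elim
        case (elim x)
        then have nE: "x \<notin> rel_interior E" using eq by auto
        show ?case
        proof (cases "x \<in> interior K \<union> interior K'")
          case True
          then show ?thesis using disj sub by (auto simp: indicator_def)
        next
          case False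
          then have "x \<notin> closure {x. \<phi> x \<noteq> 0}" using supp nE by blast
          then show ?thesis using outside_support[of x \<phi>] by simp
        qed
      qed
      show "(\<lambda>x. indicator \<Omega> x *\<^sub>R ?h x) \<in> borel_measurable lebesgue"
        by (rule borel_measurable_integrable[OF I[OF \<Omega>(1,2) order_refl]])
      show "(\<lambda>x. indicator (interior K) x *\<^sub>R ?h x + indicator (interior K') x *\<^sub>R ?h x) \<in> borel_measurable lebesgue"
        by (intro borel_measurable_integrable Bochner_Integration.integrable_add I
            open_bounded_interior K'.open_bounded_interior sub)
    qed
    also have "\<dots> = (\<integral>x. indicator (interior K) x *\<^sub>R ?h x \<partial>lebesgue) + (\<integral>x. indicator (interior K') x *\<^sub>R ?h x \<partial>lebesgue)"
      by (intro Bochner_Integration.integral_add I open_bounded_interior K'.open_bounded_interior sub)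
    also have "\<dots> = (LINT x|lebesgue_on (interior K). ?h x) + (LINT x|lebesgue_on (interior K'). ?h x)"
      by (subst (1 2) integral_restrict_space) auto
    finally show ?thesis .
  qed
  have zero: "(LINT x|lebesgue_on \<Omega>. ?h x) = 0"
  proof -
    have "(LINT x|lebesgue_on \<Omega>. ?h x) = (LINT x|lebesgue_on \<Omega>. ?G x $ i $ j * \<phi> x) + (LINT x|lebesgue_on \<Omega>. u x $ i * partial j \<phi> x)"
      by (intro Bochner_Integration.integral_add square_integrable_mult square_integrable_nth
          square_integrable_weak_grad[OF u] H1_square_integrable[OF u] test_function_square_integrable \<Omega>(1,2) C1)
    also have "(LINT x|lebesgue_on \<Omega>. u x $ i * partial j \<phi> x) = - (LINT x|lebesgue_on \<Omega>. ?G x $ i $ j * \<phi> x)"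
      using H1_weak_grad[OF u] test by (simp add: has_weak_grad_def)
    finally show ?thesis by simp
  qed
  have "(LINT x|face_measure E. g x $ i * \<psi> x * K'.normal $ j) = (LINT x|face_measure E. - (g x $ i * \<phi> x * normal $ j))"
  proof (rule integral_cong_AE)
    show "AE x in face_measure E. g x $ i * \<psi> x * K'.normal $ j = - (g x $ i * \<phi> x * normal $ j)"
      using AE_face_measure_rel_interior
    proof eventually_elim
      case (elim x)
      then have "x \<in> K'" using rel_interior_subset K'.E_subset_K by blast
      then show ?case using same(1)[of x] opp by simp
    qed
    have sqE: "square_integrable (face_measure E) \<psi>" "square_integrable (face_measure E) \<phi>"
      by (intro square_integrable_face_continuous C1_fun_continuous psi C1)+
    have "integrable (face_measure E) (\<lambda>x. g x $ i * \<psi> x)" "integrable (face_measure E) (\<lambda>x. g x $ i * \<phi> x)"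
      by (intro square_integrable_mult square_integrable_nth sqg sqE)+
    then show "(\<lambda>x. g x $ i * \<psi> x * K'.normal $ j) \<in> borel_measurable (face_measure E)"
      "(\<lambda>x. - (g x $ i * \<phi> x * normal $ j)) \<in> borel_measurable (face_measure E)"
      by (auto dest!: borel_measurable_integrable)
  qed
  also have "\<dots> = - (LINT x|face_measure E. g x $ i * \<phi> x * normal $ j)" by simp
  also have "\<dots> = - (LINT x|lebesgue_on (interior K). ?h x)"
    using g facet_test local[OF sub(1) open_bounded_interior(2)] by (simp add: has_trace_def)
  also have "\<dots> = (LINT x|lebesgue_on (interior K'). ?h x)"
    using split zero by simp
  also have "\<dots> = (LINT x|lebesgue_on (interior K'). ?I K' \<phi> x)"
    by (rule local[OF sub(2) K'.open_bounded_interior(2), symmetric])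
  also have "\<dots> = (LINT x|lebesgue_on (interior K'). ?I K' \<psi> x)"
    using same interior_subset[of K'] by (intro Bochner_Integration.integral_cong refl) auto
  finally show "(LINT x|face_measure E. g x $ i * \<psi> x * K'.normal $ j)
    = (LINT x|lebesgue_on (interior K'). ?I K' \<psi> x)" .
qed

end


section \<open>Jumps of the error\<close>

lemma full_simplex_rel_interior:
  fixes K :: "(real^'d) set"
  assumes "int CARD('d) simplex K"
  shows "rel_interior K = interior K"
  using aff_dim_simplex[OF assms] by (intro interior_rel_interior) simp

lemma triangulation_interiors_disjoint:
  fixes K K' :: "(real^'d) set"
  assumes T: "triangulation \<T>" and K: "K \<in> \<T>" "K' \<in> \<T>" "K \<noteq> K'"
    and simp: "int CARD('d) simplex K" "int CARD('d) simplex K'"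
  shows "interior K \<inter> interior K' = {}"
proof (rule ccontr)
  assume ne: "interior K \<inter> interior K' \<noteq> {}"
  have face: "(L \<inter> L') face_of L" if "L \<in> \<T>" "L' \<in> \<T>" for L L'
    using T that unfolding triangulation_def by blast
  have "K \<subseteq> K \<inter> K'"
    by (rule subset_of_face_of[OF face[OF K(1,2)] order_refl])
       (use ne full_simplex_rel_interior[OF simp(1)] interior_subset in blast)
  moreover have "K' \<subseteq> K' \<inter> K"
    by (rule subset_of_face_of[OF face[OF K(2,1)] order_refl])
       (use ne full_simplex_rel_interior[OF simp(2)] interior_subset in blast)
  ultimately show False using K(3) by blast
qed

lemma L2_norm_nonneg: "L2_norm M f \<ge> 0"
  unfolding L2_norm_def by simp

lemma L2_norm_square: "(L2_norm M f)\<^sup>2 = (LINT x|M. (norm (f x))\<^sup>2)"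
  unfolding L2_norm_def by simp

lemma L2_norm_cong_AE:
  assumes "square_integrable M f" "square_integrable M g" "AE x in M. norm (f x) = norm (g x)"
  shows "L2_norm M f = L2_norm M g"
proof -
  have "(LINT x|M. (norm (f x))\<^sup>2) = (LINT x|M. (norm (g x))\<^sup>2)"
    using assms by (intro integral_cong_AE) (auto simp: square_integrable_def)
  then show ?thesis by (simp add: L2_norm_def)
qed

locale polyhedral_mesh =
  fixes \<Omega> \<Gamma>D \<Gamma>N :: "(real^'d) set" and \<T> :: "(real^'d) set set"
  assumes domain: "polyhedral_domain \<Omega>" and mesh: "mesh \<Omega> \<Gamma>D \<Gamma>N \<T>"
begin

lemma open_\<Omega>: "open \<Omega>" and bounded_\<Omega>: "bounded \<Omega>" and interior_closure_\<Omega>: "interior (closure \<Omega>) = \<Omega>"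
  using domain by (auto simp: polyhedral_domain_def)

lemma finite_mesh: "finite \<T>" and mesh_simplex: "K \<in> \<T> \<Longrightarrow> int CARD('d) simplex K"
  and Union_mesh: "\<Union>\<T> = closure \<Omega>" and triangulation: "triangulation \<T>"
  using mesh by (auto simp: mesh_def triangulation_def)

lemma simplex_facet: "K \<in> \<T> \<Longrightarrow> E facet_of K \<Longrightarrow> simplex_facet K E"
  using mesh_simplex by unfold_locales

lemma open_subset_\<Omega>: "open W \<Longrightarrow> W \<subseteq> \<Union>\<T> \<Longrightarrow> W \<subseteq> \<Omega>"
  using interior_maximal[of W "closure \<Omega>"] Union_mesh interior_closure_\<Omega> by simp

lemma interior_subset_\<Omega>: "K \<in> \<T> \<Longrightarrow> interior K \<subseteq> \<Omega>"
  using interior_subset by (intro open_subset_\<Omega>) auto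

lemma bounded_interior: "K \<in> \<T> \<Longrightarrow> bounded (interior K)"
  using bounded_subset[OF bounded_\<Omega> interior_subset_\<Omega>] .

lemma interiors_disjoint: "K \<in> \<T> \<Longrightarrow> K' \<in> \<T> \<Longrightarrow> K \<noteq> K' \<Longrightarrow> interior K \<inter> interior K' = {}"
  using triangulation_interiors_disjoint[OF triangulation] mesh_simplex by blast

lemma broken_polys_piece:
  assumes w: "w \<in> broken_polys \<Omega> \<T> m" and K: "K \<in> \<T>"
  obtains p where "\<And>i. C1_fun (\<lambda>x. p x $ i)" "square_integrable (lebesgue_on (interior K)) w"
    "AE x in lebesgue_on (interior K). w x = p x"
proof -
  obtain p where p: "p \<in> polys m" "AE x in lebesgue_on K. w x = p x"
    using w K by (auto simp: broken_polys_def restricts_to_def)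
  have "closed K"
    using mesh_simplex[OF K] by (intro polytope_imp_closed simplex_imp_polytope)
  then have Kc: "K \<in> sets lebesgue" by auto
  have "AE x in lebesgue_on (interior K). w x = p x"
    by (rule AE_lebesgue_on_subset[OF p(2) interior_subset Kc]) auto
  moreover have "square_integrable (lebesgue_on (interior K)) w"
    using w open_\<Omega> by (intro square_integrable_subset[OF _ interior_subset_\<Omega>[OF K]]) (auto simp: broken_polys_def)
  ultimately show ?thesis using that C1_fun_polys[OF p(1)] by blast
qed

lemma broken_polys_H1: "w \<in> broken_polys \<Omega> \<T> m \<Longrightarrow> K \<in> \<T> \<Longrightarrow> w \<in> H1 (interior K)"
  by (rule broken_polys_piece, assumption, assumption)
     (rule H1_piecewise_C1[OF open_interior bounded_interior])

lemma H1_interior: "u \<in> H1 \<Omega> \<Longrightarrow> K \<in> \<T> \<Longrightarrow> u \<in> H1 (interior K)"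
  using H1_subset[OF open_interior open_\<Omega> interior_subset_\<Omega>] by blast

lemma face_trace_error:
  assumes w: "w \<in> broken_polys \<Omega> \<T> m" and u: "u \<in> H1 \<Omega>" and K: "K \<in> \<T>" "E facet_of K"
    and g: "has_trace K E u g"
  shows "AE x in face_measure E. face_trace K E (\<lambda>x. u x - w x) x = g x - face_trace K E w x"
    and "square_integrable (face_measure E) (face_trace K E (\<lambda>x. u x - w x))"
    and "square_integrable (face_measure E) (face_trace K E w)"
proof -
  interpret simplex_facet K E by (rule simplex_facet[OF K])
  obtain p where "\<And>i. C1_fun (\<lambda>x. p x $ i)" "square_integrable (lebesgue_on (interior K)) w"
    "AE x in lebesgue_on (interior K). w x = p x"
    using broken_polys_piece[OF w K(1)] by metis
  from has_trace_piecewise_C1[OF this] have tw: "has_trace K E w (face_trace K E w)"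
    by (rule has_trace_face_trace)
  have te: "has_trace K E (\<lambda>x. u x - w x) (\<lambda>x. g x - face_trace K E w x)"
    using has_trace_add_scale[OF H1_interior[OF u K(1)] g broken_polys_H1[OF w K(1)] tw, of "-1"] by simp
  from has_trace_face_trace[OF te]
  show "AE x in face_measure E. face_trace K E (\<lambda>x. u x - w x) x = g x - face_trace K E w x"
    by (rule has_trace_unique[OF _ te])
  show "square_integrable (face_measure E) (face_trace K E (\<lambda>x. u x - w x))"
    "square_integrable (face_measure E) (face_trace K E w)"
    using has_trace_face_trace[OF te] tw by (auto simp: has_trace_def)
qed

text \<open>Either \<open>u\<close> has a common trace from both sides, which cancels in the jump and leaves that of
  \<open>- w\<close>, or it has none from either side. In the second case \<open>u - w\<close> has no trace, either, as the
  piecewise polynomial \<open>w\<close> has one; then both face traces of \<open>u - w\<close> are the same default value of the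
  choice operator and the jump is zero.\<close>

lemma jump_error_le:
  assumes w: "w \<in> broken_polys \<Omega> \<T> m" and u: "u \<in> H1 \<Omega>" and E: "E \<in> interior_faces \<T>"
  shows "L2_norm (face_measure E) (jump \<T> E (\<lambda>x. u x - w x)) \<le> L2_norm (face_measure E) (jump \<T> E w)"
proof -
  let ?P = "\<lambda>(K, K'). K \<in> \<T> \<and> K' \<in> \<T> \<and> K \<noteq> K' \<and> E facet_of K \<and> E facet_of K'"
  obtain K K' where KK: "(SOME p. ?P p) = (K, K')" by fastforce
  have "\<exists>p. ?P p" using E by (auto simp: interior_faces_def)
  from someI_ex[OF this] have K: "K \<in> \<T>" "E facet_of K" and K': "K' \<in> \<T>" "E facet_of K'" and "K \<noteq> K'"
    unfolding KK by auto
  have jump: "jump \<T> E v = (\<lambda>x. face_trace K E v x - face_trace K' E v x)" for v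
    unfolding jump_def KK by simp
  interpret K: simplex_facet K E by (rule simplex_facet[OF K])
  interpret K': simplex_facet K' E by (rule simplex_facet[OF K'])
  have disj: "interior K \<inter> interior K' = {}" by (rule interiors_disjoint) fact+
  have across: "has_trace K E u g \<longleftrightarrow> has_trace K' E u g" for g
  proof -
    have "open (interior K \<union> rel_interior E \<union> interior K')"
      by (rule K.open_two_sided_collar[OF K'.simplex_facet_axioms disj])
    moreover have "interior K \<union> rel_interior E \<union> interior K' \<subseteq> \<Union>\<T>"
      using K K' interior_subset rel_interior_subset[of E] K.E_subset_K by fastforce
    ultimately have W: "interior K \<union> rel_interior E \<union> interior K' \<subseteq> \<Omega>"
      by (rule open_subset_\<Omega>)
    then have W': "interior K' \<union> rel_interior E \<union> interior K \<subseteq> \<Omega>" by blast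
    show ?thesis
      using K.has_trace_opposite_simplex[OF K'.simplex_facet_axioms disj open_\<Omega> bounded_\<Omega> W u]
        K'.has_trace_opposite_simplex[OF K.simplex_facet_axioms _ open_\<Omega> bounded_\<Omega> W' u] disj by blast
  qed
  show ?thesis
  proof (cases "\<exists>g. has_trace K E u g")
    case True
    then obtain g where g: "has_trace K E u g" "has_trace K' E u g" using across by blast
    note e = face_trace_error[OF w u K g(1)]
    note e' = face_trace_error[OF w u K' g(2)]
    have "L2_norm (face_measure E) (jump \<T> E (\<lambda>x. u x - w x)) = L2_norm (face_measure E) (jump \<T> E w)"
      unfolding jump
    proof (rule L2_norm_cong_AE)
      show "AE x in face_measure E. norm (face_trace K E (\<lambda>x. u x - w x) x - face_trace K' E (\<lambda>x. u x - w x) x)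
        = norm (face_trace K E w x - face_trace K' E w x)"
        using e(1) e'(1) by eventually_elim (simp add: norm_minus_commute)
    qed (intro square_integrable_diff e e')+
    then show ?thesis by simp
  next
    case False
    have none: "\<not> has_trace L E (\<lambda>x. u x - w x) g" if L: "L \<in> \<T>" "E facet_of L" "\<nexists>g. has_trace L E u g" for L g
    proof
      interpret L: simplex_facet L E by (rule simplex_facet[OF L(1,2)])
      assume g: "has_trace L E (\<lambda>x. u x - w x) g"
      obtain p where p: "\<And>i. C1_fun (\<lambda>x. p x $ i)" "square_integrable (lebesgue_on (interior L)) w"
        "AE x in lebesgue_on (interior L). w x = p x"
        using broken_polys_piece[OF w L(1)] by metis
      have "(\<lambda>x. u x - w x) \<in> H1 (interior L)"
        using H1_add_scale[OF open_interior bounded_interior[OF L(1)] H1_interior[OF u L(1)] broken_polys_H1[OF w L(1)], of "-1"]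
        by simp
      from L.has_trace_add_scale[OF this g broken_polys_H1[OF w L(1)] L.has_trace_piecewise_C1[OF p], of 1]
      have "has_trace L E u (\<lambda>x. g x + p x)" by simp
      then show False using L(3) by blast
    qed
    have "has_trace K E (\<lambda>x. u x - w x) = has_trace K' E (\<lambda>x. u x - w x)"
      using none[OF K] none[OF K'] False across by blast
    then have "face_trace K E (\<lambda>x. u x - w x) = face_trace K' E (\<lambda>x. u x - w x)"
      by (simp add: face_trace_def)
    then have "L2_norm (face_measure E) (jump \<T> E (\<lambda>x. u x - w x)) = 0"
      unfolding jump by (simp add: L2_norm_def)
    then show ?thesis using L2_norm_nonneg by metis
  qed
qed

lemma boundary_trace_error:
  assumes w: "w \<in> broken_polys \<Omega> \<T> m" and u: "u \<in> H1_vanishing \<Omega> \<Gamma>D" and E: "E \<in> dirichlet_faces \<Gamma>D \<T>"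
  shows "L2_norm (face_measure E) (boundary_trace \<T> E (\<lambda>x. u x - w x)) = L2_norm (face_measure E) (boundary_trace \<T> E w)"
proof -
  define K where "K = (SOME K. K \<in> \<T> \<and> E facet_of K)"
  have "\<exists>K. K \<in> \<T> \<and> E facet_of K" using E by (auto simp: dirichlet_faces_def)
  from someI_ex[OF this] have K: "K \<in> \<T>" "E facet_of K" by (auto simp: K_def)
  have "flat_piece \<Omega> \<Gamma>D K E"
    using K E mesh_simplex Union_mesh by (auto simp: flat_piece_def dirichlet_faces_def)
  then have "u \<in> H1 \<Omega>" "has_trace K E u (\<lambda>x. 0)"
    using u by (auto simp: H1_vanishing_def)
  note e = face_trace_error[OF w this(1) K this(2)]
  show ?thesis
    unfolding boundary_trace_def K_def[symmetric]
  proof (rule L2_norm_cong_AE)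
    show "AE x in face_measure E. norm (face_trace K E (\<lambda>x. u x - w x) x) = norm (face_trace K E w x)"
      using e(1) by eventually_elim simp
  qed (rule e)+
qed

end

section \<open>Piecewise integrals\<close>

text \<open>Since the Lebesgue measure is complete, \<open>f\<close> and \<open>g\<close> are measurable together; if they are not, both
  integrals have the default value \<open>0\<close>.\<close>

lemma integral_lebesgue_cong_AE:
  fixes f g :: "real^'d \<Rightarrow> real"
  assumes "AE x in lebesgue. f x = g x"
  shows "integral\<^sup>L lebesgue f = integral\<^sup>L lebesgue g"
proof (cases "f \<in> borel_measurable lebesgue")
  case True
  then show ?thesis using borel_measurable_AE[OF True assms] assms by (intro integral_cong_AE) auto
next
  case False
  have "AE x in lebesgue. g x = f x" using assms by eventually_elim simp
  then have "g \<notin> borel_measurable lebesgue" using False borel_measurable_AE by blast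
  then show ?thesis
    using False not_integrable_integral_eq borel_measurable_integrable by metis
qed

lemma integral_lebesgue_on_interior:
  fixes f :: "real^'d \<Rightarrow> real"
  assumes "convex K" "closed K"
  shows "(LINT x|lebesgue_on K. f x) = (LINT x|lebesgue_on (interior K). f x)"
proof -
  have "frontier K \<in> null_sets lebesgue"
    using negligible_convex_frontier[OF assms(1)] by (simp add: negligible_iff_null_sets)
  from AE_not_in[OF this] have "AE x in lebesgue. indicator K x *\<^sub>R f x = indicator (interior K) x *\<^sub>R f x"
    by eventually_elim (use assms(2) interior_subset[of K] in \<open>auto simp: frontier_def indicator_def\<close>)
  from integral_lebesgue_cong_AE[OF this] show ?thesis
    using assms(2) by (simp add: integral_restrict_space)
qed

definition symmetric_part :: "real^'d^'d \<Rightarrow> real^'d^'d" where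
  "symmetric_part A = (1/2) *\<^sub>R (A + transpose A)"

lemma linear_symmetric_part: "linear symmetric_part"
  by (rule linearI) (simp_all add: symmetric_part_def transpose_def vec_eq_iff algebra_simps)

lemma eps_eq: "eps D v x = symmetric_part (weak_grad D v x)"
  by (simp add: eps_def symmetric_part_def)

lemma square_integrable_eps: "v \<in> H1 D \<Longrightarrow> square_integrable (lebesgue_on D) (eps D v)"
  unfolding eps_eq[abs_def] by (rule square_integrable_linear[OF square_integrable_weak_grad linear_symmetric_part])

lemma eps_add_scale:
  assumes "open D" "bounded D" "v \<in> H1 D" "w \<in> H1 D"
  shows "AE x in lebesgue_on D. eps D (\<lambda>x. v x + c *\<^sub>R w x) x = eps D v x + c *\<^sub>R eps D w x"
  using weak_grad_add_scale[OF assms, of c]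
  by eventually_elim (simp add: eps_eq linear_add[OF linear_symmetric_part] linear_scale[OF linear_symmetric_part])

lemma H1_diff: "open D \<Longrightarrow> bounded D \<Longrightarrow> v \<in> H1 D \<Longrightarrow> w \<in> H1 D \<Longrightarrow> (\<lambda>x. v x - w x) \<in> H1 D"
  using H1_add_scale[of D v w "-1"] by simp

lemma eps_diff:
  assumes "open D" "bounded D" "v \<in> H1 D" "w \<in> H1 D"
  shows "AE x in lebesgue_on D. eps D (\<lambda>x. v x - w x) x = eps D v x - eps D w x"
  using eps_add_scale[OF assms, of "-1"] by simp

lemma polys_add_scale:
  assumes "p \<in> polys m" "q \<in> polys m"
  shows "(\<lambda>x. p x + a *\<^sub>R q x) \<in> polys m"
proof -
  obtain c d where c: "\<And>x. p x = (\<Sum>\<alpha>\<in>{\<alpha>. (\<Sum>i\<in>UNIV. \<alpha> i) \<le> m}. (\<Prod>i\<in>UNIV. (x $ i) ^ \<alpha> i) *\<^sub>R c \<alpha>)"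
    and d: "\<And>x. q x = (\<Sum>\<alpha>\<in>{\<alpha>. (\<Sum>i\<in>UNIV. \<alpha> i) \<le> m}. (\<Prod>i\<in>UNIV. (x $ i) ^ \<alpha> i) *\<^sub>R d \<alpha>)"
    using assms unfolding polys_def by blast
  show ?thesis
    unfolding polys_def
    by (intro CollectI exI[of _ "\<lambda>\<alpha>. c \<alpha> + a *\<^sub>R d \<alpha>"])
       (simp add: c d scaleR_add_right sum.distrib scaleR_sum_right mult.commute)
qed

lemma polys_zero: "(\<lambda>x. 0) \<in> polys m"
  unfolding polys_def by (auto intro!: exI[of _ "\<lambda>\<alpha>. 0"])

lemma finite_multi_indices: "finite {\<alpha>::'d::finite \<Rightarrow> nat. (\<Sum>i\<in>UNIV. \<alpha> i) \<le> m}"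
proof (rule finite_subset)
  show "{\<alpha>::'d \<Rightarrow> nat. (\<Sum>i\<in>UNIV. \<alpha> i) \<le> m} \<subseteq> UNIV \<rightarrow>\<^sub>E {..m}"
  proof
    fix \<alpha> :: "'d \<Rightarrow> nat" assume "\<alpha> \<in> {\<alpha>. (\<Sum>i\<in>UNIV. \<alpha> i) \<le> m}"
    moreover have "\<alpha> i \<le> (\<Sum>i\<in>UNIV. \<alpha> i)" for i by (rule member_le_sum) auto
    ultimately show "\<alpha> \<in> UNIV \<rightarrow>\<^sub>E {..m}" using order_trans by fastforce
  qed
qed (intro finite_PiE; simp)

lemma polys_mono:
  assumes "m \<le> n" shows "(polys m :: (real^'d \<Rightarrow> 'b::real_vector) set) \<subseteq> polys n"
proof
  fix p :: "real^'d \<Rightarrow> 'b" assume "p \<in> polys m"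
  then obtain c where c: "\<And>x. p x = (\<Sum>\<alpha>\<in>{\<alpha>. (\<Sum>i\<in>UNIV. \<alpha> i) \<le> m}. (\<Prod>i\<in>UNIV. (x $ i) ^ \<alpha> i) *\<^sub>R c \<alpha>)"
    unfolding polys_def by blast
  have "p x = (\<Sum>\<alpha>\<in>{\<alpha>. (\<Sum>i\<in>UNIV. \<alpha> i) \<le> n}. (\<Prod>i\<in>UNIV. (x $ i) ^ \<alpha> i) *\<^sub>R
      (if (\<Sum>i\<in>UNIV. \<alpha> i) \<le> m then c \<alpha> else 0))" for x
    unfolding c using assms by (intro sum.mono_neutral_cong_left finite_multi_indices) auto
  then show "p \<in> polys n" unfolding polys_def by (intro CollectI exI allI)
qed

lemma broken_polys_mono: "m \<le> n \<Longrightarrow> broken_polys \<Omega> \<T> m \<subseteq> broken_polys \<Omega> \<T> n"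
  using polys_mono[of m n] unfolding broken_polys_def restricts_to_def by blast

lemma broken_polys_zero: "(\<lambda>x. 0) \<in> broken_polys \<Omega> \<T> m"
  using polys_zero[of m] unfolding broken_polys_def restricts_to_def square_integrable_def by auto

lemma broken_polys_add_scale:
  assumes "v \<in> broken_polys \<Omega> \<T> m" "w \<in> broken_polys \<Omega> \<T> m"
  shows "(\<lambda>x. v x + c *\<^sub>R w x) \<in> broken_polys \<Omega> \<T> m"
  unfolding broken_polys_def
proof (intro CollectI conjI ballI)
  show "square_integrable (lebesgue_on \<Omega>) (\<lambda>x. v x + c *\<^sub>R w x)"
    using assms by (intro square_integrable_add_scale) (auto simp: broken_polys_def)
  fix K assume "K \<in> \<T>"
  then obtain p q where pq: "p \<in> polys m" "q \<in> polys m" "AE x in lebesgue_on K. v x = p x" "AE x in lebesgue_on K. w x = q x"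
    using assms unfolding broken_polys_def restricts_to_def by blast
  have "AE x in lebesgue_on K. v x + c *\<^sub>R w x = p x + c *\<^sub>R q x"
    using pq(3,4) by eventually_elim simp
  then show "restricts_to K (\<lambda>x. v x + c *\<^sub>R w x) (polys m)"
    using polys_add_scale[OF pq(1,2), of c] unfolding restricts_to_def
    by (intro bexI[of _ "\<lambda>x. p x + c *\<^sub>R q x"])
qed

lemma broken_polys_diff:
  "v \<in> broken_polys \<Omega> \<T> m \<Longrightarrow> w \<in> broken_polys \<Omega> \<T> m \<Longrightarrow> (\<lambda>x. v x - w x) \<in> broken_polys \<Omega> \<T> m"
  using broken_polys_add_scale[of v \<Omega> \<T> m w "-1"] by simp

context polyhedral_mesh
begin

abbreviation "strain_sq v \<equiv> (\<Sum>K\<in>\<T>. (L2_norm (lebesgue_on K) (eps (interior K) v))\<^sup>2)"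

abbreviation "hooke_residual_sq \<mu> lam \<sigma>\<^sub>h w \<equiv>
  (\<Sum>K\<in>\<T>. (L2_norm (lebesgue_on K) (\<lambda>x. compliance \<mu> lam (\<sigma>\<^sub>h x) - eps (interior K) w x))\<^sup>2)"

abbreviation "jump_sq v \<equiv> (\<Sum>E\<in>interior_faces \<T>. (L2_norm (face_measure E) (jump \<T> E v))\<^sup>2 / diameter E)"

abbreviation "dirichlet_sq v \<equiv>
  (\<Sum>E\<in>dirichlet_faces \<Gamma>D \<T>. (L2_norm (face_measure E) (boundary_trace \<T> E v))\<^sup>2 / diameter E)"

lemma simplex_convex_closed:
  assumes "K \<in> \<T>" shows "convex K" "closed K"
  using mesh_simplex[OF assms]
  by (auto intro: polytope_imp_convex polytope_imp_closed simplex_imp_polytope)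

lemma integral_lebesgue_on_mesh_simplex:
  "K \<in> \<T> \<Longrightarrow> (LINT x|lebesgue_on K. f x) = (LINT x|lebesgue_on (interior K). f x :: real)"
  by (intro integral_lebesgue_on_interior simplex_convex_closed)

lemma L2_norm_mesh_simplex: "K \<in> \<T> \<Longrightarrow> L2_norm (lebesgue_on K) f = L2_norm (lebesgue_on (interior K)) f"
  unfolding L2_norm_def by (simp add: integral_lebesgue_on_mesh_simplex)

lemma L2_inner_mesh_simplex: "K \<in> \<T> \<Longrightarrow> L2_inner (lebesgue_on K) f g = L2_inner (lebesgue_on (interior K)) f g"
  unfolding L2_inner_def by (simp add: integral_lebesgue_on_mesh_simplex)

text \<open>A point of \<open>\<Omega>\<close> outside of the boundaries of the simplices, which have volume zero, is interior to
  exactly one simplex.\<close>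

lemma AE_domain_decomposition:
  "AE x in lebesgue. indicator \<Omega> x = (\<Sum>K\<in>\<T>. indicator (interior K) x :: real)"
proof -
  have "negligible (\<Union>K\<in>\<T>. frontier K)"
    using finite_mesh simplex_convex_closed by (intro negligible_Union) (auto intro: negligible_convex_frontier)
  then have "(\<Union>K\<in>\<T>. frontier K) \<in> null_sets lebesgue" by (simp add: negligible_iff_null_sets)
  from AE_not_in[OF this] show ?thesis
  proof eventually_elim
    case (elim x)
    show ?case
    proof (cases "x \<in> \<Omega>")
      case True
      then obtain K where K: "K \<in> \<T>" "x \<in> K" using Union_mesh closure_subset by blast
      then have xK: "x \<in> interior K" using elim simplex_convex_closed by (auto simp: frontier_def)
      have "(\<Sum>L\<in>\<T>. indicator (interior L) x :: real) = (\<Sum>L\<in>\<T>. if L = K then 1 else 0)"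
        using interiors_disjoint K(1) xK by (intro sum.cong refl) (auto simp: indicator_def)
      then show ?thesis using True K finite_mesh by simp
    next
      case False
      then have "x \<notin> interior K" if "K \<in> \<T>" for K using interior_subset_\<Omega>[OF that] by blast
      then show ?thesis using False by simp
    qed
  qed
qed

lemma integral_mesh:
  fixes f :: "real^'d \<Rightarrow> real"
  assumes "\<And>K. K \<in> \<T> \<Longrightarrow> integrable (lebesgue_on (interior K)) f"
  shows "(LINT x|lebesgue_on \<Omega>. f x) = (\<Sum>K\<in>\<T>. LINT x|lebesgue_on (interior K). f x)"
proof -
  have I: "integrable lebesgue (\<lambda>x. indicator (interior K) x *\<^sub>R f x)" if "K \<in> \<T>" for K
    using assms[OF that] by (subst (asm) integrable_restrict_space) auto
  have "(LINT x|lebesgue_on \<Omega>. f x) = (\<integral>x. indicator \<Omega> x *\<^sub>R f x \<partial>lebesgue)"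
    using open_\<Omega> by (intro integral_restrict_space) auto
  also have "\<dots> = (\<integral>x. (\<Sum>K\<in>\<T>. indicator (interior K) x *\<^sub>R f x) \<partial>lebesgue)"
    using AE_domain_decomposition
    by (intro integral_lebesgue_cong_AE) (auto elim!: eventually_mono simp: sum_distrib_right)
  also have "\<dots> = (\<Sum>K\<in>\<T>. \<integral>x. indicator (interior K) x *\<^sub>R f x \<partial>lebesgue)"
    using I by (rule Bochner_Integration.integral_sum)
  also have "\<dots> = (\<Sum>K\<in>\<T>. LINT x|lebesgue_on (interior K). f x)"
    by (intro sum.cong refl integral_restrict_space[symmetric]) auto
  finally show ?thesis .
qed

lemma square_integrable_piece:
  "square_integrable (lebesgue_on \<Omega>) f \<Longrightarrow> K \<in> \<T> \<Longrightarrow> square_integrable (lebesgue_on (interior K)) f"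
  using square_integrable_subset[OF _ interior_subset_\<Omega>] open_\<Omega> by auto

lemma L2_inner_mesh:
  assumes "square_integrable (lebesgue_on \<Omega>) f" "square_integrable (lebesgue_on \<Omega>) g"
  shows "L2_inner (lebesgue_on \<Omega>) f g = (\<Sum>K\<in>\<T>. L2_inner (lebesgue_on K) f g)"
proof -
  have "L2_inner (lebesgue_on \<Omega>) f g = (\<Sum>K\<in>\<T>. L2_inner (lebesgue_on (interior K)) f g)"
    unfolding L2_inner_def using assms by (intro integral_mesh square_integrable_inner square_integrable_piece)
  then show ?thesis by (simp add: L2_inner_mesh_simplex)
qed

lemma L2_norm_mesh:
  assumes "\<And>K. K \<in> \<T> \<Longrightarrow> square_integrable (lebesgue_on (interior K)) f"
  shows "(L2_norm (lebesgue_on \<Omega>) f)\<^sup>2 = (\<Sum>K\<in>\<T>. (L2_norm (lebesgue_on (interior K)) f)\<^sup>2)"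
  unfolding L2_norm_square using assms by (intro integral_mesh) (auto simp: square_integrable_def)

lemma broken_eps_interior:
  assumes "K \<in> \<T>" "x \<in> interior K"
  shows "broken_eps \<T> v x = eps (interior K) v x"
proof -
  have "broken_eps \<T> v x = (\<Sum>L\<in>\<T>. if L = K then eps (interior K) v x else 0)"
    unfolding broken_eps_def using interiors_disjoint assms by (intro sum.cong refl) (auto simp: indicator_def)
  then show ?thesis using assms finite_mesh by simp
qed

lemma L2_norm_broken_eps:
  assumes "\<And>K. K \<in> \<T> \<Longrightarrow> v \<in> H1 (interior K)"
  shows "(L2_norm (lebesgue_on \<Omega>) (broken_eps \<T> v))\<^sup>2 = strain_sq v"
proof -
  have ae: "AE x in lebesgue_on (interior K). broken_eps \<T> v x = eps (interior K) v x" if "K \<in> \<T>" for K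
    using broken_eps_interior[OF that] by (intro AE_I2) simp
  have sq: "square_integrable (lebesgue_on (interior K)) (broken_eps \<T> v)" if "K \<in> \<T>" for K
  proof (rule square_integrable_bound[OF square_integrable_eps[OF assms[OF that]], of _ 1])
    show "AE x in lebesgue_on (interior K). norm (broken_eps \<T> v x) \<le> 1 * norm (eps (interior K) v x)"
      using ae[OF that] by eventually_elim simp
    have "eps (interior K) v \<in> borel_measurable (lebesgue_on (interior K))"
      using square_integrable_eps[OF assms[OF that]] by (simp add: square_integrable_def)
    then show "broken_eps \<T> v \<in> borel_measurable (lebesgue_on (interior K))"
      by (rule measurable_cong[THEN iffD1, rotated]) (simp add: broken_eps_interior[OF that])
  qed
  have "(L2_norm (lebesgue_on \<Omega>) (broken_eps \<T> v))\<^sup>2 = (\<Sum>K\<in>\<T>. (L2_norm (lebesgue_on (interior K)) (broken_eps \<T> v))\<^sup>2)"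
    using sq by (rule L2_norm_mesh)
  also have "\<dots> = strain_sq v"
  proof (intro sum.cong refl arg_cong[where f="\<lambda>t. t\<^sup>2"])
    fix K assume K: "K \<in> \<T>"
    have "AE x in lebesgue_on (interior K). norm (broken_eps \<T> v x) = norm (eps (interior K) v x)"
      using ae[OF K] by eventually_elim simp
    then show "L2_norm (lebesgue_on (interior K)) (broken_eps \<T> v) = L2_norm (lebesgue_on K) (eps (interior K) v)"
      unfolding L2_norm_mesh_simplex[OF K]
      by (intro L2_norm_cong_AE sq K square_integrable_eps assms)
  qed
  finally show ?thesis .
qed

end


section \<open>The local problems\<close>

lemma linear_compliance: "linear (compliance \<mu> lam :: real^'d^'d \<Rightarrow> _)"
  by (rule linearI)
     (simp_all add: compliance_def trace_def sum.distrib vec_eq_iff algebra_simps flip: sum_distrib_left)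

lemma compliance_inverse:
  assumes "\<mu> > 0" "lam > 0"
  shows "(2 * \<mu>) *\<^sub>R compliance \<mu> lam \<tau> + (lam * trace (compliance \<mu> lam \<tau>)) *\<^sub>R mat 1 = (\<tau> :: real^'d^'d)"
proof -
  let ?d = "2 * \<mu> + real CARD('d) * lam"
  have d: "?d > 0" using assms by (simp add: add_pos_nonneg)
  have "trace (compliance \<mu> lam \<tau>) = (1 / (2 * \<mu>)) * (trace \<tau> - lam / ?d * trace \<tau> * real CARD('d))"
    by (simp add: compliance_def trace_def mat_def sum_subtractf sum_distrib_left algebra_simps flip: sum_divide_distrib)
  also have "\<dots> = trace \<tau> / ?d"
    using d assms by (simp add: field_simps)
  finally have tr: "trace (compliance \<mu> lam \<tau>) = trace \<tau> / ?d" .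
  show ?thesis unfolding tr using assms by (simp add: compliance_def)
qed

text \<open>The inverse of the compliance has the norm \<open>2\<mu> + d lam\<close>; it is here that the constant of the
  estimate degenerates in the incompressible limit.\<close>

lemma compliance_bounded_below:
  assumes "\<mu> > 0" "lam > 0"
  obtains B where "B > 0" "\<And>\<tau> :: real^'d^'d. norm \<tau> \<le> B * norm (compliance \<mu> lam \<tau>)"
proof -
  let ?L = "\<lambda>\<tau> :: real^'d^'d. (2 * \<mu>) *\<^sub>R \<tau> + (lam * trace \<tau>) *\<^sub>R mat 1"
  have "linear ?L"
    by (rule linearI) (simp_all add: trace_def sum.distrib vec_eq_iff algebra_simps flip: sum_distrib_left)
  then obtain B where "B > 0" "\<And>\<tau>. norm (?L \<tau>) \<le> B * norm \<tau>"
    using linear_bounded_pos by blast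
  then show ?thesis using that compliance_inverse[OF assms] by metis
qed

lemma displacement_degree_le: "displacement_degree fam k \<le> local_degree fam k"
  by (cases "fam = JM") (auto simp: displacement_degree_def local_degree_def)

lemma self_in_proj_image: "v \<in> V \<Longrightarrow> v \<in> W \<Longrightarrow> v \<in> proj_image \<Omega> V W"
  unfolding proj_image_def is_L2_projection_def L2_inner_def by (intro CollectI bexI[of _ v]) auto

lemma orthogonal_in_coproj_image:
  assumes "(\<lambda>x. 0) \<in> V" "w \<in> W" "\<And>v. v \<in> V \<Longrightarrow> L2_inner (lebesgue_on \<Omega>) w v = 0"
  shows "w \<in> coproj_image \<Omega> V W"
  using assms unfolding coproj_image_def is_L2_projection_def
  by (intro CollectI bexI[of _ w] exI[of _ "\<lambda>x. 0"]) auto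

context polyhedral_mesh
begin

text \<open>On each simplex \<open>\<epsilon>(z - w) = \<epsilon>(r)\<close>. The difference \<open>z - w - r\<close> is orthogonal to the displacement space, because \<open>z\<close> and \<open>w\<close> have the
  same moments against it and \<open>r\<close> has none. So it is an admissible test function of both local
  problems, and subtracting them shows that its own strain vanishes.\<close>

lemma eps_auxiliary_solution:
  assumes rm: "residual_minimization \<mu> lam fam k \<Omega> \<T> u\<^sub>h \<sigma>\<^sub>h r w"
    and aux: "auxiliary_problem \<mu> lam fam k \<Omega> \<T> u\<^sub>h \<sigma>\<^sub>h z"
    and K: "K \<in> \<T>"
  shows "r \<in> broken_polys \<Omega> \<T> (local_degree fam k + 1)"
    and "AE x in lebesgue_on (interior K). eps (interior K) z x = eps (interior K) w x + eps (interior K) r x"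
proof -
  let ?V = "displacement_space fam k \<Omega> \<T>"
  let ?l = "local_degree fam k"
  let ?W = "broken_polys \<Omega> \<T> (?l + 1)"
  have VW: "?V \<subseteq> broken_polys \<Omega> \<T> ?l" "?V \<subseteq> ?W" and lW: "broken_polys \<Omega> \<T> ?l \<subseteq> ?W"
    using displacement_degree_le[of fam k] broken_polys_mono unfolding displacement_space_def by (metis le_add1 order_trans)+
  have V0: "(\<lambda>x. 0) \<in> ?V" unfolding displacement_space_def by (rule broken_polys_zero)
  have sqW: "square_integrable (lebesgue_on \<Omega>) v" if "v \<in> ?W" for v using that by (simp add: broken_polys_def)
  have r: "r \<in> coproj_image \<Omega> ?V ?W" and w: "w \<in> broken_polys \<Omega> \<T> ?l" and z: "z \<in> ?W"
    and eq_w: "\<And>K v. K \<in> \<T> \<Longrightarrow> v \<in> coproj_image \<Omega> ?V ?W \<Longrightarrow>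
        L2_inner (lebesgue_on K) (eps (interior K) r) (eps (interior K) v)
        + L2_inner (lebesgue_on K) (eps (interior K) w) (eps (interior K) v)
        = L2_inner (lebesgue_on K) (\<lambda>x. compliance \<mu> lam (\<sigma>\<^sub>h x)) (eps (interior K) v)"
    and mom_w: "\<And>K v. K \<in> \<T> \<Longrightarrow> v \<in> proj_image \<Omega> ?V (broken_polys \<Omega> \<T> ?l) \<Longrightarrow>
        L2_inner (lebesgue_on K) w v = L2_inner (lebesgue_on K) u\<^sub>h v"
    and eq_z: "\<And>K v. K \<in> \<T> \<Longrightarrow> v \<in> coproj_image \<Omega> ?V ?W \<Longrightarrow>
        L2_inner (lebesgue_on K) (eps (interior K) z) (eps (interior K) v)
        = L2_inner (lebesgue_on K) (\<lambda>x. compliance \<mu> lam (\<sigma>\<^sub>h x)) (eps (interior K) v)"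
    and mom_z: "\<And>K v. K \<in> \<T> \<Longrightarrow> v \<in> proj_image \<Omega> ?V ?W \<Longrightarrow>
        L2_inner (lebesgue_on K) z v = L2_inner (lebesgue_on K) u\<^sub>h v"
    using rm aux unfolding residual_minimization_def auxiliary_problem_def Let_def by auto
  obtain w0 p0 where w0: "w0 \<in> ?W" and p0: "is_L2_projection \<Omega> ?V w0 p0" and r_eq: "r = (\<lambda>x. w0 x - p0 x)"
    using r unfolding coproj_image_def by blast
  have p0V: "p0 \<in> ?V" using p0 by (simp add: is_L2_projection_def)
  show rW: "r \<in> ?W" unfolding r_eq using w0 p0V VW by (intro broken_polys_diff) auto
  have r_orth: "L2_inner (lebesgue_on \<Omega>) r v = 0" if "v \<in> ?V" for v
    using p0 that unfolding is_L2_projection_def r_eq by blast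
  have wW: "w \<in> ?W" using w lW by blast
  define y where "y = (\<lambda>x. z x - w x - r x)"
  have zwW: "(\<lambda>x. z x - w x) \<in> ?W" by (rule broken_polys_diff[OF z wW])
  have yW: "y \<in> ?W" unfolding y_def by (rule broken_polys_diff[OF zwW rW])
  have y: "y \<in> coproj_image \<Omega> ?V ?W"
  proof (rule orthogonal_in_coproj_image[OF V0 yW])
    fix v assume v: "v \<in> ?V"
    then have sqv: "square_integrable (lebesgue_on \<Omega>) v" using VW sqW by blast
    have "L2_inner (lebesgue_on \<Omega>) z v = (\<Sum>K\<in>\<T>. L2_inner (lebesgue_on K) z v)"
      by (rule L2_inner_mesh[OF sqW[OF z] sqv])
    also have "\<dots> = (\<Sum>K\<in>\<T>. L2_inner (lebesgue_on K) w v)"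
    proof (intro sum.cong refl)
      fix K assume K: "K \<in> \<T>"
      show "L2_inner (lebesgue_on K) z v = L2_inner (lebesgue_on K) w v"
        using mom_z[OF K self_in_proj_image[OF v subsetD[OF VW(2) v]]]
          mom_w[OF K self_in_proj_image[OF v subsetD[OF VW(1) v]]] by simp
    qed
    also have "\<dots> = L2_inner (lebesgue_on \<Omega>) w v"
      by (rule L2_inner_mesh[OF sqW[OF wW] sqv, symmetric])
    finally have zw: "L2_inner (lebesgue_on \<Omega>) z v = L2_inner (lebesgue_on \<Omega>) w v" .
    note int = square_integrable_inner[OF sqW[OF z] sqv] square_integrable_inner[OF sqW[OF wW] sqv]
      square_integrable_inner[OF sqW[OF rW] sqv]
    have "L2_inner (lebesgue_on \<Omega>) y v
      = L2_inner (lebesgue_on \<Omega>) z v - L2_inner (lebesgue_on \<Omega>) w v - L2_inner (lebesgue_on \<Omega>) r v"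
      unfolding L2_inner_def y_def inner_diff_left using int by simp
    then show "L2_inner (lebesgue_on \<Omega>) y v = 0" using zw r_orth[OF v] by simp
  qed
  let ?M = "lebesgue_on (interior K)"
  let ?e = "\<lambda>v. eps (interior K) v"
  note D = open_interior[of K] bounded_interior[OF K]
  note H = broken_polys_H1[OF _ K]
  have sq: "square_integrable ?M (?e v)" if "v \<in> ?W" for v using square_integrable_eps H that by blast
  have "AE x in ?M. ?e y x = ?e (\<lambda>x. z x - w x) x - ?e r x"
    unfolding y_def by (rule eps_diff[OF D H[OF zwW] H[OF rW]])
  with eps_diff[OF D H[OF z] H[OF wW]] have ae: "AE x in ?M. ?e y x = ?e z x - ?e w x - ?e r x"
    by eventually_elim simp
  have "L2_inner (lebesgue_on K) (?e z) (?e y) = L2_inner (lebesgue_on K) (?e r) (?e y) + L2_inner (lebesgue_on K) (?e w) (?e y)"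
    using eq_z[OF K y] eq_w[OF K y] by simp
  then have "(LINT x|?M. ?e z x \<bullet> ?e y x) - (LINT x|?M. ?e w x \<bullet> ?e y x) - (LINT x|?M. ?e r x \<bullet> ?e y x) = 0"
    unfolding L2_inner_mesh_simplex[OF K] by (simp add: L2_inner_def)
  moreover note int = square_integrable_inner[OF sq[OF z] sq[OF yW]] square_integrable_inner[OF sq[OF wW] sq[OF yW]]
    square_integrable_inner[OF sq[OF rW] sq[OF yW]]
  ultimately have "(LINT x|?M. ?e z x \<bullet> ?e y x - ?e w x \<bullet> ?e y x - ?e r x \<bullet> ?e y x) = 0"
    by simp
  moreover have "(LINT x|?M. ?e z x \<bullet> ?e y x - ?e w x \<bullet> ?e y x - ?e r x \<bullet> ?e y x) = (LINT x|?M. (norm (?e y x))\<^sup>2)"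
  proof (rule integral_cong_AE)
    show "AE x in ?M. ?e z x \<bullet> ?e y x - ?e w x \<bullet> ?e y x - ?e r x \<bullet> ?e y x = (norm (?e y x))\<^sup>2"
      using ae
    proof eventually_elim
      case (elim x)
      then show ?case by (simp add: power2_norm_eq_inner inner_diff_left)
    qed
    show "(\<lambda>x. ?e z x \<bullet> ?e y x - ?e w x \<bullet> ?e y x - ?e r x \<bullet> ?e y x) \<in> borel_measurable ?M"
      by (intro borel_measurable_integrable Bochner_Integration.integrable_diff int)
    show "(\<lambda>x. (norm (?e y x))\<^sup>2) \<in> borel_measurable ?M"
      using sq[OF yW] unfolding square_integrable_def by (auto dest: borel_measurable_integrable)
  qed
  ultimately have "(LINT x|?M. (norm (?e y x))\<^sup>2) = 0" by simp
  then have "AE x in ?M. (norm (?e y x))\<^sup>2 = 0"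
    using sq[OF yW] by (subst (asm) integral_nonneg_eq_0_iff_AE) (auto simp: square_integrable_def)
  then show "AE x in ?M. ?e z x = ?e w x + ?e r x"
    using ae by eventually_elim (simp add: algebra_simps)
qed

end


section \<open>Reliability of the indicator\<close>

lemma norm_add_square_le:
  fixes a b :: "'a::real_inner"
  assumes "0 < t" "t < 1"
  shows "(norm (a + b))\<^sup>2 \<le> (norm a)\<^sup>2 / t + (norm b)\<^sup>2 / (1 - t)"
proof -
  have "0 \<le> (norm ((1 - t) *\<^sub>R a - t *\<^sub>R b))\<^sup>2" by simp
  also have "\<dots> = (1 - t) * (norm a)\<^sup>2 + t * (norm b)\<^sup>2 - t * (1 - t) * (norm (a + b))\<^sup>2"
    by (simp add: power2_norm_eq_inner inner_diff_left inner_diff_right inner_add_left inner_add_right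
        inner_commute algebra_simps)
  finally show ?thesis using assms by (simp add: field_simps)
qed

lemma L2_norm_add_square_le:
  fixes f g h :: "'a \<Rightarrow> 'b::euclidean_space"
  assumes "0 < t" "t < 1" and sq: "square_integrable M f" "square_integrable M g" "square_integrable M h"
    and ae: "AE x in M. f x = g x + h x"
  shows "(L2_norm M f)\<^sup>2 \<le> (L2_norm M g)\<^sup>2 / t + (L2_norm M h)\<^sup>2 / (1 - t)"
proof -
  have int: "integrable M (\<lambda>x. (norm (f x))\<^sup>2)" "integrable M (\<lambda>x. (norm (g x))\<^sup>2)" "integrable M (\<lambda>x. (norm (h x))\<^sup>2)"
    using sq by (auto simp: square_integrable_def)
  have "(LINT x|M. (norm (f x))\<^sup>2) \<le> (LINT x|M. (norm (g x))\<^sup>2 / t + (norm (h x))\<^sup>2 / (1 - t))"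
  proof (rule integral_mono_AE)
    show "AE x in M. (norm (f x))\<^sup>2 \<le> (norm (g x))\<^sup>2 / t + (norm (h x))\<^sup>2 / (1 - t)"
      using ae by eventually_elim (simp add: norm_add_square_le[OF assms(1,2)])
  qed (use int in auto)
  also have "\<dots> = (LINT x|M. (norm (g x))\<^sup>2) / t + (LINT x|M. (norm (h x))\<^sup>2) / (1 - t)"
    using int by simp
  finally show ?thesis by (simp add: L2_norm_square)
qed

lemma sum_le_sum_cover:
  fixes f :: "'b \<Rightarrow> real"
  assumes "finite A" "finite B" "\<And>b. b \<in> B \<Longrightarrow> f b \<ge> 0" "\<And>b. b \<in> B \<Longrightarrow> \<exists>a\<in>A. R a b"
  shows "(\<Sum>b\<in>B. f b) \<le> (\<Sum>a\<in>A. \<Sum>b\<in>{b \<in> B. R a b}. f b)"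
proof -
  have "f b \<le> (\<Sum>a\<in>{a \<in> A. R a b}. f b)" if b: "b \<in> B" for b
  proof -
    obtain a where "a \<in> {a \<in> A. R a b}" using assms(4)[OF b] by blast
    then show ?thesis
      using assms(1) assms(3)[OF b] by (intro member_le_sum) auto
  qed
  then have "(\<Sum>b\<in>B. f b) \<le> (\<Sum>b\<in>B. \<Sum>a\<in>{a \<in> A. R a b}. f b)" by (rule sum_mono)
  also have "\<dots> = (\<Sum>a\<in>A. \<Sum>b\<in>{b \<in> B. R a b}. f b)"
    using assms(1,2) by (rule sum.swap_restrict[symmetric])
  finally show ?thesis .
qed

context polyhedral_mesh
begin

lemma finite_faces: "finite (interior_faces \<T>)" "finite (dirichlet_faces \<Gamma>D \<T>)"
proof -
  have "finite (\<Union>K\<in>\<T>. {E. E facet_of K})"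
    using finite_mesh mesh_simplex finite_polytope_facets simplex_imp_polytope by blast
  then show "finite (interior_faces \<T>)" "finite (dirichlet_faces \<Gamma>D \<T>)"
    by (auto simp: interior_faces_def dirichlet_faces_def elim!: finite_subset[rotated])
qed

lemma diameter_facet_nonneg: "K \<in> \<T> \<Longrightarrow> E facet_of K \<Longrightarrow> diameter E \<ge> 0"
  using simplex_facet.compact_E[OF simplex_facet] by (intro diameter_ge_0 compact_imp_bounded)

lemma interior_face_facet: "E \<in> interior_faces \<T> \<Longrightarrow> \<exists>K\<in>\<T>. E facet_of K"
  and dirichlet_face_facet: "E \<in> dirichlet_faces \<Gamma>D \<T> \<Longrightarrow> \<exists>K\<in>\<T>. E facet_of K"
  by (auto simp: interior_faces_def dirichlet_faces_def)

lemmas face_facts = interior_face_facet dirichlet_face_facet diameter_facet_nonneg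

text \<open>The strain of \<open>u - w = (u - z) + (z - w)\<close> is split by Young's inequality with weights \<open>1/t\<close> and
  \<open>1/(1 - t)\<close>. Saturation bounds the first part by \<open>\<delta>\<^sup>2/t \<le> t\<close> times the left-hand side, which is
  absorbed; the second part is the strain of \<open>r\<close>.\<close>

lemma strain_error_le:
  assumes u: "u \<in> H1 \<Omega>"
    and rm: "residual_minimization \<mu> lam fam k \<Omega> \<T> u\<^sub>h \<sigma>\<^sub>h r w"
    and aux: "auxiliary_problem \<mu> lam fam k \<Omega> \<T> u\<^sub>h \<sigma>\<^sub>h z"
    and sat: "saturation \<delta> \<Omega> \<T> u z w" and \<delta>: "0 \<le> \<delta>" "\<delta> \<le> t" "0 < t" "t < 1"
  shows "strain_sq (\<lambda>x. u x - w x)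
    \<le> strain_sq r / (1 - t)\<^sup>2"
proof -
  define N where "N v = strain_sq v" for v
  let ?uw = "\<lambda>x. u x - w x" and ?uz = "\<lambda>x. u x - z x"
  have w: "w \<in> broken_polys \<Omega> \<T> (local_degree fam k)" and z: "z \<in> broken_polys \<Omega> \<T> (local_degree fam k + 1)"
    using rm aux by (auto simp: residual_minimization_def auxiliary_problem_def Let_def)
  have H: "u \<in> H1 (interior K)" "w \<in> H1 (interior K)" "z \<in> H1 (interior K)" "r \<in> H1 (interior K)"
    "?uw \<in> H1 (interior K)" "?uz \<in> H1 (interior K)" if K: "K \<in> \<T>" for K
  proof -
    show "u \<in> H1 (interior K)" "w \<in> H1 (interior K)" "z \<in> H1 (interior K)" "r \<in> H1 (interior K)"
      using H1_interior[OF u K] broken_polys_H1[OF _ K] w z eps_auxiliary_solution(1)[OF rm aux K] by auto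
    then show "?uw \<in> H1 (interior K)" "?uz \<in> H1 (interior K)"
      by (auto intro!: H1_diff bounded_interior[OF K])
  qed
  have "N ?uw \<le> (\<Sum>K\<in>\<T>. (L2_norm (lebesgue_on K) (eps (interior K) ?uz))\<^sup>2 / t
      + (L2_norm (lebesgue_on K) (eps (interior K) r))\<^sup>2 / (1 - t))"
    unfolding N_def
  proof (rule sum_mono)
    fix K assume K: "K \<in> \<T>"
    note D = open_interior[of K] bounded_interior[OF K]
    have "AE x in lebesgue_on (interior K). eps (interior K) ?uw x = eps (interior K) ?uz x + eps (interior K) r x"
      using eps_diff[OF D H(1,2)[OF K]] eps_diff[OF D H(1,3)[OF K]] eps_auxiliary_solution(2)[OF rm aux K]
      by eventually_elim simp
    then show "(L2_norm (lebesgue_on K) (eps (interior K) ?uw))\<^sup>2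
      \<le> (L2_norm (lebesgue_on K) (eps (interior K) ?uz))\<^sup>2 / t + (L2_norm (lebesgue_on K) (eps (interior K) r))\<^sup>2 / (1 - t)"
      unfolding L2_norm_mesh_simplex[OF K]
      by (intro L2_norm_add_square_le \<delta> square_integrable_eps H K)
  qed
  also have "\<dots> = N ?uz / t + N r / (1 - t)"
    by (simp add: N_def sum.distrib sum_divide_distrib)
  also have "N ?uz / t \<le> t * N ?uw"
  proof -
    have "L2_norm (lebesgue_on \<Omega>) (broken_eps \<T> ?uz) \<le> t * L2_norm (lebesgue_on \<Omega>) (broken_eps \<T> ?uw)"
      by (rule order_trans[OF sat[unfolded saturation_def] mult_right_mono[OF \<delta>(2) L2_norm_nonneg]])
    then have "(L2_norm (lebesgue_on \<Omega>) (broken_eps \<T> ?uz))\<^sup>2 \<le> (t * L2_norm (lebesgue_on \<Omega>) (broken_eps \<T> ?uw))\<^sup>2"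
      by (intro power_mono L2_norm_nonneg)
    then have "N ?uz \<le> t\<^sup>2 * N ?uw"
      using H by (simp add: L2_norm_broken_eps N_def power_mult_distrib)
    then show ?thesis using \<delta> by (simp add: divide_le_eq power2_eq_square mult_ac)
  qed
  finally have "(1 - t) * N ?uw \<le> N r / (1 - t)" by (simp add: algebra_simps)
  then have "N ?uw \<le> (N r / (1 - t)) / (1 - t)" using \<delta> by (simp add: le_divide_eq mult.commute)
  then have "N ?uw \<le> N r / (1 - t)\<^sup>2" by (simp add: power2_eq_square)
  then show ?thesis by (simp add: N_def)
qed

text \<open>As \<open>\<C>\<sigma> = \<epsilon>(u)\<close>, the strain \<open>\<epsilon>(w)\<close> splits \<open>\<C>(\<sigma> - \<sigma>\<^sub>h)\<close> into the strain error and a computable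
  term.\<close>

lemma stress_error_le:
  assumes u: "u \<in> H1 \<Omega>" and w: "w \<in> broken_polys \<Omega> \<T> m"
    and \<sigma>: "square_integrable (lebesgue_on \<Omega>) \<sigma>" and \<sigma>\<^sub>h: "square_integrable (lebesgue_on \<Omega>) \<sigma>\<^sub>h"
    and hooke: "AE x in lebesgue_on \<Omega>. compliance \<mu> lam (\<sigma> x) - eps \<Omega> u x = 0"
    and B: "\<And>\<tau> :: real^'d^'d. norm \<tau> \<le> B * norm (compliance \<mu> lam \<tau>)"
  shows "(L2_norm (lebesgue_on \<Omega>) (\<lambda>x. \<sigma> x - \<sigma>\<^sub>h x))\<^sup>2
    \<le> 2 * B\<^sup>2 * (strain_sq (\<lambda>x. u x - w x)
      + hooke_residual_sq \<mu> lam \<sigma>\<^sub>h w)"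
proof -
  let ?uw = "\<lambda>x. u x - w x"
  let ?a = "\<lambda>K. (L2_norm (lebesgue_on K) (eps (interior K) ?uw))\<^sup>2"
  let ?b = "\<lambda>K. (L2_norm (lebesgue_on K) (\<lambda>x. compliance \<mu> lam (\<sigma>\<^sub>h x) - eps (interior K) w x))\<^sup>2"
  have diff: "square_integrable (lebesgue_on \<Omega>) (\<lambda>x. \<sigma> x - \<sigma>\<^sub>h x)"
    by (rule square_integrable_diff[OF \<sigma> \<sigma>\<^sub>h])
  have "(L2_norm (lebesgue_on \<Omega>) (\<lambda>x. \<sigma> x - \<sigma>\<^sub>h x))\<^sup>2 = (\<Sum>K\<in>\<T>. (L2_norm (lebesgue_on (interior K)) (\<lambda>x. \<sigma> x - \<sigma>\<^sub>h x))\<^sup>2)"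
    using diff by (intro L2_norm_mesh square_integrable_piece)
  also have "\<dots> \<le> (\<Sum>K\<in>\<T>. B\<^sup>2 * (2 * (?a K + ?b K)))"
  proof (rule sum_mono)
    fix K assume K: "K \<in> \<T>"
    let ?M = "lebesgue_on (interior K)"
    note D = open_interior[of K] bounded_interior[OF K]
    have uK: "u \<in> H1 (interior K)" and wK: "w \<in> H1 (interior K)"
      using H1_interior[OF u K] broken_polys_H1[OF w K] by auto
    define c where "c x = compliance \<mu> lam (\<sigma> x - \<sigma>\<^sub>h x)" for x
    define e where "e x = eps (interior K) w x - compliance \<mu> lam (\<sigma>\<^sub>h x)" for x
    have sq: "square_integrable ?M c" "square_integrable ?M e" "square_integrable ?M (eps (interior K) ?uw)"
      "square_integrable ?M (\<lambda>x. compliance \<mu> lam (\<sigma>\<^sub>h x) - eps (interior K) w x)"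
      unfolding c_def[abs_def] e_def[abs_def] using square_integrable_piece[OF diff K] square_integrable_piece[OF \<sigma>\<^sub>h K]
      by (auto intro!: square_integrable_linear[OF _ linear_compliance] square_integrable_diff square_integrable_eps wK H1_diff D uK)
    have "AE x in ?M. compliance \<mu> lam (\<sigma> x) - eps \<Omega> u x = 0"
      by (rule AE_lebesgue_on_subset[OF hooke interior_subset_\<Omega>[OF K]]) (use open_\<Omega> in auto)
    moreover have "AE x in ?M. weak_grad (interior K) u x = weak_grad \<Omega> u x"
      by (intro weak_grad_AE_eq D has_weak_grad_subset[OF _ open_\<Omega> interior_subset_\<Omega>[OF K]] H1_weak_grad u)
    ultimately have "AE x in ?M. c x = eps (interior K) ?uw x + e x"
      using eps_diff[OF D uK wK]
      by eventually_elim (simp add: c_def e_def linear_diff[OF linear_compliance] eps_eq)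
    from L2_norm_add_square_le[OF _ _ sq(1,3,2) this, of "1/2"]
    have "(L2_norm ?M c)\<^sup>2 \<le> 2 * ((L2_norm ?M (eps (interior K) ?uw))\<^sup>2 + (L2_norm ?M e)\<^sup>2)"
      by simp
    moreover have "L2_norm ?M e = L2_norm ?M (\<lambda>x. compliance \<mu> lam (\<sigma>\<^sub>h x) - eps (interior K) w x)"
      by (rule L2_norm_cong_AE[OF sq(2,4)]) (auto simp: e_def norm_minus_commute)
    ultimately have c: "(L2_norm ?M c)\<^sup>2 \<le> 2 * (?a K + ?b K)"
      by (simp add: L2_norm_mesh_simplex[OF K])
    have "(L2_norm ?M (\<lambda>x. \<sigma> x - \<sigma>\<^sub>h x))\<^sup>2 \<le> B\<^sup>2 * (L2_norm ?M c)\<^sup>2"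
      unfolding L2_norm_square integral_mult_right_zero[symmetric]
    proof (rule integral_mono)
      show "integrable ?M (\<lambda>x. (norm (\<sigma> x - \<sigma>\<^sub>h x))\<^sup>2)" "integrable ?M (\<lambda>x. B\<^sup>2 * (norm (c x))\<^sup>2)"
        using square_integrable_piece[OF diff K] sq(1) by (auto simp: square_integrable_def)
      fix x
      have "(norm (\<sigma> x - \<sigma>\<^sub>h x))\<^sup>2 \<le> (B * norm (c x))\<^sup>2"
        unfolding c_def by (intro power_mono B) auto
      then show "(norm (\<sigma> x - \<sigma>\<^sub>h x))\<^sup>2 \<le> B\<^sup>2 * (norm (c x))\<^sup>2" by (simp add: power_mult_distrib)
    qed
    also have "\<dots> \<le> B\<^sup>2 * (2 * (?a K + ?b K))" using c by (intro mult_left_mono) auto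
    finally show "(L2_norm ?M (\<lambda>x. \<sigma> x - \<sigma>\<^sub>h x))\<^sup>2 \<le> B\<^sup>2 * (2 * (?a K + ?b K))" .
  qed
  also have "\<dots> = 2 * B\<^sup>2 * ((\<Sum>K\<in>\<T>. ?a K) + (\<Sum>K\<in>\<T>. ?b K))"
    by (simp add: sum.distrib flip: sum_distrib_left)
  finally show ?thesis .
qed

lemma h_norm_error_le:
  assumes u: "u \<in> H1_vanishing \<Omega> \<Gamma>D" and w: "w \<in> broken_polys \<Omega> \<T> m"
  shows "(h_norm \<Gamma>D \<T> (\<lambda>x. u x - w x))\<^sup>2
    \<le> strain_sq (\<lambda>x. u x - w x)
      + jump_sq w
      + dirichlet_sq w"
proof -
  let ?uw = "\<lambda>x. u x - w x"
  have uH: "u \<in> H1 \<Omega>" using u by (simp add: H1_vanishing_def)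
  have J0: "0 \<le> jump_sq v" and D0: "0 \<le> dirichlet_sq v" for v
    using face_facts
    by (auto intro!: sum_nonneg divide_nonneg_nonneg)
  have "jump_sq ?uw \<le> jump_sq w"
    using interior_face_facet diameter_facet_nonneg
    by (intro sum_mono divide_right_mono power_mono jump_error_le[OF w uH] L2_norm_nonneg) auto
  moreover have "dirichlet_sq ?uw = dirichlet_sq w"
    by (intro sum.cong refl) (simp add: boundary_trace_error[OF w u])
  moreover have "0 \<le> strain_sq ?uw"
    by (intro sum_nonneg) auto
  ultimately show ?thesis
    unfolding h_norm_def using J0[of ?uw] D0[of ?uw] by simp
qed

lemma local_indicator_sq_nonneg: "\<mu> > 0 \<Longrightarrow> 0 \<le> local_indicator_sq \<mu> lam \<Gamma>D \<T> \<sigma>\<^sub>h r w K"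
  unfolding local_indicator_sq_def using face_facts
  by (intro add_nonneg_nonneg mult_nonneg_nonneg sum_nonneg divide_nonneg_nonneg) auto

lemma error_indicator_ge:
  assumes "\<mu> > 0"
  shows "\<mu> * strain_sq r
      + \<mu> * hooke_residual_sq \<mu> lam \<sigma>\<^sub>h w
      + \<mu> / 2 * jump_sq w
      + \<mu> * dirichlet_sq w
    \<le> (error_indicator \<mu> lam \<Gamma>D \<T> \<sigma>\<^sub>h r w)\<^sup>2"
proof -
  \<comment> \<open>Each face belongs to some simplex, so the sums over simplices run at least once over all faces.\<close>
  let ?j = "\<lambda>E. (L2_norm (face_measure E) (jump \<T> E w))\<^sup>2 / diameter E"
  let ?d = "\<lambda>E. (L2_norm (face_measure E) (boundary_trace \<T> E w))\<^sup>2 / diameter E"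
  let ?A = "\<lambda>K. (L2_norm (lebesgue_on K) (eps (interior K) r))\<^sup>2"
  let ?B = "\<lambda>K. (L2_norm (lebesgue_on K) (\<lambda>x. compliance \<mu> lam (\<sigma>\<^sub>h x) - eps (interior K) w x))\<^sup>2"
  have pos: "?j E \<ge> 0" "?d E \<ge> 0" if "\<exists>K\<in>\<T>. E facet_of K" for E
    using that diameter_facet_nonneg by auto
  have j: "(\<Sum>E\<in>interior_faces \<T>. ?j E) \<le> (\<Sum>K\<in>\<T>. \<Sum>E\<in>{E \<in> interior_faces \<T>. E facet_of K}. ?j E)"
    using pos(1) interior_face_facet by (intro sum_le_sum_cover finite_mesh finite_faces) auto
  have d: "(\<Sum>E\<in>dirichlet_faces \<Gamma>D \<T>. ?d E) \<le> (\<Sum>K\<in>\<T>. \<Sum>E\<in>{E \<in> dirichlet_faces \<Gamma>D \<T>. E facet_of K}. ?d E)"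
    using pos(2) dirichlet_face_facet by (intro sum_le_sum_cover finite_mesh finite_faces) auto
  have "0 \<le> (\<Sum>K\<in>\<T>. local_indicator_sq \<mu> lam \<Gamma>D \<T> \<sigma>\<^sub>h r w K)"
    by (rule sum_nonneg) (rule local_indicator_sq_nonneg[OF assms])
  then have "(error_indicator \<mu> lam \<Gamma>D \<T> \<sigma>\<^sub>h r w)\<^sup>2 = (\<Sum>K\<in>\<T>. local_indicator_sq \<mu> lam \<Gamma>D \<T> \<sigma>\<^sub>h r w K)"
    by (simp add: error_indicator_def)
  also have "\<dots> = \<mu> * (\<Sum>K\<in>\<T>. ?A K) + \<mu> * (\<Sum>K\<in>\<T>. ?B K)
    + \<mu> / 2 * (\<Sum>K\<in>\<T>. \<Sum>E\<in>{E \<in> interior_faces \<T>. E facet_of K}. ?j E)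
    + \<mu> * (\<Sum>K\<in>\<T>. \<Sum>E\<in>{E \<in> dirichlet_faces \<Gamma>D \<T>. E facet_of K}. ?d E)"
    unfolding local_indicator_sq_def by (simp add: sum.distrib sum_distrib_left)
  finally have eq: "(error_indicator \<mu> lam \<Gamma>D \<T> \<sigma>\<^sub>h r w)\<^sup>2 = \<dots>" .
  show ?thesis
    unfolding eq using assms j d by (intro add_mono mult_left_mono order_refl) auto
qed

text \<open>With \<open>q = 1 / (1 - t)\<^sup>2\<close>, both error terms are bounded by the strain of \<open>r\<close> times \<open>q\<close> and by other
  terms of the indicator. The lower bound for \<open>t\<close> gives \<open>q \<ge> 2\<close>, which compensates for the weight \<open>1/2\<close> of
  the jumps in the indicator.\<close>

lemma error_le_indicator:
  assumes \<mu>: "0 < \<mu>" and B: "B > 0" "\<And>\<tau> :: real^'d^'d. norm \<tau> \<le> B * norm (compliance \<mu> lam \<tau>)"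
    and \<delta>: "0 \<le> \<delta>" "\<delta> \<le> t" "1/2 \<le> t" "t < 1"
    and el: "elasticity_solution \<mu> lam \<Omega> \<Gamma>D \<Gamma>N f g u \<sigma>"
    and disc: "discrete_solution \<mu> lam fam k S \<Omega> \<Gamma>N \<T> f g u\<^sub>h \<sigma>\<^sub>h"
    and rm: "residual_minimization \<mu> lam fam k \<Omega> \<T> u\<^sub>h \<sigma>\<^sub>h r w"
    and aux: "auxiliary_problem \<mu> lam fam k \<Omega> \<T> u\<^sub>h \<sigma>\<^sub>h z"
    and sat: "saturation \<delta> \<Omega> \<T> u z w"
  shows "\<mu> powr (-1/2) * L2_norm (lebesgue_on \<Omega>) (\<lambda>x. \<sigma> x - \<sigma>\<^sub>h x)
      + \<mu> powr (1/2) * h_norm \<Gamma>D \<T> (\<lambda>x. u x - w x)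
    \<le> (B * sqrt 2 / \<mu> + 1) / (1 - t) * error_indicator \<mu> lam \<Gamma>D \<T> \<sigma>\<^sub>h r w"
proof -
  have t: "0 < t" using \<delta> by simp
  define q where "q = 1 / (1 - t)\<^sup>2"
  have q: "q \<ge> 2"
  proof -
    have "(1 - t)\<^sup>2 \<le> (1/2)\<^sup>2" using \<delta> by (intro power_mono) auto
    moreover have "(1 - t)\<^sup>2 > 0" using \<delta> by simp
    ultimately show ?thesis unfolding q_def by (simp add: le_divide_eq power2_eq_square)
  qed
  have u: "u \<in> H1_vanishing \<Omega> \<Gamma>D" "u \<in> H1 \<Omega>"
    and \<sigma>: "square_integrable (lebesgue_on \<Omega>) \<sigma>"
    and hooke: "AE x in lebesgue_on \<Omega>. compliance \<mu> lam (\<sigma> x) - eps \<Omega> u x = 0"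
    using el by (auto simp: elasticity_solution_def H1_vanishing_def Hdiv_sym_def)
  have \<sigma>\<^sub>h: "square_integrable (lebesgue_on \<Omega>) \<sigma>\<^sub>h"
    using disc by (auto simp: discrete_solution_def stress_space_traction_def stress_space_def Hdiv_sym_def)
  have w: "w \<in> broken_polys \<Omega> \<T> (local_degree fam k)"
    using rm by (simp add: residual_minimization_def Let_def)
  define X where "X = strain_sq (\<lambda>x. u x - w x)"
  define R where "R = strain_sq r"
  define A where "A = hooke_residual_sq \<mu> lam \<sigma>\<^sub>h w"
  define J where "J = jump_sq w"
  define D where "D = dirichlet_sq w"
  define \<eta> where "\<eta> = error_indicator \<mu> lam \<Gamma>D \<T> \<sigma>\<^sub>h r w"
  define s where "s = L2_norm (lebesgue_on \<Omega>) (\<lambda>x. \<sigma> x - \<sigma>\<^sub>h x)"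
  define h where "h = h_norm \<Gamma>D \<T> (\<lambda>x. u x - w x)"
  have nonneg: "R \<ge> 0" "A \<ge> 0" "J \<ge> 0" "D \<ge> 0"
    unfolding R_def A_def J_def D_def using face_facts
    by (auto intro!: sum_nonneg divide_nonneg_nonneg)
  have X: "X \<le> q * R"
    using strain_error_le[OF u(2) rm aux sat \<delta>(1,2) t \<delta>(4)] by (simp add: X_def R_def q_def)
  have s: "s\<^sup>2 \<le> 2 * B\<^sup>2 * (X + A)"
    using stress_error_le[OF u(2) w \<sigma> \<sigma>\<^sub>h hooke B(2)] by (simp add: s_def X_def A_def)
  have h: "h\<^sup>2 \<le> X + J + D"
    using h_norm_error_le[OF u(1) w] by (simp add: h_def X_def J_def D_def)
  have \<eta>: "\<mu> * R + \<mu> * A + \<mu> / 2 * J + \<mu> * D \<le> \<eta>\<^sup>2"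
    using error_indicator_ge[OF \<mu>] by (simp add: \<eta>_def R_def A_def J_def D_def)
  have terms: "0 \<le> \<mu> * R" "0 \<le> \<mu> * A" "0 \<le> \<mu> / 2 * J" "0 \<le> \<mu> * D" using nonneg \<mu> by auto
  have pos: "\<eta> \<ge> 0" "s \<ge> 0"
  proof -
    show "s \<ge> 0" by (simp add: s_def L2_norm_nonneg)
    show "\<eta> \<ge> 0" using local_indicator_sq_nonneg[OF \<mu>] by (simp add: \<eta>_def error_indicator_def sum_nonneg)
  qed
  have "sqrt \<mu> * h \<le> sqrt q * \<eta>"
  proof (rule power2_le_imp_le)
    have "\<mu> * h\<^sup>2 \<le> \<mu> * (q * R + J + D)" using h X \<mu> by (intro mult_left_mono) auto
    also have "\<dots> = q * (\<mu> * R) + 2 * (\<mu> / 2 * J) + 1 * (\<mu> * D)" by (simp add: algebra_simps)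
    also have "\<dots> \<le> q * (\<mu> * R) + q * (\<mu> / 2 * J) + q * (\<mu> * D)"
      using q terms by (intro add_mono mult_right_mono order_refl) auto
    also have "\<dots> = q * (\<mu> * R + \<mu> / 2 * J + \<mu> * D)" by (simp only: distrib_left)
    also have "\<dots> \<le> q * \<eta>\<^sup>2"
      using \<eta> terms q by (intro mult_left_mono) linarith+
    finally show "(sqrt \<mu> * h)\<^sup>2 \<le> (sqrt q * \<eta>)\<^sup>2" using \<mu> q by (simp add: power_mult_distrib)
  qed (use q pos in auto)
  moreover have "s / sqrt \<mu> \<le> B * sqrt (2 * q) / \<mu> * \<eta>"
  proof (rule power2_le_imp_le)
    have "\<mu> * s\<^sup>2 \<le> \<mu> * (2 * B\<^sup>2 * (q * R + A))"
      using s X \<mu> by (intro mult_left_mono order_trans[OF s]) auto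
    also have "\<dots> = 2 * B\<^sup>2 * (q * (\<mu> * R) + 1 * (\<mu> * A))" by (simp add: algebra_simps)
    also have "\<dots> \<le> 2 * B\<^sup>2 * (q * (\<mu> * R) + q * (\<mu> * A))"
      using q terms by (intro mult_left_mono add_mono mult_right_mono order_refl) auto
    also have "\<dots> = 2 * B\<^sup>2 * (q * (\<mu> * R + \<mu> * A))" by (simp only: distrib_left)
    also have "\<dots> \<le> 2 * B\<^sup>2 * (q * \<eta>\<^sup>2)"
    proof (intro mult_left_mono)
      show "\<mu> * R + \<mu> * A \<le> \<eta>\<^sup>2" using \<eta> terms by linarith
    qed (use q in auto)
    finally have "\<mu> * s\<^sup>2 \<le> B\<^sup>2 * (2 * q) * \<eta>\<^sup>2" by (simp add: algebra_simps)
    then have "s\<^sup>2 / \<mu> \<le> B\<^sup>2 * (2 * q) * \<eta>\<^sup>2 / \<mu>\<^sup>2"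
      using \<mu> by (simp add: field_simps power2_eq_square)
    then show "(s / sqrt \<mu>)\<^sup>2 \<le> (B * sqrt (2 * q) / \<mu> * \<eta>)\<^sup>2"
      using \<mu> q by (simp add: power_mult_distrib power_divide)
  qed (use B q pos \<mu> in auto)
  moreover have "\<mu> powr (1/2) = sqrt \<mu>" "\<mu> powr (-1/2) = 1 / sqrt \<mu>"
    using \<mu> powr_minus_divide[of \<mu> "1/2"] by (simp_all add: powr_half_sqrt)
  moreover have "sqrt q = 1 / (1 - t)" "sqrt (2 * q) = sqrt 2 / (1 - t)"
    using \<delta> by (simp_all add: q_def real_sqrt_divide)
  ultimately show ?thesis
    by (simp add: s_def h_def \<eta>_def add_divide_distrib distrib_right mult.commute[of \<mu>])
qed

end

theorem theorem4p4:
  fixes \<Omega> \<Gamma>D \<Gamma>N :: "(real^'d) set"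
    and fam :: family and k :: nat
    and S :: "(real^'d) set \<Rightarrow> 'd mfield set"
    and \<delta> :: real
  assumes "CARD('d) \<in> {2, 3}"
    and "polyhedral_domain \<Omega>" and "boundary_split \<Omega> \<Gamma>D \<Gamma>N"
    and "family_ok fam CARD('d) k"
    and "0 \<le> \<delta>" and "\<delta> < 1"
  shows "\<forall>\<mu>>0. \<forall>lam>0. \<exists>C>0. \<forall>\<T> f g u \<sigma> u\<^sub>h \<sigma>\<^sub>h r\<^sub>h w\<^sub>h z\<^sub>h.
     mesh \<Omega> \<Gamma>D \<Gamma>N \<T> \<longrightarrow> mixed_element fam k S \<Omega> \<T> \<longrightarrow>
     square_integrable (lebesgue_on \<Omega>) f \<longrightarrow> L2_traction \<Omega> \<Gamma>N g \<longrightarrow>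
     elasticity_solution \<mu> lam \<Omega> \<Gamma>D \<Gamma>N f g u \<sigma> \<longrightarrow>
     discrete_solution \<mu> lam fam k S \<Omega> \<Gamma>N \<T> f g u\<^sub>h \<sigma>\<^sub>h \<longrightarrow>
     residual_minimization \<mu> lam fam k \<Omega> \<T> u\<^sub>h \<sigma>\<^sub>h r\<^sub>h w\<^sub>h \<longrightarrow>
     auxiliary_problem \<mu> lam fam k \<Omega> \<T> u\<^sub>h \<sigma>\<^sub>h z\<^sub>h \<longrightarrow>
     saturation \<delta> \<Omega> \<T> u z\<^sub>h w\<^sub>h \<longrightarrow>
     \<mu> powr (-1/2) * L2_norm (lebesgue_on \<Omega>) (\<lambda>x. \<sigma> x - \<sigma>\<^sub>h x)
       + \<mu> powr (1/2) * h_norm \<Gamma>D \<T> (\<lambda>x. u x - w\<^sub>h x)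
     \<le> C * error_indicator \<mu> lam \<Gamma>D \<T> \<sigma>\<^sub>h r\<^sub>h w\<^sub>h"
proof (intro allI impI, goal_cases)
  case (1 \<mu> lam)
  obtain B where B: "B > 0" "\<And>\<tau> :: real^'d^'d. norm \<tau> \<le> B * norm (compliance \<mu> lam \<tau>)"
    using compliance_bounded_below[OF 1] by blast
  \<comment> \<open>Saturation remains valid for larger factors; a factor of at least \<open>1/2\<close> makes \<open>1 / (1 - t)\<^sup>2 \<ge> 2\<close>.\<close>
  define t where "t = max \<delta> (1/2)"
  have t: "0 \<le> \<delta>" "\<delta> \<le> t" "1/2 \<le> t" "t < 1" using assms by (auto simp: t_def)
  show ?case
  proof (intro exI[of _ "(B * sqrt 2 / \<mu> + 1) / (1 - t)"] conjI allI impI, goal_cases)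
    case 1
    show ?case using B \<open>0 < \<mu>\<close> t by (intro divide_pos_pos add_pos_pos) auto
  next
    case (2 \<T> f g u \<sigma> u\<^sub>h \<sigma>\<^sub>h r\<^sub>h w\<^sub>h z\<^sub>h)
    interpret polyhedral_mesh \<Omega> \<Gamma>D \<Gamma>N \<T>
      using assms(2) 2(1) by unfold_locales
    show ?case
      by (rule error_le_indicator[OF \<open>0 < \<mu>\<close> B t 2(5-9)])
  qed
qed

end
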